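(* Let $d\ge 1$ and $k\ge 1$ be fixed integers, let $f$ be a bounded probability density on $\mathbb{R}^d$, and let $X_1,X_2,\ldots$ be i.i.d. random points in $\mathbb{R}^d$ with density $f$. Let $\delta>0$ and let $(r_n)_{n\ge1}$ be a sequence of positive numbers with $r_n=o\left(n^{-1/d-\delta}\right)$ and $n^{k+2}r_n^{d(k+1)}\to\infty$ as $n\to\infty$. Let $\beta_k$ be the $k$-th Betti number of the random Čech complex $\mathcal{C}(X_1,\ldots,X_n)$ with radius parameter $r_n$. Then, as $n\to\infty$, $$\frac{1}{\sqrt{n(nr_n^d)^{k+1}}}\Big(\beta_k-\mathbb{E}[\beta_k]\Big)\Longrightarrow \mathcal{N}\left(0,\frac{\mu_{k+2,1}}{(k+2)!}\right),$$ where $\Longrightarrow$ denotes convergence in distribution and $\mu_{k+2,1}$ is the constant defined in the context.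
   Context: For a finite set $\{x_1,\ldots,x_i\}\subset\mathbb{R}^d$, the Čech complex $\mathcal{C}(x_1,\ldots,x_i)$ with radius parameter $r_n$ is the simplicial complex with vertex set $\{x_1,\ldots,x_i\}$ in which a subset of vertices is a face if and only if the balls of radius $r_n$ centered at these vertices have a common point. Betti numbers are dimensions of homology groups with rational coefficients. The constant $\mu_{k+2,1}$ is $$\mu_{k+2,1}=\lim_{n\to\infty} r_n^{-d(k+1)}\,\mathbb{P}\big[\mathcal{C}(X_1,\ldots,X_{k+2})\text{ is connected and has }k\text{-th Betti number equal to }1\big],$$ where $X_1,\ldots,X_{k+2}$ are i.i.d. with density $f$ and the complex is taken with radius parameter $r_n$; this limit exists and does not depend on the sequence $r_n\to0$. A normal distribution of variance $0$ means the point mass at $0$. *)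

theory Defs
  imports
    "HOL-Probability.Probability"
    "HOL-Combinatorics.Permutations"
    "Jordan_Normal_Form.Missing_VectorSpace"
begin

section \<open>Rational simplicial homology\<close>

text \<open>A finite abstract simplicial complex is represented by the set \<open>K\<close> of its (nonempty) faces.
  Its vertex set is \<open>\<Union>K\<close>.

  An oriented \<open>k\<close>-chain is a function on ordered \<open>k\<close>-simplices, given as lists
  \<open>[v\<^sub>0, \<dots>, v\<^sub>k]\<close> of distinct vertices, that changes by the sign of the permutation when the vertices
  are permuted. The elementary chain of the oriented simplex \<open>[v\<^sub>0, \<dots>, v\<^sub>k]\<close> has the value
  \<open>sign \<pi>\<close> at \<open>[v\<^sub>\<pi>\<^sub>0, \<dots>, v\<^sub>\<pi>\<^sub>k]\<close>, and vanishes elsewhere.\<close>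

definition oriented_chains :: "'v set set \<Rightarrow> nat \<Rightarrow> ('v list \<Rightarrow> rat) set" where
  "oriented_chains K k = {c.
     (\<forall>l. c l \<noteq> 0 \<longrightarrow> length l = k + 1 \<and> distinct l \<and> set l \<in> K) \<and>
     (\<forall>l \<pi>. \<pi> permutes {..<length l} \<longrightarrow> c (permute_list \<pi> l) = of_int (sign \<pi>) * c l)}"

text \<open>In terms of coefficients, the boundary operator
  \<open>\<partial>[v\<^sub>0, \<dots>, v\<^sub>k] = (\<Sum>i\<le>k. (-1)\<^sup>i [v\<^sub>0, \<dots>, v\<^sub>i\<^sub>-\<^sub>1, v\<^sub>i\<^sub>+\<^sub>1, \<dots>, v\<^sub>k])\<close> collects at \<open>l\<close> the coefficients of
  all \<open>v # l\<close>: moving \<open>v\<^sub>i\<close> to the front has sign \<open>(-1)\<^sup>i\<close>. The value at \<open>[]\<close> is set to \<open>0\<close> because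
  the homology is not reduced: the boundary of a \<open>0\<close>-chain is zero.\<close>

definition boundary :: "'v set set \<Rightarrow> ('v list \<Rightarrow> rat) \<Rightarrow> ('v list \<Rightarrow> rat)" where
  "boundary K c = (\<lambda>l. if l = [] then 0 else \<Sum>v\<in>\<Union>K. c (v # l))"

definition cycles :: "'v set set \<Rightarrow> nat \<Rightarrow> ('v list \<Rightarrow> rat) set" where
  "cycles K k = {c \<in> oriented_chains K k. boundary K c = (\<lambda>l. 0)}"

definition boundaries :: "'v set set \<Rightarrow> nat \<Rightarrow> ('v list \<Rightarrow> rat) set" where
  "boundaries K k = boundary K ` oriented_chains K (k + 1)"

definition homology_class :: "'v set set \<Rightarrow> nat \<Rightarrow> ('v list \<Rightarrow> rat) \<Rightarrow> ('v list \<Rightarrow> rat) set" where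
  "homology_class K k z = {(\<lambda>l. z l + b l) | b. b \<in> boundaries K k}"

abbreviation rat_field :: "rat ring" where
  "rat_field \<equiv> \<lparr>carrier = UNIV, monoid.mult = (*), one = 1, zero = 0, add = (+)\<rparr>"

text \<open>The quotient space of cycles by boundaries. The fields \<open>mult\<close> and \<open>one\<close> of the record are
  irrelevant for the vector space structure.\<close>

definition homology :: "'v set set \<Rightarrow> nat \<Rightarrow> (rat, ('v list \<Rightarrow> rat) set) module" where
  "homology K k =
    \<lparr>carrier = homology_class K k ` cycles K k,
     monoid.mult = undefined, one = undefined,
     zero = homology_class K k (\<lambda>l. 0),
     add = (\<lambda>C D. {(\<lambda>l. c l + d l) | c d. c \<in> C \<and> d \<in> D}),
     module.smult = (\<lambda>q C. {(\<lambda>l. q * c l + b l) | c b. c \<in> C \<and> b \<in> boundaries K k})\<rparr>"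

lemma boundary_boundary:
  assumes "c \<in> oriented_chains K k"
  shows "boundary K (boundary K c) = (\<lambda>l. 0)"
proof
  fix l
  have anti: "c (v # u # l) = - c (u # v # l)" for u v
  proof -
    let ?\<pi> = "Transposition.transpose 0 (1::nat)"
    have p: "?\<pi> permutes {..<length (u # v # l)}" by (intro permutes_swap_id) auto
    have "permute_list ?\<pi> (u # v # l) = v # u # l"
    proof (rule nth_equalityI)
      fix i assume "i < length (permute_list ?\<pi> (u # v # l))"
      then show "permute_list ?\<pi> (u # v # l) ! i = (v # u # l) ! i"
        using p by (simp add: permute_list_nth Transposition.transpose_def nth_Cons split: nat.split)
    qed simp
    moreover have "sign ?\<pi> = -1" by (simp add: sign_swap_id)
    ultimately show ?thesis
      using assms p unfolding oriented_chains_def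
      by (metis (mono_tags, lifting) mem_Collect_eq mult_minus1 of_int_minus of_int_1)
  qed
  have "(\<Sum>u\<in>\<Union>K. \<Sum>v\<in>\<Union>K. c (v # u # l)) = - (\<Sum>u\<in>\<Union>K. \<Sum>v\<in>\<Union>K. c (u # v # l))"
    unfolding sum_negf[symmetric] by (intro sum.cong refl anti)
  also have "(\<Sum>u\<in>\<Union>K. \<Sum>v\<in>\<Union>K. c (u # v # l)) = (\<Sum>u\<in>\<Union>K. \<Sum>v\<in>\<Union>K. c (v # u # l))"
    by (rule sum.swap)
  finally show "boundary K (boundary K c) l = 0" by (simp add: boundary_def)
qed

lemma oriented_chains_zero: "(\<lambda>l. 0) \<in> oriented_chains K k"
  by (simp add: oriented_chains_def)

lemma oriented_chains_comb: "c \<in> oriented_chains K k \<Longrightarrow> d \<in> oriented_chains K k \<Longrightarrow> (\<lambda>l. q * c l + p * d l) \<in> oriented_chains K k"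
proof -
  assume cd: "c \<in> oriented_chains K k" "d \<in> oriented_chains K k"
  have "c l \<noteq> 0 \<or> d l \<noteq> 0" if "q * c l + p * d l \<noteq> 0" for l
    using that by auto
  with cd show ?thesis
    unfolding oriented_chains_def mem_Collect_eq
    by (intro conjI allI impI) (metis, metis, metis, simp add: algebra_simps)
qed

lemma boundary_zero: "boundary K (\<lambda>l. 0) = (\<lambda>l. 0)"
  by (auto simp: boundary_def)

lemma boundary_comb:
  "boundary K (\<lambda>l. q * c l + p * d l) = (\<lambda>l. q * boundary K c l + p * boundary K d l)"
  by (auto simp: boundary_def sum.distrib sum_distrib_left fun_eq_iff)

lemma cycles_zero: "(\<lambda>l. 0) \<in> cycles K k"
  by (simp add: cycles_def oriented_chains_zero boundary_zero)

lemma cycles_comb: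
  assumes "c \<in> cycles K k" "d \<in> cycles K k"
  shows "(\<lambda>l. q * c l + p * d l) \<in> cycles K k"
proof -
  have "boundary K c = (\<lambda>l. 0)" "boundary K d = (\<lambda>l. 0)"
    using assms by (simp_all add: cycles_def)
  then have "boundary K (\<lambda>l. q * c l + p * d l) = (\<lambda>l. 0)"
    unfolding boundary_comb by simp
  moreover have "(\<lambda>l. q * c l + p * d l) \<in> oriented_chains K k"
    using assms by (intro oriented_chains_comb) (simp_all add: cycles_def)
  ultimately show ?thesis
    unfolding cycles_def by blast
qed

lemma boundaries_zero: "(\<lambda>l. 0) \<in> boundaries K k"
  unfolding boundaries_def
  by (rule image_eqI[where f = "boundary K", OF boundary_zero[symmetric] oriented_chains_zero])

lemma boundaries_comb:
  assumes "c \<in> boundaries K k" "d \<in> boundaries K k"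
  shows "(\<lambda>l. q * c l + p * d l) \<in> boundaries K k"
proof -
  obtain c' d' where c': "c' \<in> oriented_chains K (k + 1)" "c = boundary K c'"
    and d': "d' \<in> oriented_chains K (k + 1)" "d = boundary K d'"
    using assms unfolding boundaries_def by blast
  show ?thesis
    unfolding boundaries_def c'(2) d'(2)
    by (rule image_eqI[where f = "boundary K", OF boundary_comb[symmetric] oriented_chains_comb[OF c'(1) d'(1)]])
qed

lemma homology_class_add:
  "{(\<lambda>l. c l + d l) | c d. c \<in> homology_class K k z \<and> d \<in> homology_class K k w}
     = homology_class K k (\<lambda>l. z l + w l)" (is "?L = ?R")
proof
  show "?L \<subseteq> ?R"
  proof
    fix x assume "x \<in> ?L"
    then obtain b b' where b: "b \<in> boundaries K k" "b' \<in> boundaries K k"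
      and x: "x = (\<lambda>l. (z l + b l) + (w l + b' l))"
      unfolding homology_class_def by blast
    have "x = (\<lambda>l. (z l + w l) + (b l + b' l))" by (simp add: x algebra_simps)
    with boundaries_comb[OF b, of 1 1] show "x \<in> ?R"
      unfolding homology_class_def by auto
  qed
  show "?R \<subseteq> ?L"
  proof
    fix x assume "x \<in> ?R"
    then obtain b where b: "b \<in> boundaries K k" and x: "x = (\<lambda>l. (z l + w l) + b l)"
      unfolding homology_class_def by blast
    have "x = (\<lambda>l. (z l + b l) + (w l + 0))" by (simp add: x algebra_simps)
    moreover have "(\<lambda>l. z l + b l) \<in> homology_class K k z" 
      using b unfolding homology_class_def by blast
    moreover have "(\<lambda>l. w l + 0) \<in> homology_class K k w"
      unfolding homology_class_def
      by (rule CollectI, rule exI[of _ "\<lambda>l. 0"]) (simp add: boundaries_zero)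
    ultimately show "x \<in> ?L"
      by (intro CollectI exI[of _ "\<lambda>l. z l + b l"] exI[of _ "\<lambda>l. w l + 0"] conjI)
  qed
qed

lemma homology_class_smult:
  "{(\<lambda>l. q * c l + b l) | c b. c \<in> homology_class K k z \<and> b \<in> boundaries K k}
     = homology_class K k (\<lambda>l. q * z l)" (is "?L = ?R")
proof
  show "?L \<subseteq> ?R"
  proof
    fix x assume "x \<in> ?L"
    then obtain b b' where b: "b \<in> boundaries K k" "b' \<in> boundaries K k"
      and x: "x = (\<lambda>l. q * (z l + b l) + b' l)"
      unfolding homology_class_def by blast
    have "x = (\<lambda>l. q * z l + (q * b l + b' l))" by (simp add: x algebra_simps)
    with boundaries_comb[OF b, of q 1] show "x \<in> ?R"
      unfolding homology_class_def by auto
  qed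
  show "?R \<subseteq> ?L"
  proof
    fix x assume "x \<in> ?R"
    then obtain b where b: "b \<in> boundaries K k" and x: "x = (\<lambda>l. q * z l + b l)"
      unfolding homology_class_def by blast
    have "x = (\<lambda>l. q * (z l + 0) + b l)" by (simp add: x)
    moreover have "(\<lambda>l. z l + 0) \<in> homology_class K k z"
      unfolding homology_class_def
      by (rule CollectI, rule exI[of _ "\<lambda>l. 0"]) (simp add: boundaries_zero)
    ultimately show "x \<in> ?L" using b
      by (intro CollectI exI[of _ "\<lambda>l. z l + 0"] exI[of _ b] conjI)
  qed
qed

lemma homology_simps:
  "carrier (homology K k) = homology_class K k ` cycles K k"
  "\<zero>\<^bsub>homology K k\<^esub> = homology_class K k (\<lambda>l. 0)"
  "homology_class K k z \<oplus>\<^bsub>homology K k\<^esub> homology_class K k w = homology_class K k (\<lambda>l. z l + w l)"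
  "q \<odot>\<^bsub>homology K k\<^esub> homology_class K k z = homology_class K k (\<lambda>l. q * z l)"
  by (simp_all add: homology_def homology_class_add homology_class_smult)

lemma rat_field: "field rat_field"
proof (intro cring.cring_fieldI cringI abelian_groupI comm_monoidI)
  show "Units rat_field = carrier rat_field - {\<zero>\<^bsub>rat_field\<^esub>}"
    by (auto simp: Units_def) (metis right_inverse left_inverse)
next
  fix x :: rat
  have "- x \<oplus>\<^bsub>rat_field\<^esub> x = \<zero>\<^bsub>rat_field\<^esub>" by simp
  then show "\<exists>y\<in>carrier rat_field. y \<oplus>\<^bsub>rat_field\<^esub> x = \<zero>\<^bsub>rat_field\<^esub>"
    by (intro bexI[of _ "- x"]) simp_all
qed (simp_all add: algebra_simps)


lemma vectorspace_homology: "vectorspace rat_field (homology K k)"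
proof -
  have add: "(\<lambda>l. c l + d l) \<in> cycles K k" if "c \<in> cycles K k" "d \<in> cycles K k" for c d
    using cycles_comb[OF that, of 1 1] by simp
  have scale: "(\<lambda>l. q * c l) \<in> cycles K k" if "c \<in> cycles K k" for q c
    using cycles_comb[OF that that, of q 0] by simp
  have "Module.module rat_field (homology K k)"
  proof (intro moduleI abelian_groupI)
    show "cring rat_field" using rat_field by (simp add: field_def domain_def)
  next
    fix x assume "x \<in> carrier (homology K k)"
    then obtain z where z: "z \<in> cycles K k" "x = homology_class K k z" by (auto simp: homology_simps)
    have "homology_class K k (\<lambda>l. (-1) * z l) \<oplus>\<^bsub>homology K k\<^esub> x = \<zero>\<^bsub>homology K k\<^esub>"
      by (simp add: z homology_simps)
    moreover have "homology_class K k (\<lambda>l. (-1) * z l) \<in> carrier (homology K k)"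
      unfolding homology_simps by (intro imageI scale z)
    ultimately show "\<exists>y\<in>carrier (homology K k). y \<oplus>\<^bsub>homology K k\<^esub> x = \<zero>\<^bsub>homology K k\<^esub>" by blast
  qed (unfold homology_simps(1),
       (elim imageE, simp add: homology_simps add scale cycles_zero algebra_simps |
        simp add: homology_simps cycles_zero)+)
  then show ?thesis
    by (intro vectorspace.intro rat_field)
qed

definition betti :: "'v set set \<Rightarrow> nat \<Rightarrow> nat" where
  "betti K k = vectorspace.dim rat_field (homology K k)"

definition complex_connected :: "'v set set \<Rightarrow> bool" where
  "complex_connected K \<longleftrightarrow> (\<forall>u\<in>\<Union>K. \<forall>v\<in>\<Union>K. (u, v) \<in> {(x, y). {x, y} \<in> K}\<^sup>*)"


section \<open>Cech complexes\<close>

text \<open>The balls are closed.\<close>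

definition cech_complex :: "real \<Rightarrow> 'a::metric_space set \<Rightarrow> 'a set set" where
  "cech_complex r V = {\<sigma>. \<sigma> \<noteq> {} \<and> finite \<sigma> \<and> \<sigma> \<subseteq> V \<and> (\<Inter>x\<in>\<sigma>. cball x r) \<noteq> {}}"

text \<open>The constant \<open>\<mu>\<^bsub>k+2,1\<^esub>\<close>, for points \<open>X 1, X 2, \<dots>\<close> in \<open>\<real>\<^sup>d\<close> and radii \<open>r n\<close>. The limit
  exists, and depends only on \<open>k\<close> and the density, when the points are i.i.d. with a bounded density
  and the radii are positive (eventually) and tend to \<open>0\<close>.\<close>

definition cech_mu ::
  "'w measure \<Rightarrow> (nat \<Rightarrow> 'w \<Rightarrow> real ^ 'd) \<Rightarrow> (nat \<Rightarrow> real) \<Rightarrow> nat \<Rightarrow> real" where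
  "cech_mu M X r k = lim (\<lambda>n. r n powi (- int (CARD('d) * (k + 1))) *
     measure M {\<omega> \<in> space M.
       complex_connected (cech_complex (r n) ((\<lambda>i. X i \<omega>) ` {1..k+2})) \<and>
       betti (cech_complex (r n) ((\<lambda>i. X i \<omega>) ` {1..k+2})) k = 1})"


section \<open>Normal distributions\<close>

definition normal_distribution :: "real \<Rightarrow> real \<Rightarrow> real measure" where
  "normal_distribution m v =
    (if v = 0 then return borel m else density lborel (normal_density m (sqrt v)))"

end

theory Submission
  imports Defs
begin

text \<open>Let \<open>W\<close> count the \<open>(k+2)\<close>-element subsets of the sample that span an empty simplex: every proper
  subset is a face, the whole set is not. Such events are independent for disjoint index sets, so
  the Stein--Chen identity, read as a perturbed differential equation for the characteristic
  function, shows that \<open>W\<close> is close to a Poisson variable of the same mean \<open>\<lambda>\<^sub>n\<close> because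
  \<open>n r\<^sub>n\<^sup>d \<longlongrightarrow> 0\<close>. The excess \<open>\<beta>\<^sub>k - W\<close> is negligible: inserting a point changes it only if at
  least \<open>k+2\<close> other points lie within \<open>4 r\<^sub>n\<close>, and then by at most a power of their number, so
  by the Efron--Stein inequality its variance is of smaller order than \<open>n (n r\<^sub>n\<^sup>d)\<^sup>k\<^sup>+\<^sup>1\<close>. A complex
  on \<open>k+2\<close> points is connected with \<open>\<beta>\<^sub>k = 1\<close> exactly if it is an empty simplex; rescaling around
  one of the points and \<open>L\<^sup>1\<close>-continuity of translations show that \<open>\<lambda>\<^sub>n / (n (n r\<^sub>n\<^sup>d)\<^sup>k\<^sup>+\<^sup>1)\<close> tends to
  \<open>\<mu> / (k+2)!\<close>, and Levy's continuity theorem concludes.\<close>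

section \<open>Spaces of rational-valued functions\<close>

text \<open>The obvious quantity to count, isolated components on \<open>k+2\<close> points with
  \<open>\<beta>\<^sub>k = 1\<close>, is not dissociated: isolation depends on every other point.
  Whether \<open>k+2\<close> given points span an empty simplex depends on these points alone, so
  \<open>W\<close> uses this local event and all global geometry goes into the excess. A point with
  at most \<open>k+1\<close> others within \<open>4 r\<close> changes \<open>\<beta>\<^sub>k\<close>
  and \<open>W\<close> equally; hence each contribution to the variance of the excess needs
  \<open>k+2\<close> near points and carries one factor \<open>n r^d\<close> more than the
  normalisation \<open>S = n (n r^d)^(k+1)\<close>. No lower bound on the variance enters:
  everything is divided by \<open>S\<close>, not by the standard deviation, so the same estimates
  yield the point mass when \<open>\<mu>\<close> vanishes. Characteristic functions suit this
  scaling: at \<open>s = t / sqrt S\<close> the quantities \<open>l s^2\<close> and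
  \<open>s^2 b\<close> of the perturbation bound become \<open>t^2 l / S\<close>, which stays
  bounded, and \<open>t^2 b / S\<close>, which tends to 0.\<close>

definition fun_subspace :: "('a \<Rightarrow> rat) set \<Rightarrow> bool" where
  "fun_subspace A \<longleftrightarrow> (\<lambda>_. 0) \<in> A \<and> (\<forall>c\<in>A. \<forall>d\<in>A. \<forall>q p. (\<lambda>l. q * c l + p * d l) \<in> A)"

definition supported_funs :: "'a set \<Rightarrow> ('a \<Rightarrow> rat) set" where
  "supported_funs S = {a. \<forall>l. l \<notin> S \<longrightarrow> a l = 0}"

text \<open>Chains, cycles, boundaries and images of linear maps are all sets of rational functions
  with pointwise operations, so one structure parametrised by its carrier serves every dimension
  count; only homology is a genuine quotient.\<close>

definition fun_space :: "('a \<Rightarrow> rat) set \<Rightarrow> (rat, 'a \<Rightarrow> rat) module" where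
  "fun_space A = \<lparr>carrier = A, monoid.mult = undefined, one = undefined, zero = (\<lambda>_. 0),
     add = (\<lambda>c d l. c l + d l), module.smult = (\<lambda>q c l. q * c l)\<rparr>"

definition fun_dim :: "('a \<Rightarrow> rat) set \<Rightarrow> nat" where
  "fun_dim A = vectorspace.dim rat_field (fun_space A)"

definition fun_linear :: "('a \<Rightarrow> rat) set \<Rightarrow> (('a \<Rightarrow> rat) \<Rightarrow> ('b \<Rightarrow> rat)) \<Rightarrow> bool" where
  "fun_linear A T \<longleftrightarrow> (\<forall>c\<in>A. \<forall>d\<in>A. \<forall>q p. T (\<lambda>l. q * c l + p * d l) = (\<lambda>l. q * T c l + p * T d l))"

lemma fun_subspace_zero: "fun_subspace A \<Longrightarrow> (\<lambda>_. 0) \<in> A"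
  by (simp add: fun_subspace_def)

lemma fun_subspace_comb:
  "fun_subspace A \<Longrightarrow> c \<in> A \<Longrightarrow> d \<in> A \<Longrightarrow> (\<lambda>l. q * c l + p * d l) \<in> A"
  by (simp add: fun_subspace_def)

lemma fun_subspace_add:
  "fun_subspace A \<Longrightarrow> c \<in> A \<Longrightarrow> d \<in> A \<Longrightarrow> (\<lambda>l. c l + d l) \<in> A"
  using fun_subspace_comb[of A c d 1 1] by simp

lemma fun_subspace_scale:
  "fun_subspace A \<Longrightarrow> c \<in> A \<Longrightarrow> (\<lambda>l. q * c l) \<in> A"
  using fun_subspace_comb[of A c c q 0] by simp

lemma fun_space_simps [simp]:
  "carrier (fun_space A) = A" "\<zero>\<^bsub>fun_space A\<^esub> = (\<lambda>_. 0)"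
  "c \<oplus>\<^bsub>fun_space A\<^esub> d = (\<lambda>l. c l + d l)" "q \<odot>\<^bsub>fun_space A\<^esub> c = (\<lambda>l. q * c l)"
  by (simp_all add: fun_space_def)

lemma vectorspace_fun_space:
  assumes A: "fun_subspace A"
  shows "vectorspace rat_field (fun_space A)"
proof -
  have "Module.module rat_field (fun_space A)"
  proof (intro moduleI abelian_groupI)
    show "cring rat_field" using rat_field by (simp add: field_def domain_def)
  next
    fix x assume "x \<in> carrier (fun_space A)"
    then have "(\<lambda>l. - 1 * x l) \<in> carrier (fun_space A)"
      using fun_subspace_scale[OF A, of x "-1"] by simp
    then show "\<exists>y\<in>carrier (fun_space A). y \<oplus>\<^bsub>fun_space A\<^esub> x = \<zero>\<^bsub>fun_space A\<^esub>"
      by (intro bexI[of _ "\<lambda>l. - 1 * x l"]) auto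
  qed (use A in \<open>auto simp: fun_subspace_zero fun_subspace_add fun_subspace_scale algebra_simps\<close>)
  then show ?thesis
    by (intro vectorspace.intro rat_field)
qed

text \<open>Gaussian elimination along the support: a \<open>g\<close> with
  \<open>g s \<noteq> 0\<close>, if there is one, clears the coordinate \<open>s\<close>, and the
  functions of \<open>A\<close> vanishing at \<open>s\<close> are generated by induction. Generation
  is expressed by minimality among subspaces, so that no calculus of linear combinations is
  involved.\<close>

lemma finite_support_generators:
  assumes "finite S" "fun_subspace A" "A \<subseteq> supported_funs S"
  shows "\<exists>G. finite G \<and> G \<subseteq> A \<and> card G \<le> card S \<and> (\<forall>B. fun_subspace B \<longrightarrow> G \<subseteq> B \<longrightarrow> A \<subseteq> B)"
  using assms
proof (induction S arbitrary: A rule: finite_induct)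
  case empty
  then have "a = (\<lambda>_. 0)" if "a \<in> A" for a using that by (auto simp: supported_funs_def)
  then have "A \<subseteq> B" if "fun_subspace B" for B
    using that fun_subspace_zero by fast
  then show ?case by (intro exI[of _ "{}"]) auto
next
  case (insert s S)
  show ?case
  proof (cases "\<exists>g\<in>A. g s \<noteq> 0")
    case False
    then have "A \<subseteq> supported_funs S" using insert.prems(2) by (fastforce simp: supported_funs_def)
    from insert.IH[OF insert.prems(1) this] obtain G where
      "finite G" "G \<subseteq> A" "card G \<le> card S" "\<forall>B. fun_subspace B \<longrightarrow> G \<subseteq> B \<longrightarrow> A \<subseteq> B" by blast
    then show ?thesis using insert.hyps by (intro exI[of _ G]) auto
  next
    case True
    then obtain g where g: "g \<in> A" "g s \<noteq> 0" by blast
    define A' where "A' = {a \<in> A. a s = 0}"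
    have sub: "fun_subspace A'"
      using insert.prems(1) unfolding fun_subspace_def A'_def by simp
    have "A' \<subseteq> supported_funs S"
      using insert.prems(2) unfolding A'_def by (fastforce simp: supported_funs_def)
    from insert.IH[OF sub this] obtain G where
      G: "finite G" "G \<subseteq> A'" "card G \<le> card S" "\<And>B. fun_subspace B \<Longrightarrow> G \<subseteq> B \<Longrightarrow> A' \<subseteq> B" by blast
    have "A \<subseteq> B" if B: "fun_subspace B" "insert g G \<subseteq> B" for B
    proof
      fix a assume a: "a \<in> A"
      have "(\<lambda>l. 1 * a l + (- a s / g s) * g l) \<in> A'"
        unfolding A'_def using fun_subspace_comb[OF insert.prems(1) a g(1), of 1 "- a s / g s"] g(2) by simp
      then have "(\<lambda>l. 1 * a l + (- a s / g s) * g l) \<in> B" using G(4)[OF B(1)] B(2) by blast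
      then have "(\<lambda>l. 1 * (1 * a l + (- a s / g s) * g l) + (a s / g s) * g l) \<in> B"
        using fun_subspace_comb[OF B(1), of "\<lambda>l. 1 * a l + (- a s / g s) * g l" g 1 "a s / g s"] B(2)
        by blast
      then show "a \<in> B" by simp
    qed
    moreover have "card (insert g G) \<le> card (insert s S)"
      using G(1,3) insert.hyps by (simp add: card_insert_if)
    ultimately show ?thesis using G g unfolding A'_def by (intro exI[of _ "insert g G"]) blast
  qed
qed

text \<open>The span of \<open>G\<close> in the module is itself closed in the concrete sense of
  \<open>fun_subspace\<close>, so the minimality property of \<open>G\<close> puts \<open>A\<close>
  inside it; \<open>G\<close> is then a generating set of at most \<open>card S\<close>
  elements.\<close>

lemma fun_dim_finite_support:
  assumes S: "finite S" and A: "fun_subspace A" and supp: "A \<subseteq> supported_funs S"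
  shows "vectorspace.fin_dim rat_field (fun_space A)" "fun_dim A \<le> card S"
proof -
  interpret V: vectorspace rat_field "fun_space A" by (rule vectorspace_fun_space[OF A])
  obtain G where G: "finite G" "G \<subseteq> A" "card G \<le> card S"
    "\<And>B. fun_subspace B \<Longrightarrow> G \<subseteq> B \<Longrightarrow> A \<subseteq> B"
    using finite_support_generators[OF S A supp] by metis
  have GA: "G \<subseteq> carrier (fun_space A)" using G by simp
  have sm: "LinearCombinations.submodule rat_field (V.span G) (fun_space A)"
    by (rule V.span_is_submodule[OF GA])
  have sub: "fun_subspace (V.span G)"
    unfolding fun_subspace_def
  proof (intro conjI ballI allI)
    show "(\<lambda>_. 0) \<in> V.span G"
      using LinearCombinations.submodule.zero_closed[OF sm] by simp
    fix c d q p assume cd: "c \<in> V.span G" "d \<in> V.span G"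
    have 1: "q \<odot>\<^bsub>fun_space A\<^esub> c \<in> V.span G" "p \<odot>\<^bsub>fun_space A\<^esub> d \<in> V.span G"
      using cd LinearCombinations.submodule.smult_closed[OF sm] by simp_all
    show "(\<lambda>l. q * c l + p * d l) \<in> V.span G"
      using LinearCombinations.submodule.m_closed[OF sm 1] by simp
  qed
  have "A \<subseteq> V.span G" by (rule G(4)[OF sub]) (rule V.in_own_span[OF GA])
  moreover have "V.span G \<subseteq> carrier (fun_space A)" by (rule V.span_is_subset2[OF GA])
  ultimately have gen: "V.gen_set G" by auto
  show "V.fin_dim" unfolding V.fin_dim_def using G(1) GA gen by blast
  have "V.dim \<le> card G" by (rule V.gen_ge_dim[OF G(1) GA gen])
  then show "fun_dim A \<le> card S" using G(3) by (simp add: fun_dim_def)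
qed

text \<open>The target is an arbitrary vector space because one application maps cycles onto the
  quotient \<open>homology K k\<close>, whose elements are sets of functions rather than
  functions.\<close>

lemma fun_dim_rank_nullity_general:
  assumes S: "finite S" and A: "fun_subspace A" and supp: "A \<subseteq> supported_funs S"
    and W: "vectorspace rat_field W" and im: "T ` A = carrier W"
    and T: "\<And>c d. c \<in> A \<Longrightarrow> d \<in> A \<Longrightarrow> T (\<lambda>l. c l + d l) = T c \<oplus>\<^bsub>W\<^esub> T d"
      "\<And>q c. c \<in> A \<Longrightarrow> T (\<lambda>l. q * c l) = q \<odot>\<^bsub>W\<^esub> T c"
  shows "fun_dim A = vectorspace.dim rat_field W + fun_dim {a \<in> A. T a = \<zero>\<^bsub>W\<^esub>}"
proof -
  interpret V: vectorspace rat_field "fun_space A" by (rule vectorspace_fun_space[OF A])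
  interpret W: vectorspace rat_field W by (rule W)
  have "module_hom rat_field (fun_space A) W = {f. f \<in> A \<rightarrow> carrier W \<and> 
     (\<forall>c\<in>A. \<forall>d\<in>A. f (\<lambda>l. c l + d l) = f c \<oplus>\<^bsub>W\<^esub> f d) \<and> (\<forall>q. \<forall>c\<in>A. f (\<lambda>l. q * c l) = q \<odot>\<^bsub>W\<^esub> f c)}"
    by (auto simp: module_hom_def)
  then have hom: "T \<in> module_hom rat_field (fun_space A) W"
    using T im by auto
  interpret L: linear_map rat_field "fun_space A" W T
    by (intro linear_map.intro mod_hom.intro mod_hom_axioms.intro hom) unfold_locales
  have "L.imT = carrier W" unfolding L.im_def using im by simp
  then have im': "W\<lparr>carrier := L.imT\<rparr> = W" by simp
  have "L.kerT = {a \<in> A. T a = \<zero>\<^bsub>W\<^esub>}" unfolding L.ker_def by simp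
  then have ker': "(fun_space A)\<lparr>carrier := L.kerT\<rparr> = fun_space {a \<in> A. T a = \<zero>\<^bsub>W\<^esub>}"
    by (simp add: fun_space_def)
  show ?thesis
    using L.rank_nullity[OF fun_dim_finite_support(1)[OF S A supp]] unfolding im' ker' fun_dim_def by simp
qed

lemma fun_linear_comb:
  "fun_linear A T \<Longrightarrow> c \<in> A \<Longrightarrow> d \<in> A \<Longrightarrow> T (\<lambda>l. q * c l + p * d l) = (\<lambda>l. q * T c l + p * T d l)"
  by (simp add: fun_linear_def)

lemma fun_linear_zero:
  assumes "fun_subspace A" "fun_linear A T"
  shows "T (\<lambda>_. 0) = (\<lambda>_. 0)"
proof -
  have "T (\<lambda>l. 0 * (\<lambda>_. 0) l + 0 * (\<lambda>_. 0) l) = (\<lambda>l. 0 * T (\<lambda>_. 0) l + 0 * T (\<lambda>_. 0) l)"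
    by (rule fun_linear_comb[OF assms(2)]) (rule fun_subspace_zero[OF assms(1)])+
  then show ?thesis by simp
qed

lemma fun_subspace_image:
  assumes A: "fun_subspace A"
    and T: "fun_linear A T"
  shows "fun_subspace (T ` A)"
proof -
  have "T (\<lambda>_. 0) = (\<lambda>_. 0)"
    by (rule fun_linear_zero[OF A T])
  then have "(\<lambda>_. 0) \<in> T ` A"
    by (rule image_eqI[OF sym fun_subspace_zero[OF A]])
  moreover have "(\<lambda>l. q * T c l + p * T d l) \<in> T ` A" if "c \<in> A" "d \<in> A" for c d q p
    using fun_linear_comb[OF T that] fun_subspace_comb[OF A that] by (metis imageI)
  ultimately show ?thesis unfolding fun_subspace_def by blast
qed

lemma fun_dim_rank_nullity:
  assumes S: "finite S" and A: "fun_subspace A" and supp: "A \<subseteq> supported_funs S"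
    and T: "fun_linear A T"
  shows "fun_dim A = fun_dim (T ` A) + fun_dim {a \<in> A. T a = (\<lambda>_. 0)}"
proof -
  let ?W = "fun_space (T ` A)"
  have T1: "T (\<lambda>l. c l + d l) = T c \<oplus>\<^bsub>?W\<^esub> T d" if "c \<in> A" "d \<in> A" for c d
    using fun_linear_comb[OF T that, of 1 1] by (simp only: fun_space_simps mult_1)
  have T2: "T (\<lambda>l. q * c l) = q \<odot>\<^bsub>?W\<^esub> T c" if "c \<in> A" for c q
    using fun_linear_comb[OF T that that, of q 0] by (simp only: fun_space_simps mult_zero_left add_0_right)
  have "T ` A = carrier ?W" by simp
  from fun_dim_rank_nullity_general[where T = T, OF S A supp vectorspace_fun_space[OF fun_subspace_image[OF A T]] this T1 T2]
  show ?thesis unfolding fun_dim_def fun_space_simps(2) by assumption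
qed

lemma fun_dim_zero: "fun_dim {\<lambda>_. 0} = 0"
proof -
  have "fun_subspace {\<lambda>_. 0}" by (simp add: fun_subspace_def)
  from fun_dim_finite_support(2)[OF finite.emptyI this] show ?thesis by (simp add: supported_funs_def)
qed

lemma fun_dim_pos:
  assumes S: "finite S" and A: "fun_subspace A" and supp: "A \<subseteq> supported_funs S"
    and a: "a \<in> A" "a \<noteq> (\<lambda>_. 0)"
  shows "fun_dim A > 0"
proof (rule ccontr)
  assume "\<not> fun_dim A > 0"
  interpret V: vectorspace rat_field "fun_space A" by (rule vectorspace_fun_space[OF A])
  obtain \<beta> where \<beta>: "finite \<beta>" "V.basis \<beta>"
    using V.finite_basis_exists[OF fun_dim_finite_support(1)[OF S A supp]] by blast
  have "card \<beta> = 0" using V.dim_basis[OF \<beta>] \<open>\<not> fun_dim A > 0\<close> by (simp add: fun_dim_def)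
  then have "V.span {} = A" using \<beta> by (simp add: V.basis_def)
  then have "A = {\<lambda>_. 0}" unfolding V.span_empty by simp
  then show False using a by blast
qed

lemma fun_dim_one:
  assumes S: "finite S" and A: "fun_subspace A" and supp: "A \<subseteq> supported_funs S"
    and a: "a \<in> A" "a \<noteq> (\<lambda>_. 0)" and s: "\<And>c. c \<in> A \<Longrightarrow> c s = 0 \<Longrightarrow> c = (\<lambda>_. 0)"
  shows "fun_dim A = 1"
proof -
  \<comment> \<open>The domain \<open>unit\<close> turns evaluation at \<open>s\<close> into a map
    between function spaces; its image has dimension at most \<open>card {()}\<close>, and by
    \<open>s\<close> it is injective.\<close>
  define T where "T = (\<lambda>c::'a \<Rightarrow> rat. \<lambda>_::unit. c s)"
  have T: "fun_linear A T"
    by (simp add: T_def fun_linear_def)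
  have "{c \<in> A. T c = (\<lambda>_. 0)} = {\<lambda>_. 0}"
  proof (intro equalityI subsetI)
    fix c assume "c \<in> {c \<in> A. T c = (\<lambda>_. 0)}"
    then have "c \<in> A" "c s = 0" by (simp_all add: T_def fun_eq_iff)
    from s[OF this] show "c \<in> {\<lambda>_. 0}" by blast
  next
    fix c :: "'a \<Rightarrow> rat" assume "c \<in> {\<lambda>_. 0}"
    then show "c \<in> {c \<in> A. T c = (\<lambda>_. 0)}" using fun_subspace_zero[OF A] by (simp add: T_def)
  qed
  then have "fun_dim A = fun_dim (T ` A)"
    using fun_dim_rank_nullity[OF S A supp T] fun_dim_zero by simp
  moreover have "fun_dim (T ` A) \<le> card {()}"
    by (rule fun_dim_finite_support(2)[OF _ fun_subspace_image[OF A T]]) (auto simp: supported_funs_def)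
  ultimately show ?thesis using fun_dim_pos[OF S A supp a] by simp
qed

lemma fun_dim_eq_of_bij:
  assumes S: "finite S" and A: "fun_subspace A" and supp: "A \<subseteq> supported_funs S"
    and T: "fun_linear A T"
    and bij: "T ` A = B" "\<And>c. c \<in> A \<Longrightarrow> T c = (\<lambda>_. 0) \<Longrightarrow> c = (\<lambda>_. 0)"
  shows "fun_dim A = fun_dim B"
proof -
  have "T (\<lambda>_. 0) = (\<lambda>_. 0)"
    by (rule fun_linear_zero[OF A T])
  then have "{c \<in> A. T c = (\<lambda>_. 0)} = {\<lambda>_. 0}"
    using bij(2) fun_subspace_zero[OF A] by blast
  then show ?thesis
    using fun_dim_rank_nullity[OF S A supp T] fun_dim_zero bij(1) by simp
qed

section \<open>Oriented chains\<close>

definition simplicial_complex :: "'v set set \<Rightarrow> bool" where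
  "simplicial_complex K \<longleftrightarrow> finite K \<and> (\<forall>\<sigma>\<in>K. finite \<sigma> \<and> \<sigma> \<noteq> {} \<and> (\<forall>\<tau>. \<tau> \<subseteq> \<sigma> \<longrightarrow> \<tau> \<noteq> {} \<longrightarrow> \<tau> \<in> K))"

lemma simplicial_complex_face:
  "simplicial_complex K \<Longrightarrow> \<sigma> \<in> K \<Longrightarrow> \<tau> \<subseteq> \<sigma> \<Longrightarrow> \<tau> \<noteq> {} \<Longrightarrow> \<tau> \<in> K"
  unfolding simplicial_complex_def by blast

lemma simplicial_complex_finite_vertices: "simplicial_complex K \<Longrightarrow> finite (\<Union>K)"
  unfolding simplicial_complex_def by blast

text \<open>Conjugation with \<open>Suc\<close> moves \<open>p\<close> to the positions after the
  head and fixes position 0 without changing the sign. This makes the coefficient at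
  \<open>v # l\<close> antisymmetric in \<open>l\<close> for each fixed \<open>v\<close>, so that
  boundaries of chains are chains.\<close>

lemma permute_list_Cons_shift:
  fixes l :: "'v list"
  assumes p: "p permutes {..<length l}"
  obtains q where "q permutes {..<length (v # l)}" "permute_list q (v # l) = v # permute_list p l"
    "sign q = sign p"
proof -
  let ?q = "map_permutation {..<length l} Suc p"
  have q': "?q permutes (Suc ` {..<length l})"
    by (rule map_permutation_permutes[OF _ p]) (simp add: bij_betw_def)
  then have q: "?q permutes {..<length (v # l)}"
    by (rule permutes_subset) auto
  have "?q 0 = 0" using permutes_not_in[OF q'] by auto
  moreover have "?q (Suc i) = Suc (p i)" if "i < length l" for i
    using map_permutation_apply[of Suc "{..<length l}" i p] that by simp
  ultimately have "permute_list ?q (v # l) = v # permute_list p l"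
    using p q by (intro nth_equalityI) (auto simp: permute_list_nth nth_Cons split: nat.splits)
  then show ?thesis using that[OF q] sign_map_permutation[OF _ p, of Suc] by simp
qed

definition simplex_lists :: "'v set set \<Rightarrow> nat \<Rightarrow> 'v list set" where
  "simplex_lists K j = {l. length l = j + 1 \<and> distinct l \<and> set l \<in> K}"

lemma finite_simplex_lists:
  assumes "simplicial_complex K"
  shows "finite (simplex_lists K j)"
proof (rule finite_subset)
  show "simplex_lists K j \<subseteq> {l. set l \<subseteq> \<Union>K \<and> length l = j + 1}"
    unfolding simplex_lists_def by auto
  show "finite {l. set l \<subseteq> \<Union>K \<and> length l = j + 1}"
    by (rule finite_lists_length_eq[OF simplicial_complex_finite_vertices[OF assms]])
qed

lemma oriented_chains_supported: "oriented_chains K j \<subseteq> supported_funs (simplex_lists K j)"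
  unfolding oriented_chains_def supported_funs_def simplex_lists_def by blast

lemma chain_simplex:
  assumes "c \<in> oriented_chains K j" "c l \<noteq> 0"
  shows "length l = j + 1" "distinct l" "set l \<in> K"
  using assms unfolding oriented_chains_def by blast+

lemma chain_permute:
  "c \<in> oriented_chains K j \<Longrightarrow> p permutes {..<length l} \<Longrightarrow> c (permute_list p l) = of_int (sign p) * c l"
  unfolding oriented_chains_def by blast

text \<open>Two enumerations of the same vertex set differ by a permutation, whose sign is nonzero.
  Vanishing of a coefficient is thus a property of the simplex, and later arguments may choose
  whatever enumeration is convenient.\<close>

lemma chain_zero_iff:
  assumes c: "c \<in> oriented_chains K j" and l: "distinct l" "distinct l'" "set l = set l'"
  shows "c l = 0 \<longleftrightarrow> c l' = 0"
proof -
  have "mset l = mset l'" using l by (simp add: set_eq_iff_mset_eq_distinct)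
  then obtain p where "p permutes {..<length l'}" "permute_list p l' = l"
    by (rule mset_eq_permutation)
  then have "c l = of_int (sign p) * c l'" using chain_permute[OF c] by metis
  then show ?thesis by (simp add: sign_def)
qed

lemma fun_subspace_chains: "fun_subspace (oriented_chains K j)"
  unfolding fun_subspace_def using oriented_chains_zero oriented_chains_comb by blast

lemma fun_subspace_cycles: "fun_subspace (cycles K j)"
  unfolding fun_subspace_def using cycles_zero cycles_comb by blast

lemma fun_subspace_boundaries: "fun_subspace (boundaries K j)"
  unfolding fun_subspace_def using boundaries_zero boundaries_comb by blast

lemma cycles_subset: "cycles K j \<subseteq> oriented_chains K j"
  unfolding cycles_def by blast

lemma cycles_supported: "cycles K j \<subseteq> supported_funs (simplex_lists K j)"
  using cycles_subset oriented_chains_supported by (rule subset_trans)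

lemma boundary_chain:
  assumes K: "simplicial_complex K" and c: "c \<in> oriented_chains K (Suc j)"
  shows "boundary K c \<in> oriented_chains K j"
  unfolding oriented_chains_def mem_Collect_eq
proof (intro conjI allI impI)
  fix l assume "boundary K c l \<noteq> 0"
  then have l: "l \<noteq> []" and "(\<Sum>v\<in>\<Union>K. c (v # l)) \<noteq> 0"
    by (auto simp: boundary_def split: if_splits)
  then obtain v where "c (v # l) \<noteq> 0" by (meson sum.neutral)
  from chain_simplex[OF c this] l show "length l = j + 1" "distinct l" "set l \<in> K"
    by (auto intro: simplicial_complex_face[OF K, of "insert v (set l)"])
next
  fix l :: "'a list" and p assume p: "p permutes {..<length l}"
  have "c (v # permute_list p l) = of_int (sign p) * c (v # l)" for v
    using permute_list_Cons_shift[OF p, of v] chain_permute[OF c] by metis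
  moreover have "permute_list p l = [] \<longleftrightarrow> l = []" 
    by (metis length_0_conv length_permute_list)
  ultimately show "boundary K c (permute_list p l) = of_int (sign p) * boundary K c l"
    by (simp add: boundary_def sum_distrib_left)
qed

lemma boundaries_subset_cycles:
  assumes "simplicial_complex K"
  shows "boundaries K j \<subseteq> cycles K j"
  using boundary_chain[OF assms] boundary_boundary unfolding boundaries_def cycles_def by fastforce

lemma homology_class_eq_zero_iff:
  "homology_class K k z = homology_class K k (\<lambda>l. 0) \<longleftrightarrow> z \<in> boundaries K k"
proof
  assume *: "homology_class K k z = homology_class K k (\<lambda>l. 0)"
  have "z \<in> homology_class K k z"
    unfolding homology_class_def using boundaries_zero[of K k] by (auto intro!: exI[of _ "\<lambda>l. 0"])
  then show "z \<in> boundaries K k" unfolding * unfolding homology_class_def by auto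
next
  assume z: "z \<in> boundaries K k"
  have "\<exists>b'. (\<lambda>l. z l + b l) = (\<lambda>l. 0 + b' l) \<and> b' \<in> boundaries K k" if "b \<in> boundaries K k" for b
    using fun_subspace_add[OF fun_subspace_boundaries z that] by auto
  moreover have "\<exists>b'. (\<lambda>l. 0 + b l) = (\<lambda>l. z l + b' l) \<and> b' \<in> boundaries K k" if "b \<in> boundaries K k" for b
    using fun_subspace_comb[OF fun_subspace_boundaries that z, of 1 "-1"] by (intro exI[of _ "\<lambda>l. b l - z l"]) simp
  ultimately show "homology_class K k z = homology_class K k (\<lambda>l. 0)"
    unfolding homology_class_def by blast
qed

text \<open>Rank--nullity twice: \<open>dim Z\<^sub>k = \<beta>\<^sub>k + dim B\<^sub>k\<close> for
  the quotient map and \<open>dim C\<^sub>k\<^sub>+\<^sub>1 = dim B\<^sub>k + dim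
  Z\<^sub>k\<^sub>+\<^sub>1\<close> for the boundary map. Eliminating the boundaries matters: chains
  and cycles of a subcomplex are exactly those of \<open>K\<close> supported on it, whereas a
  boundary of \<open>K\<close> supported on the subcomplex need not bound there.\<close>

lemma betti_dimension:
  assumes K: "simplicial_complex K"
  shows "betti K k + fun_dim (oriented_chains K (k + 1)) = fun_dim (cycles K k) + fun_dim (cycles K (k + 1))"
proof -
  have 1: "fun_dim (cycles K k) = betti K k + fun_dim (boundaries K k)"
  proof -
    have "{z \<in> cycles K k. homology_class K k z = \<zero>\<^bsub>homology K k\<^esub>} = boundaries K k"
      using boundaries_subset_cycles[OF K] homology_class_eq_zero_iff unfolding homology_simps by blast
    moreover have "homology_class K k ` cycles K k = carrier (homology K k)" by (simp add: homology_simps)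
    note fun_dim_rank_nullity_general[OF finite_simplex_lists[OF K] fun_subspace_cycles cycles_supported 
       vectorspace_homology this homology_simps(3)[symmetric] homology_simps(4)[symmetric]]
    ultimately show ?thesis by (simp add: betti_def)
  qed
  have lin: "fun_linear (oriented_chains K (k+1)) (boundary K)"
    unfolding fun_linear_def using boundary_comb by blast
  have "fun_dim (oriented_chains K (k + 1)) = fun_dim (boundaries K k) + fun_dim (cycles K (k + 1))"
    using fun_dim_rank_nullity[OF finite_simplex_lists[OF K] fun_subspace_chains oriented_chains_supported lin]
    by (simp only: boundaries_def cycles_def)
  with 1 show ?thesis by simp
qed

section \<open>Adding a vertex\<close>

text \<open>On chains its kernel consists of the chains of the complex without \<open>v\<close>, so
  the image is a concrete model of the relative chains of \<open>K\<close> modulo that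
  subcomplex.\<close>

definition at_vertex :: "'v \<Rightarrow> ('v list \<Rightarrow> rat) \<Rightarrow> ('v list \<Rightarrow> rat)" where
  "at_vertex v c = (\<lambda>l. if v \<in> set l then c l else 0)"

definition delete_vertex :: "'v \<Rightarrow> 'v set set \<Rightarrow> 'v set set" where
  "delete_vertex v K = {\<sigma> \<in> K. v \<notin> \<sigma>}"

definition nbrs :: "'v set set \<Rightarrow> 'v \<Rightarrow> 'v set" where
  "nbrs K v = {u. u \<noteq> v \<and> {u, v} \<in> K}"

text \<open>Requiring the facets is enough, as every proper nonempty subset of \<open>S\<close> lies
  in one of them and complexes are closed under nonempty subsets.\<close>

definition empty_simplex :: "'v set set \<Rightarrow> 'v set \<Rightarrow> bool" where
  "empty_simplex K S \<longleftrightarrow> (\<forall>u\<in>S. S - {u} \<in> K) \<and> S \<notin> K"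

lemma simplicial_complex_delete_vertex:
  "simplicial_complex K \<Longrightarrow> simplicial_complex (delete_vertex v K)"
  unfolding simplicial_complex_def delete_vertex_def by (simp, meson subsetD)

lemma fun_linear_at_vertex: "fun_linear A (at_vertex v)"
  unfolding fun_linear_def at_vertex_def by auto

lemma at_vertex_eq_zero: "at_vertex v c = (\<lambda>_. 0) \<longleftrightarrow> (\<forall>l. v \<in> set l \<longrightarrow> c l = 0)"
  unfolding at_vertex_def fun_eq_iff by auto

lemma oriented_chains_delete_vertex:
  "oriented_chains (delete_vertex v K) j = {c \<in> oriented_chains K j. at_vertex v c = (\<lambda>_. 0)}"
proof (intro equalityI subsetI)
  fix c assume c: "c \<in> oriented_chains (delete_vertex v K) j"
  have "c l = 0" if "v \<in> set l" for l
    using chain_simplex(3)[OF c, of l] that unfolding delete_vertex_def by blast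
  moreover have "c \<in> oriented_chains K j"
    using c unfolding oriented_chains_def delete_vertex_def by simp
  ultimately show "c \<in> {c \<in> oriented_chains K j. at_vertex v c = (\<lambda>_. 0)}"
    by (simp add: at_vertex_eq_zero)
next
  fix c assume "c \<in> {c \<in> oriented_chains K j. at_vertex v c = (\<lambda>_. 0)}"
  then have c: "c \<in> oriented_chains K j" and "\<forall>l. v \<in> set l \<longrightarrow> c l = 0"
    by (simp_all add: at_vertex_eq_zero)
  then have "\<And>l. c l \<noteq> 0 \<Longrightarrow> set l \<in> delete_vertex v K"
    using chain_simplex(3)[OF c] unfolding delete_vertex_def by blast
  then show "c \<in> oriented_chains (delete_vertex v K) j"
    using c unfolding oriented_chains_def by simp
qed

lemma boundary_superset:
  assumes c: "c \<in> oriented_chains K' j" and sub: "\<Union>K' \<subseteq> \<Union>K" and fin: "finite (\<Union>K)"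
  shows "boundary K c = boundary K' c"
proof
  fix l
  have "(\<Sum>v\<in>\<Union>K. c (v # l)) = (\<Sum>v\<in>\<Union>K'. c (v # l))"
  proof (rule sum.mono_neutral_right[OF fin sub], rule ballI)
    fix v assume "v \<in> \<Union>K - \<Union>K'"
    then have "set (v # l) \<notin> K'" by auto
    then show "c (v # l) = 0" using chain_simplex(3)[OF c] by metis
  qed
  then show "boundary K c l = boundary K' c l" by (simp add: boundary_def)
qed

text \<open>A chain avoiding \<open>v\<close> has the same boundary in both complexes, because the
  additional vertices of \<open>K\<close> contribute zero coefficients; being a cycle therefore does
  not depend on which of the two is meant.\<close>

lemma cycles_delete_vertex:
  assumes "simplicial_complex K"
  shows "cycles (delete_vertex v K) j = {c \<in> cycles K j. at_vertex v c = (\<lambda>_. 0)}"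
proof -
  have "boundary K c = boundary (delete_vertex v K) c" if "c \<in> oriented_chains (delete_vertex v K) j" for c
    by (rule boundary_superset[OF that _ simplicial_complex_finite_vertices[OF assms]])
      (auto simp: delete_vertex_def)
  then show ?thesis
    unfolding cycles_def using oriented_chains_delete_vertex[of v K j] by auto
qed

text \<open>\<open>betti_dimension\<close> for \<open>K\<close> and for
  \<open>delete_vertex v K\<close>, with each of the three dimensions split by
  \<open>at_vertex v\<close> into image and kernel. The change of the Betti number is thereby
  carried by three spaces that see only simplices through \<open>v\<close>.\<close>

lemma betti_delete_vertex:
  assumes K: "simplicial_complex K"
  shows "betti K k + fun_dim (at_vertex v ` oriented_chains K (k + 1)) =
    betti (delete_vertex v K) k + fun_dim (at_vertex v ` cycles K k) + fun_dim (at_vertex v ` cycles K (k + 1))"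
proof -
  have z: "fun_dim (cycles K j) = fun_dim (at_vertex v ` cycles K j) + fun_dim (cycles (delete_vertex v K) j)" for j
    unfolding cycles_delete_vertex[OF K]
    by (rule fun_dim_rank_nullity[OF finite_simplex_lists[OF K] fun_subspace_cycles cycles_supported fun_linear_at_vertex])
  have c: "fun_dim (oriented_chains K j) =
    fun_dim (at_vertex v ` oriented_chains K j) + fun_dim (oriented_chains (delete_vertex v K) j)" for j
    unfolding oriented_chains_delete_vertex
    by (rule fun_dim_rank_nullity[OF finite_simplex_lists[OF K] fun_subspace_chains oriented_chains_supported fun_linear_at_vertex])
  show ?thesis
    using betti_dimension[OF K, of k] betti_dimension[OF simplicial_complex_delete_vertex[OF K, of v], of k]
      z[of k] z[of "k + 1"] c[of "k + 1"] by simp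
qed

lemma star_simplex_subset:
  assumes K: "simplicial_complex K" and s: "\<sigma> \<in> K" "v \<in> \<sigma>"
  shows "\<sigma> \<subseteq> insert v (nbrs K v)"
proof
  fix u assume "u \<in> \<sigma>"
  then show "u \<in> insert v (nbrs K v)"
    using simplicial_complex_face[OF K s(1), of "{u, v}"] s(2) unfolding nbrs_def by simp
qed

lemma finite_nbrs:
  assumes "simplicial_complex K"
  shows "finite (nbrs K v)"
  by (rule finite_subset[OF _ simplicial_complex_finite_vertices[OF assms]]) (auto simp: nbrs_def)

lemma at_vertex_supported:
  assumes K: "simplicial_complex K" and c: "c \<in> oriented_chains K j" and l: "at_vertex v c l \<noteq> 0"
  shows "v \<in> set l" "length l = j + 1" "distinct l" "set l \<in> K" "set l \<subseteq> insert v (nbrs K v)"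
proof -
  from l have "v \<in> set l" "c l \<noteq> 0" by (auto simp: at_vertex_def split: if_splits)
  with chain_simplex[OF c this(2)] star_simplex_subset[OF K]
  show "v \<in> set l" "length l = j + 1" "distinct l" "set l \<in> K" "set l \<subseteq> insert v (nbrs K v)" by blast+
qed

text \<open>A \<open>j\<close>-simplex through \<open>v\<close> uses only \<open>v\<close> and its
  neighbours, so the image is supported on the lists of length \<open>j + 1\<close> over these
  vertices.\<close>

lemma fun_dim_at_vertex_le:
  assumes K: "simplicial_complex K" and A: "fun_subspace A" "A \<subseteq> oriented_chains K j"
  shows "fun_dim (at_vertex v ` A) \<le> (card (nbrs K v) + 1) ^ (j + 1)"
proof -
  let ?S = "insert v (nbrs K v)"
  have fin: "finite ?S" using finite_nbrs[OF K] by simp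
  have "fun_dim (at_vertex v ` A) \<le> card {l. set l \<subseteq> ?S \<and> length l = j + 1}"
  proof (rule fun_dim_finite_support(2)[OF finite_lists_length_eq[OF fin] fun_subspace_image[OF A(1) fun_linear_at_vertex]])
    show "at_vertex v ` A \<subseteq> supported_funs {l. set l \<subseteq> ?S \<and> length l = j + 1}"
      unfolding supported_funs_def using at_vertex_supported[OF K, of _ j v] A(2) by blast
  qed
  also have "\<dots> = (card (nbrs K v) + 1) ^ (j + 1)"
    using card_lists_length_eq[OF fin] finite_nbrs[OF K, of v] by (simp add: nbrs_def)
  finally show ?thesis .
qed

text \<open>In \<open>betti_delete_vertex\<close> the two terms for cycles push in one direction and
  the term for chains in the other; the factor 2 comes from the former.\<close>

lemma betti_delete_vertex_le:
  assumes K: "simplicial_complex K"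
  shows "\<bar>real (betti K k) - real (betti (delete_vertex v K) k)\<bar> \<le> 2 * (real (card (nbrs K v)) + 1) ^ (k + 2)"
proof -
  let ?m = "card (nbrs K v) + 1"
  have "fun_dim (at_vertex v ` oriented_chains K (k + 1)) \<le> ?m ^ (k + 2)"
    using fun_dim_at_vertex_le[OF K fun_subspace_chains order_refl, of v "k + 1"] by simp
  moreover have "fun_dim (at_vertex v ` cycles K (k + 1)) \<le> ?m ^ (k + 2)"
    using fun_dim_at_vertex_le[OF K fun_subspace_cycles cycles_subset, of v "k + 1"] by simp
  moreover have "fun_dim (at_vertex v ` cycles K k) \<le> ?m ^ (k + 2)"
    using fun_dim_at_vertex_le[OF K fun_subspace_cycles cycles_subset, of v "k"]
      power_increasing[of "k + 1" "k + 2" ?m] by simp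
  ultimately have "\<bar>int (betti K k) - int (betti (delete_vertex v K) k)\<bar> \<le> 2 * int (?m ^ (k + 2))"
    using betti_delete_vertex[OF K, of k v] by linarith
  then have "\<bar>real (betti K k) - real (betti (delete_vertex v K) k)\<bar> \<le> 2 * real (?m ^ (k + 2))"
    by linarith
  then show ?thesis by (simp only: of_nat_power of_nat_add of_nat_1)
qed

text \<open>The cycle condition read at a single list: only vertices extending \<open>l\<close> to a
  simplex of nonzero coefficient contribute, so the sum may run over any finite \<open>A\<close>
  containing them. In the applications \<open>A\<close> has one or two elements, which yields a
  relation between individual coefficients.\<close>

lemma cycle_at_list:
  assumes z: "z \<in> cycles K j" and l: "l \<noteq> []" and fin: "finite (\<Union>K)"
    and sub: "\<And>u. z (u # l) \<noteq> 0 \<Longrightarrow> u \<in> A" and A: "finite A"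
  shows "(\<Sum>u\<in>A. z (u # l)) = 0"
proof -
  have zc: "z \<in> oriented_chains K j" using z by (simp add: cycles_def)
  have "(\<Sum>u\<in>A. z (u # l)) = (\<Sum>u\<in>A \<union> \<Union>K. z (u # l))"
  proof (rule sum.mono_neutral_left)
    show "finite (A \<union> \<Union>K)" using A fin by simp
    show "\<forall>u\<in>A \<union> \<Union>K - A. z (u # l) = 0" using sub by blast
  qed simp
  also have "\<dots> = (\<Sum>u\<in>\<Union>K. z (u # l))"
  proof (rule sum.mono_neutral_right)
    show "finite (A \<union> \<Union>K)" using A fin by simp
    show "\<forall>u\<in>A \<union> \<Union>K - \<Union>K. z (u # l) = 0"
      using chain_simplex(3)[OF zc] by fastforce
  qed simp
  also have "\<dots> = boundary K z l" using l by (simp add: boundary_def)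
  also have "\<dots> = 0" using z by (simp add: cycles_def)
  finally show ?thesis .
qed

text \<open>With at most \<open>j\<close> neighbours there is only one possible vertex set for a
  \<open>j\<close>-simplex through \<open>v\<close>. Dropping a vertex \<open>w \<noteq> v\<close>
  leaves a face through \<open>v\<close> whose only extension is \<open>w\<close>, and the cycle
  condition at that face kills the coefficient.\<close>

lemma cycle_vanishes_few_nbrs:
  assumes K: "simplicial_complex K" and z: "z \<in> cycles K j" and j: "j \<ge> 1" and n: "card (nbrs K v) \<le> j"
    and l: "v \<in> set l"
  shows "z l = 0"
proof (rule ccontr)
  assume nz: "z l \<noteq> 0"
  let ?S = "insert v (nbrs K v)"
  have zc: "z \<in> oriented_chains K j" using z by (simp add: cycles_def)
  have fS: "finite ?S" using finite_nbrs[OF K] by simp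
  have cS: "card ?S \<le> j + 1" using n finite_nbrs[OF K] by (simp add: card_insert_if)
  have full: "set l' = ?S" if "z l' \<noteq> 0" "v \<in> set l'" for l'
  proof (rule card_subset_eq[OF fS])
    show "set l' \<subseteq> ?S" using star_simplex_subset[OF K chain_simplex(3)[OF zc that(1)] that(2)] .
    then have "card (set l') \<le> card ?S" by (rule card_mono[OF fS])
    moreover have "card (set l') = j + 1"
      using chain_simplex(1,2)[OF zc that(1)] distinct_card by metis
    ultimately show "card (set l') = card ?S" using cS by simp
  qed
  note L = chain_simplex[OF zc nz]
  \<comment> \<open>The dropped vertex must differ from \<open>v\<close>: the remaining list then
    contains \<open>v\<close> and is nonempty, and the boundary carries information only at nonempty
    lists.\<close>
  obtain w where w: "w \<in> set l" "w \<noteq> v"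
  proof -
    have "card (set l) \<ge> 2" using L(1) distinct_card[OF L(2)] j by simp
    then have "\<not> set l \<subseteq> {v}" using card_mono[of "{v}" "set l"] by auto
    then show ?thesis using that by blast
  qed
  obtain l' where l': "set l' = set l - {w}" "distinct l'" using finite_distinct_list[of "set l - {w}"] by auto
  have eq: "z (w # l') = 0 \<longleftrightarrow> z l = 0"
    using l' w L by (intro chain_zero_iff[OF zc]) auto
  have vl': "v \<in> set l'" using l' w l by simp
  have "(\<Sum>u\<in>{w}. z (u # l')) = 0"
  proof (rule cycle_at_list[OF z])
    show "l' \<noteq> []" using vl' by force
    fix u assume u: "z (u # l') \<noteq> 0"
    have "insert u (set l') = set l" using full[OF u] full[OF nz l] vl' by simp
    moreover have "w \<notin> set l'" using l'(1) by simp
    ultimately show "u \<in> {w}" using w(1) by auto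
  qed (use simplicial_complex_finite_vertices[OF K] in auto)
  then show False using eq nz by simp
qed

lemma chain_vanishes_few_nbrs:
  assumes K: "simplicial_complex K" and c: "c \<in> oriented_chains K j" and n: "card (nbrs K v) < j"
    and l: "v \<in> set l"
  shows "c l = 0"
proof (rule ccontr)
  assume nz: "c l \<noteq> 0"
  note L = chain_simplex[OF c nz]
  have "card (set l) \<le> card (insert v (nbrs K v))"
    using finite_nbrs[OF K] by (intro card_mono star_simplex_subset[OF K L(3) l]) simp
  also have "\<dots> \<le> card (nbrs K v) + 1" using finite_nbrs[OF K] by (simp add: card_insert_if)
  finally show False using L distinct_card[OF L(2)] n by simp
qed


text \<open>The oriented simplex on \<open>S\<close>: after fixing an enumeration \<open>xs\<close>,
  the value at a rearrangement is the sign of the permutation producing it. Distinctness of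
  \<open>xs\<close> makes this permutation unique, which is what the definite description in
  \<open>e\<close> rests on.\<close>

lemma elementary_chain_exists:
  assumes "simplicial_complex K" "S \<in> K" "card S = j + 1"
  obtains e where "e \<in> oriented_chains K j" "\<And>l. e l \<noteq> 0 \<longleftrightarrow> distinct l \<and> set l = S"
proof -
  have "finite S" using assms(1,2) unfolding simplicial_complex_def by blast
  then obtain xs where xs: "set xs = S" "distinct xs" using finite_distinct_list by blast
  have len: "length xs = j + 1" using xs assms(3) distinct_card by fastforce
  define P where "P = (\<lambda>l p. p permutes {..<length xs} \<and> permute_list p xs = l)"
  have uniq: "p = q" if "P l p" "P l q" for l p q
  proof
    fix i show "p i = q i"
    proof (cases "i < length xs")
      case True
      then have "xs ! p i = xs ! q i"
        using that unfolding P_def by (metis permute_list_nth)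
      moreover have "p i < length xs" "q i < length xs"
        using that True unfolding P_def by (metis lessThan_iff permutes_in_image)+
      ultimately show ?thesis using xs(2) by (simp add: nth_eq_iff_index_eq)
    next
      case False
      then show ?thesis using that unfolding P_def by (metis lessThan_iff permutes_not_in)
    qed
  qed
  have ex: "(\<exists>p. P l p) \<longleftrightarrow> distinct l \<and> set l = S" for l
  proof
    assume "\<exists>p. P l p"
    then have "mset l = mset xs" unfolding P_def by (metis mset_permute_list)
    then show "distinct l \<and> set l = S" using xs by (metis mset_eq_imp_distinct_iff mset_eq_setD)
  next
    assume "distinct l \<and> set l = S"
    then have "mset l = mset xs" using xs by (simp add: set_eq_iff_mset_eq_distinct[symmetric])
    then show "\<exists>p. P l p" unfolding P_def by (metis mset_eq_permutation)
  qed
  define e where "e = (\<lambda>l. if \<exists>p. P l p then rat_of_int (sign (THE p. P l p)) else 0)"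
  have eP: "e l = of_int (sign p)" if "P l p" for l p
  proof -
    have "(THE p. P l p) = p" using that uniq by blast
    then show ?thesis using that unfolding e_def by auto
  qed
  have nz: "e l \<noteq> 0 \<longleftrightarrow> distinct l \<and> set l = S" for l
    unfolding ex[symmetric] using eP by (auto simp: e_def sign_def)
  have "e \<in> oriented_chains K j"
    unfolding oriented_chains_def mem_Collect_eq
  proof (intro conjI allI impI)
    fix l assume "e l \<noteq> 0"
    then have l: "distinct l" "set l = S" using nz by auto
    then show "length l = j + 1" "distinct l" "set l \<in> K"
      using assms distinct_card[of l] by auto
  next
    fix l :: "'a list" and q assume q: "q permutes {..<length l}"
    show "e (permute_list q l) = of_int (sign q) * e l"
    proof (cases "\<exists>p. P l p")
      case True
      then obtain p where p: "P l p" by blast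
      then have len: "length l = length xs" unfolding P_def by auto
      have "permute_list (p \<circ> q) xs = permute_list q (permute_list p xs)"
        using q len by (intro permute_list_compose) auto
      then have "P (permute_list q l) (p \<circ> q)"
        using p q len unfolding P_def by (auto intro: permutes_compose)
      moreover have "permutation p" "permutation q"
        using p q unfolding P_def by (auto intro: permutes_imp_permutation[rotated])
      ultimately show ?thesis using eP[OF p] eP by (simp add: sign_compose)
    next
      case False
      moreover have "\<not> (\<exists>p. P (permute_list q l) p)"
        using False q unfolding ex by simp
      ultimately show ?thesis unfolding e_def by simp
    qed
  qed
  with nz show ?thesis using that by blast
qed

text \<open>With \<open>k + 1\<close> neighbours, a \<open>k\<close>-simplex through
  \<open>v\<close> omits exactly one of them. The simplices omitting \<open>a\<close> and
  \<open>b\<close> meet in the face omitting both, which still contains \<open>v\<close> and extends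
  in no other way; the cycle condition there ties the two coefficients together. Near
  \<open>v\<close> a cycle is thus fixed by one coefficient.\<close>

lemma cycle_determined_at_vertex:
  assumes K: "simplicial_complex K" and z: "z \<in> cycles K k" and k: "k \<ge> 1"
    and n: "card (nbrs K v) = k + 1"
    and l0: "set l0 \<subseteq> insert v (nbrs K v)" "v \<in> set l0" "distinct l0" "length l0 = k + 1" "z l0 = 0"
    and l: "v \<in> set l"
  shows "z l = 0"
proof (rule ccontr)
  assume nz: "z l \<noteq> 0"
  let ?S = "insert v (nbrs K v)"
  have zc: "z \<in> oriented_chains K k" using z by (simp add: cycles_def)
  note L = chain_simplex[OF zc nz]
  have fS: "finite ?S" using finite_nbrs[OF K] by simp
  have cS: "card ?S = k + 2" using n finite_nbrs[OF K, of v] by (simp add: nbrs_def)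
  have lS: "set l \<subseteq> ?S" by (rule star_simplex_subset[OF K L(3) l])
  have "card (?S - set l) = 1" "card (?S - set l0) = 1"
    using card_Diff_subset[OF _ lS] card_Diff_subset[OF _ l0(1)] cS l0(4) L(1)
      distinct_card[OF L(2)] distinct_card[OF l0(3)] by simp_all
  then obtain a b where ab: "?S - set l = {a}" "?S - set l0 = {b}" by (metis card_1_singletonE)
  have neq: "a \<noteq> b"
  proof
    assume "a = b"
    then have "set l = set l0" using ab lS l0(1) by blast
    then show False using chain_zero_iff[OF zc L(2) l0(3)] l0(5) nz by simp
  qed
  obtain l' where l': "set l' = ?S - {a, b}" "distinct l'"
    using finite_distinct_list[of "?S - {a, b}"] fS by auto
  have va: "v \<noteq> a" "v \<noteq> b" using ab l l0(2) by auto
  have aS: "a \<in> ?S" "b \<in> ?S" using ab by blast+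
  have sets: "set (b # l') = set l" "set (a # l') = set l0"
    using ab lS l0(1) neq l'(1) by auto
  have dist: "distinct (b # l')" "distinct (a # l')" using l' by auto
  have eq: "z (b # l') = 0 \<longleftrightarrow> z l = 0" "z (a # l') = 0 \<longleftrightarrow> z l0 = 0"
    by (rule chain_zero_iff[OF zc dist(1) L(2) sets(1)], rule chain_zero_iff[OF zc dist(2) l0(3) sets(2)])
  have vl': "v \<in> set l'" using l' va by simp
  have "(\<Sum>u\<in>{a, b}. z (u # l')) = 0"
  proof (rule cycle_at_list[OF z])
    show "l' \<noteq> []" using vl' by force
    fix u assume u: "z (u # l') \<noteq> 0"
    have "u \<in> ?S" using star_simplex_subset[OF K chain_simplex(3)[OF zc u]] vl' by simp
    then show "u \<in> {a, b}" using chain_simplex(2)[OF zc u] l'(1) by auto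
  qed (use simplicial_complex_finite_vertices[OF K] in auto)
  then show False using eq nz l0(5) neq by simp
qed

text \<open>By \<open>cycle_determined_at_vertex\<close> the dimension is at most 1. It is 1
  precisely when all facets on the \<open>k + 2\<close> vertices are present, the boundary of the
  full simplex then being a cycle. The assumption \<open>iso\<close> keeps vertices outside the star
  from contributing at faces of the facet opposite \<open>v\<close>.\<close>

lemma fun_dim_cycles_at_vertex:
  assumes K: "simplicial_complex K" and k: "k \<ge> 1" and n: "card (nbrs K v) = k + 1"
    and iso: "\<And>u w. w \<in> nbrs K v \<Longrightarrow> {u, w} \<in> K \<Longrightarrow> u \<in> insert v (nbrs K v)"
  shows "fun_dim (at_vertex v ` cycles K k) =
    of_bool (\<forall>u\<in>insert v (nbrs K v). insert v (nbrs K v) - {u} \<in> K)"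
proof -
  let ?S = "insert v (nbrs K v)"
  have fS: "finite ?S" using finite_nbrs[OF K] by simp
  have cS: "card ?S = k + 2" using n finite_nbrs[OF K, of v] by (simp add: nbrs_def)
  have fin: "finite (\<Union>K)" by (rule simplicial_complex_finite_vertices[OF K])
  have vn: "v \<notin> nbrs K v" by (simp add: nbrs_def)
  show ?thesis
  proof (cases "\<forall>u\<in>?S. ?S - {u} \<in> K")
    case False
    then obtain a where a: "a \<in> ?S" "?S - {a} \<notin> K" by blast
    have "z l = 0" if z: "z \<in> cycles K k" and l: "v \<in> set l" for z l
    proof -
      have zc: "z \<in> oriented_chains K k" using z by (simp add: cycles_def)
      show ?thesis
      proof (cases "a = v")
        case False
        obtain l0 where l0: "set l0 = ?S - {a}" "distinct l0"
          using finite_distinct_list[of "?S - {a}"] fS by auto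
        have "z l0 = 0" using a(2) chain_simplex(3)[OF zc, of l0] l0 by auto
        moreover have "length l0 = k + 1" using l0 a(1) cS fS distinct_card[OF l0(2)] by simp
        ultimately show ?thesis
          using cycle_determined_at_vertex[OF K z k n _ _ l0(2) _ _ l] l0 False by auto
      next
        case True
        \<comment> \<open>The missing facet is the one opposite \<open>v\<close>, so its absence
          says nothing directly about lists through \<open>v\<close>. The cycle condition is applied
          at a face \<open>l'\<close> of that facet instead: by \<open>iso\<close> it extends only
          by \<open>v\<close> and by the omitted \<open>b\<close>, and the latter extension is the
          missing facet.\<close>
        have N: "nbrs K v \<notin> K" using a True vn by simp
        obtain b where b: "b \<in> nbrs K v" using n by (metis Suc_eq_plus1 card.empty ex_in_conv nat.distinct(1))
        obtain l' where l': "set l' = nbrs K v - {b}" "distinct l'"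
          using finite_distinct_list[of "nbrs K v - {b}"] fS by auto
        have len: "length l' = k" using l' b n distinct_card[OF l'(2)] finite_nbrs[OF K] by simp
        have ne: "l' \<noteq> []" using len k by auto
        have "set (b # l') = nbrs K v" using l' b by auto
        then have zb: "z (b # l') = 0" using N chain_simplex(3)[OF zc, of "b # l'"] by metis
        have "(\<Sum>u\<in>{v, b}. z (u # l')) = 0"
        proof (rule cycle_at_list[OF z ne fin])
          fix u assume u: "z (u # l') \<noteq> 0"
          obtain w where w: "w \<in> set l'" using ne by (meson list.set_sel(1))
          have "{u, w} \<in> K"
            by (rule simplicial_complex_face[OF K chain_simplex(3)[OF zc u]]) (use w in auto)
          then have "u \<in> ?S" using iso w l' by blast
          then show "u \<in> {v, b}" using chain_simplex(2)[OF zc u] l' by auto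
        qed simp
        moreover have "v \<noteq> b" using b vn by blast
        ultimately have "z (v # l') = 0" using zb by simp
        moreover have "set (v # l') \<subseteq> ?S" "v \<in> set (v # l')" "distinct (v # l')" "length (v # l') = k + 1"
          using l' vn len by auto
        ultimately show ?thesis
          using cycle_determined_at_vertex[OF K z k n _ _ _ _ _ l, of "v # l'"] by blast
      qed
    qed
    then have "at_vertex v z = (\<lambda>_. 0)" if "z \<in> cycles K k" for z
      using that unfolding at_vertex_eq_zero by blast
    then have "at_vertex v ` cycles K k = {\<lambda>_. 0}"
      using cycles_zero[of K k] by (intro equalityI subsetI) (auto intro: image_eqI[of _ _ "\<lambda>l. 0"])
    then show ?thesis using False fun_dim_zero by (simp only: of_bool_eq)
  next
    case True
    \<comment> \<open>The elementary chain of \<open>?S\<close> need not exist in \<open>K\<close>,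
      so the simplex is adjoined, the boundary taken in \<open>?K'\<close>, and the result, which
      lives on the facets, is recognised as a cycle of \<open>K\<close>.\<close>
    let ?K' = "insert ?S K"
    have sub: "\<tau> \<in> K" if "\<tau> \<subseteq> ?S" "\<tau> \<noteq> {}" "\<tau> \<noteq> ?S" for \<tau>
    proof -
      have "\<exists>u. u \<in> ?S \<and> u \<notin> \<tau>" using that(1,3) by blast
      then obtain u where u: "u \<in> ?S" "u \<notin> \<tau>" by blast
      have "?S - {u} \<in> K" using True u(1) by blast
      moreover have "\<tau> \<subseteq> ?S - {u}" using \<open>\<tau> \<subseteq> ?S\<close> u(2) by blast
      ultimately show ?thesis using simplicial_complex_face[OF K _ _ \<open>\<tau> \<noteq> {}\<close>] by blast
    qed
    have K': "simplicial_complex ?K'"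
      unfolding simplicial_complex_def
    proof (intro conjI ballI allI impI)
      show "finite ?K'" using K unfolding simplicial_complex_def by simp
      fix \<sigma> assume \<sigma>: "\<sigma> \<in> ?K'"
      show "finite \<sigma>" "\<sigma> \<noteq> {}" using \<sigma> K fS unfolding simplicial_complex_def by auto
      fix \<tau> assume \<tau>: "\<tau> \<subseteq> \<sigma>" "\<tau> \<noteq> {}"
      show "\<tau> \<in> ?K'"
      proof (cases "\<sigma> = ?S")
        case True
        then show ?thesis using sub[of \<tau>] \<tau> by blast
      next
        case False
        then have "\<sigma> \<in> K" using \<sigma> by blast
        then show ?thesis using simplicial_complex_face[OF K _ \<tau>] by blast
      qed
    qed
    obtain e where e: "e \<in> oriented_chains ?K' (k + 1)" "\<And>l. e l \<noteq> 0 \<longleftrightarrow> distinct l \<and> set l = ?S"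
      using elementary_chain_exists[OF K', of ?S "k + 1"] cS by auto
    define z where "z = boundary ?K' e"
    have z': "z \<in> oriented_chains ?K' k" unfolding z_def using boundary_chain[OF K', of e k] e(1) by simp
    have "set l \<noteq> ?S" if "z l \<noteq> 0" for l
      using chain_simplex(1,2)[OF z' that] cS distinct_card[of l] by auto
    then have zc: "z \<in> oriented_chains K k"
      using z' unfolding oriented_chains_def by auto
    \<comment> \<open>\<open>boundary\<close> refers to the complex only through its vertex set, so
      equal vertex sets make the two boundary operators equal.\<close>
    have un: "\<Union>?K' = \<Union>K"
    proof -
      have "u \<in> \<Union>K" if "u \<in> ?S" for u
      proof -
        have "card {u} \<noteq> card ?S" using cS by simp
        then have "{u} \<noteq> ?S" by metis
        then show ?thesis using sub[of "{u}"] that by auto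
      qed
      then show ?thesis by auto
    qed
    have "boundary K z = boundary ?K' z" unfolding boundary_def un ..
    also have "\<dots> = (\<lambda>l. 0)" unfolding z_def by (rule boundary_boundary[OF e(1)])
    finally have z: "z \<in> cycles K k" using zc by (simp add: cycles_def)
    obtain b where b: "b \<in> nbrs K v" using n by (metis Suc_eq_plus1 card.empty ex_in_conv nat.distinct(1))
    obtain l0 where l0: "set l0 = ?S - {b}" "distinct l0"
      using finite_distinct_list[of "?S - {b}"] fS by auto
    have len: "length l0 = k + 1" using l0 b cS fS distinct_card[OF l0(2)] by simp
    have vl0: "v \<in> set l0" using l0 b vn by auto
    \<comment> \<open>Only \<open>b\<close> completes \<open>l0\<close> to an enumeration of
      \<open>?S\<close>, so the boundary coefficient at \<open>l0\<close> is the nonzero value of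
      \<open>e\<close> at \<open>b # l0\<close>.\<close>
    have "z l0 = (\<Sum>u\<in>\<Union>?K'. e (u # l0))" unfolding z_def boundary_def using vl0 by auto
    also have "\<dots> = (\<Sum>u\<in>{b}. e (u # l0))"
    proof (rule sum.mono_neutral_right[OF simplicial_complex_finite_vertices[OF K']])
      show "\<forall>u\<in>\<Union>?K' - {b}. e (u # l0) = 0"
      proof (rule ballI, rule ccontr)
        fix u assume u: "u \<in> \<Union>?K' - {b}" "e (u # l0) \<noteq> 0"
        then have "insert u (set l0) = ?S" using e(2)[of "u # l0"] by simp
        then show False using u b l0 by auto
      qed
    qed (use b in auto)
    also have "\<dots> \<noteq> 0" using e(2)[of "b # l0"] l0 b by auto
    finally have z0: "z l0 \<noteq> 0" .
    have "fun_dim (at_vertex v ` cycles K k) = 1"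
    proof (rule fun_dim_one[where s = l0])
      show "finite (simplex_lists K k)" by (rule finite_simplex_lists[OF K])
      show "fun_subspace (at_vertex v ` cycles K k)"
        by (rule fun_subspace_image[OF fun_subspace_cycles fun_linear_at_vertex])
      show "at_vertex v ` cycles K k \<subseteq> supported_funs (simplex_lists K k)"
        using cycles_supported[of K k] unfolding supported_funs_def at_vertex_def by auto
      show "at_vertex v z \<in> at_vertex v ` cycles K k" using z by simp
      have "at_vertex v z l0 \<noteq> 0" using z0 vl0 by (simp add: at_vertex_def)
      then show "at_vertex v z \<noteq> (\<lambda>_. 0)" by metis
      fix c assume "c \<in> at_vertex v ` cycles K k" "c l0 = 0"
      then obtain y where y: "y \<in> cycles K k" "c = at_vertex v y" "y l0 = 0"
        using vl0 by (auto simp: at_vertex_def)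
      have "set l0 \<subseteq> ?S" using l0 by blast
      from cycle_determined_at_vertex[OF K y(1) k n this vl0 l0(2) len y(3)]
      show "c = (\<lambda>_. 0)" unfolding y(2) at_vertex_eq_zero by blast
    qed
    then show ?thesis using True by simp
  qed
qed

text \<open>There are just enough vertices for a single \<open>j\<close>-simplex through
  \<open>v\<close>, namely \<open>v\<close> with all neighbours, and one coefficient of it
  determines the chain at \<open>v\<close>.\<close>

lemma fun_dim_chains_at_vertex:
  assumes K: "simplicial_complex K" and n: "card (nbrs K v) = j"
  shows "fun_dim (at_vertex v ` oriented_chains K j) = of_bool (insert v (nbrs K v) \<in> K)"
proof -
  let ?S = "insert v (nbrs K v)"
  have fS: "finite ?S" using finite_nbrs[OF K] by simp
  have cS: "card ?S = j + 1" using n finite_nbrs[OF K, of v] by (simp add: nbrs_def)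
  have full: "set l = ?S" if "c \<in> oriented_chains K j" "c l \<noteq> 0" "v \<in> set l" for c l
  proof (rule card_subset_eq[OF fS])
    note L = chain_simplex[OF that(1,2)]
    show "set l \<subseteq> ?S" by (rule star_simplex_subset[OF K L(3) that(3)])
    show "card (set l) = card ?S" using L(1) distinct_card[OF L(2)] cS by simp
  qed
  show ?thesis
  proof (cases "?S \<in> K")
    case False
    have "c l = 0" if "c \<in> oriented_chains K j" "v \<in> set l" for c l
      using full[OF that(1) _ that(2)] False chain_simplex(3)[OF that(1), of l] by metis
    then have "at_vertex v c = (\<lambda>_. 0)" if "c \<in> oriented_chains K j" for c
      using that unfolding at_vertex_eq_zero by blast
    then have "at_vertex v ` oriented_chains K j = {\<lambda>_. 0}"
      using oriented_chains_zero[of K j] by (intro equalityI subsetI) (auto intro: image_eqI[of _ _ "\<lambda>l. 0"])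
    then show ?thesis using False fun_dim_zero by simp
  next
    case True
    obtain e where e: "e \<in> oriented_chains K j" "\<And>l. e l \<noteq> 0 \<longleftrightarrow> distinct l \<and> set l = ?S"
      using elementary_chain_exists[OF K True cS] by metis
    obtain l0 where l0: "set l0 = ?S" "distinct l0"
      using finite_distinct_list[OF fS] by auto
    have vl0: "v \<in> set l0" using l0 by simp
    have "fun_dim (at_vertex v ` oriented_chains K j) = 1"
    proof (rule fun_dim_one[where s = l0])
      show "finite (simplex_lists K j)" by (rule finite_simplex_lists[OF K])
      show "fun_subspace (at_vertex v ` oriented_chains K j)"
        by (rule fun_subspace_image[OF fun_subspace_chains fun_linear_at_vertex])
      show "at_vertex v ` oriented_chains K j \<subseteq> supported_funs (simplex_lists K j)"
        using oriented_chains_supported[of K j] unfolding supported_funs_def at_vertex_def by auto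
      show "at_vertex v e \<in> at_vertex v ` oriented_chains K j" using e by simp
      have "at_vertex v e l0 \<noteq> 0" using e(2) l0 vl0 by (simp add: at_vertex_def)
      then show "at_vertex v e \<noteq> (\<lambda>_. 0)" by metis
      fix c assume "c \<in> at_vertex v ` oriented_chains K j" "c l0 = 0"
      then obtain y where y: "y \<in> oriented_chains K j" "c = at_vertex v y" "y l0 = 0"
        using vl0 by (auto simp: at_vertex_def)
      have "y l = 0" if "v \<in> set l" for l
      proof (rule ccontr)
        assume nz: "y l \<noteq> 0"
        have "set l = set l0" using full[OF y(1) nz that] l0 by simp
        with chain_zero_iff[OF y(1) chain_simplex(2)[OF y(1) nz] l0(2)] y(3) nz show False by simp
      qed
      then show "c = (\<lambda>_. 0)" unfolding y(2) at_vertex_eq_zero by blast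
    qed
    then show ?thesis using True by simp
  qed
qed

lemma at_vertex_image_zero:
  assumes "A \<subseteq> oriented_chains K j" "(\<lambda>_. 0) \<in> A" "\<And>c l. c \<in> A \<Longrightarrow> v \<in> set l \<Longrightarrow> c l = 0"
  shows "fun_dim (at_vertex v ` A) = 0"
proof -
  have "at_vertex v c = (\<lambda>_. 0)" if "c \<in> A" for c
    using that assms(3) unfolding at_vertex_eq_zero by blast
  then have "at_vertex v ` A = {\<lambda>_. 0}" using assms(2) by force
  then show ?thesis using fun_dim_zero by simp
qed

text \<open>In \<open>betti_delete_vertex\<close> the cycles of dimension \<open>k + 1\<close>
  contribute nothing, by \<open>cycle_vanishes_few_nbrs\<close>. With exactly \<open>k + 1\<close>
  neighbours the other two terms are the indicators that all facets are present and that the full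
  simplex is present; their difference is the indicator of an empty simplex. With fewer neighbours
  both are 0.\<close>

lemma betti_delete_vertex_isolated:
  assumes K: "simplicial_complex K" and k: "k \<ge> 1" and n: "card (nbrs K v) \<le> k + 1"
    and iso: "\<And>u w. card (nbrs K v) = k + 1 \<Longrightarrow> w \<in> nbrs K v \<Longrightarrow> {u, w} \<in> K \<Longrightarrow> u \<in> insert v (nbrs K v)"
  shows "betti K k = betti (delete_vertex v K) k +
    of_bool (card (nbrs K v) = k + 1 \<and> empty_simplex K (insert v (nbrs K v)))"
proof -
  let ?S = "insert v (nbrs K v)"
  have z1: "fun_dim (at_vertex v ` cycles K (k + 1)) = 0"
    using cycle_vanishes_few_nbrs[OF K, of _ "k + 1" v] n
    by (intro at_vertex_image_zero[OF cycles_subset cycles_zero]) simp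
  show ?thesis
  proof (cases "card (nbrs K v) = k + 1")
    case True
    have "betti K k + of_bool (?S \<in> K) = betti (delete_vertex v K) k + of_bool (\<forall>u\<in>?S. ?S - {u} \<in> K)"
      using betti_delete_vertex[OF K, of k v] z1 fun_dim_cycles_at_vertex[OF K k True iso[OF True]]
        fun_dim_chains_at_vertex[OF K True] by simp
    moreover have "\<forall>u\<in>?S. ?S - {u} \<in> K" if "?S \<in> K"
    proof
      fix u assume "u \<in> ?S"
      have "\<not> ?S \<subseteq> {u}" 
        using card_mono[of "{u}" ?S] True finite_nbrs[OF K, of v] by (auto simp: nbrs_def)
      then show "?S - {u} \<in> K" by (intro simplicial_complex_face[OF K that]) auto
    qed
    ultimately show ?thesis using True unfolding empty_simplex_def by (auto simp: of_bool_def split: if_splits)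
  next
    case False
    have z0: "fun_dim (at_vertex v ` cycles K k) = 0"
      using cycle_vanishes_few_nbrs[OF K, of _ k v] n k False
      by (intro at_vertex_image_zero[OF cycles_subset cycles_zero]) simp
    have c1: "fun_dim (at_vertex v ` oriented_chains K (k + 1)) = 0"
      using chain_vanishes_few_nbrs[OF K, of _ "k + 1" v] n False
      by (intro at_vertex_image_zero[OF order_refl oriented_chains_zero]) simp
    show ?thesis using betti_delete_vertex[OF K, of k v] z0 z1 c1 False by simp
  qed
qed

text \<open>Vertices are removed one at a time: among at most \<open>k + 1\<close> vertices each has
  at most \<open>k\<close> neighbours, so \<open>betti_delete_vertex_isolated\<close> leaves the
  Betti number unchanged down to the empty complex.\<close>

lemma betti_few_vertices:
  assumes K: "simplicial_complex K" and k: "k \<ge> 1" and n: "card (\<Union>K) \<le> k + 1"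
  shows "betti K k = 0"
proof -
  have "betti K k = 0" if "finite K" "simplicial_complex K" "card (\<Union>K) \<le> k + 1" for K :: "'a set set"
    using that
  proof (induction "card (\<Union>K)" arbitrary: K rule: less_induct)
    case less
    note K = less.prems(2)
    note fin = simplicial_complex_finite_vertices[OF K]
    show ?case
    proof (cases "\<Union>K = {}")
      case True
      then have "K = {}" using K unfolding simplicial_complex_def by blast
      then have z: "oriented_chains K j = {\<lambda>_. 0}" for j
        using oriented_chains_zero[of K j] chain_simplex(3)[of _ K j] by blast
      then have "cycles K j = {\<lambda>_. 0}" for j
        using cycles_subset[of K j] cycles_zero[of K j] by auto
      then show ?thesis using betti_dimension[OF K, of k] z fun_dim_zero by simp
    next
      case False
      then obtain v where v: "v \<in> \<Union>K" by blast
      have "\<Union>(delete_vertex v K) \<subseteq> \<Union>K - {v}" by (auto simp: delete_vertex_def)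
      then have le: "card (\<Union>(delete_vertex v K)) \<le> card (\<Union>K) - 1"
        using card_mono[of "\<Union>K - {v}" "\<Union>(delete_vertex v K)"] fin v by simp
      have pos: "card (\<Union>K) > 0" using v fin card_gt_0_iff by blast
      have 0: "betti (delete_vertex v K) k = 0"
        using le pos less.prems finite_subset[of "delete_vertex v K" K]
        by (intro less.hyps simplicial_complex_delete_vertex[OF K]) (auto simp: delete_vertex_def)
      have "nbrs K v \<subseteq> \<Union>K - {v}" by (auto simp: nbrs_def)
      then have "card (nbrs K v) \<le> card (\<Union>K) - 1"
        using card_mono[of "\<Union>K - {v}" "nbrs K v"] fin v by simp
      then have "card (nbrs K v) \<le> k" using less.prems(3) pos by simp
      then show ?thesis using betti_delete_vertex_isolated[OF K k, of v] 0 by simp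
    qed
  qed
  then show ?thesis using assms unfolding simplicial_complex_def by blast
qed

section \<open>Invariance under relabelling\<close>

text \<open>Pullback of chains along \<open>f\<close>. The cut-off to lists over
  \<open>\<Union>K\<close> is there because \<open>f\<close> will be injective only on the vertices:
  a foreign list may be mapped onto a simplex of the image.\<close>

definition relabel :: "('v \<Rightarrow> 'w) \<Rightarrow> 'v set set \<Rightarrow> ('w list \<Rightarrow> rat) \<Rightarrow> ('v list \<Rightarrow> rat)" where
  "relabel f K c = (\<lambda>l. if set l \<subseteq> \<Union>K then c (map f l) else 0)"

lemma fun_linear_relabel: "fun_linear A (relabel f K)"
  unfolding fun_linear_def relabel_def by (simp add: fun_eq_iff)

lemma relabel_chain:
  assumes f: "inj_on f (\<Union>K)" and c: "c \<in> oriented_chains ((`) f ` K) j"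
  shows "relabel f K c \<in> oriented_chains K j"
  unfolding oriented_chains_def mem_Collect_eq
proof (intro conjI allI impI)
  fix l assume "relabel f K c l \<noteq> 0"
  then have l: "set l \<subseteq> \<Union>K" "c (map f l) \<noteq> 0" by (auto simp: relabel_def split: if_splits)
  note L = chain_simplex[OF c l(2)]
  show "length l = j + 1" using L(1) by simp
  show "distinct l" using L(2) by (simp add: distinct_map)
  obtain \<sigma> where \<sigma>: "\<sigma> \<in> K" "f ` set l = f ` \<sigma>" using L(3) by auto
  then have "set l = \<sigma>" using inj_on_image_eq_iff[OF f l(1), of \<sigma>] by blast
  then show "set l \<in> K" using \<sigma> by simp
next
  fix l :: "'a list" and p assume p: "p permutes {..<length l}"
  then show "relabel f K c (permute_list p l) = of_int (sign p) * relabel f K c l"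
    using chain_permute[OF c, of p "map f l"] by (simp add: relabel_def permute_list_map)
qed

lemma boundary_relabel:
  assumes f: "inj_on f (\<Union>K)"
  shows "boundary K (relabel f K c) = relabel f K (boundary ((`) f ` K) c)"
proof
  fix l
  have U: "\<Union>((`) f ` K) = f ` \<Union>K" by blast
  show "boundary K (relabel f K c) l = relabel f K (boundary ((`) f ` K) c) l"
    unfolding boundary_def relabel_def U by (auto simp: sum.reindex[OF f])
qed

lemma relabel_cycle:
  assumes f: "inj_on f (\<Union>K)" and c: "c \<in> cycles ((`) f ` K) j"
  shows "relabel f K c \<in> cycles K j"
proof -
  have "boundary K (relabel f K c) = relabel f K (\<lambda>_. 0)"
    using boundary_relabel[OF f, of c] c by (simp add: cycles_def)
  also have "\<dots> = (\<lambda>_. 0)" by (auto simp: relabel_def)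
  finally show ?thesis using relabel_chain[OF f] c by (simp add: cycles_def)
qed

lemma relabel_inverse:
  assumes f: "inj_on f (\<Union>K)" and c: "c \<in> oriented_chains K j"
  defines "g \<equiv> inv_into (\<Union>K) f"
  shows "relabel f K (relabel g ((`) f ` K) c) = c"
proof
  fix l
  have U: "\<Union>((`) f ` K) = f ` \<Union>K" by blast
  show "relabel f K (relabel g ((`) f ` K) c) l = c l"
  proof (cases "set l \<subseteq> \<Union>K")
    case True
    then have "map g (map f l) = l"
      using inv_into_f_f[OF f] by (simp add: g_def map_idI subset_iff)
    moreover have "set (map f l) \<subseteq> f ` \<Union>K" using True by auto
    ultimately show ?thesis using True unfolding relabel_def U by simp
  next
    case False
    then have "c l = 0" using chain_simplex(3)[OF c, of l] by blast
    then show ?thesis using False by (simp add: relabel_def)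
  qed
qed

text \<open>\<open>relabel\<close> along \<open>f\<close> and along its inverse identifies the
  chains and the cycles of the two complexes, and \<open>betti_dimension\<close> expresses the Betti
  number by these alone, so no map between homology spaces is constructed.\<close>

lemma betti_image:
  assumes K: "simplicial_complex K" and f: "inj_on f (\<Union>K)"
  shows "betti ((`) f ` K) k = betti K k"
proof -
  let ?K' = "(`) f ` K" and ?g = "inv_into (\<Union>K) f"
  have U: "\<Union>?K' = f ` \<Union>K" by blast
  have g: "inj_on ?g (\<Union>?K')" unfolding U by (rule inj_on_inv_into) simp
  have id: "(`) ?g ` ?K' = K"
  proof -
    have "?g ` f ` \<sigma> = \<sigma>" if "\<sigma> \<in> K" for \<sigma>
    proof -
      have "\<sigma> \<subseteq> \<Union>K" using that by blast
      then show ?thesis using inv_into_image_cancel[OF f] by blast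
    qed
    then show ?thesis unfolding image_image by auto
  qed
  have K': "simplicial_complex ?K'"
    unfolding simplicial_complex_def
  proof (intro conjI ballI allI impI)
    fix \<sigma> assume "\<sigma> \<in> ?K'"
    then obtain s where s: "s \<in> K" "\<sigma> = f ` s" by blast
    show "finite \<sigma>" "\<sigma> \<noteq> {}" using s K unfolding simplicial_complex_def by auto
    fix \<tau> assume "\<tau> \<subseteq> \<sigma>" "\<tau> \<noteq> {}"
    then obtain t where "t \<subseteq> s" "\<tau> = f ` t" "t \<noteq> {}" using s by (metis image_is_empty subset_imageE)
    then show "\<tau> \<in> ?K'" using simplicial_complex_face[OF K s(1)] by blast
  qed (use K in \<open>simp add: simplicial_complex_def\<close>)
  have idr: "relabel ?g ?K' (relabel f K c) = c" if c: "c \<in> oriented_chains ?K' j" for c j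
  proof
    fix l
    show "relabel ?g ?K' (relabel f K c) l = c l"
    proof (cases "set l \<subseteq> \<Union>?K'")
      case True
      then have "map f (map ?g l) = l"
        unfolding U by (auto intro!: map_idI simp: f_inv_into_f subset_iff)
      moreover have "set (map ?g l) \<subseteq> \<Union>K"
      proof -
        have "?g u \<in> \<Union>K" if "u \<in> set l" for u
          using True that unfolding U by (intro inv_into_into) blast
        then show ?thesis by auto
      qed
      ultimately show ?thesis using True unfolding relabel_def by simp
    next
      case False
      then have "c l = 0" using chain_simplex(3)[OF c, of l] by blast
      then show ?thesis using False by (simp add: relabel_def)
    qed
  qed
  have zero: "c = (\<lambda>_. 0)" if "c \<in> oriented_chains ?K' j" "relabel f K c = (\<lambda>_. 0)" for c j
  proof -
    have "relabel ?g ?K' (\<lambda>_. 0) = (\<lambda>_. 0)" by (simp add: relabel_def)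
    then show ?thesis using idr[OF that(1)] that(2) by metis
  qed
  have C: "relabel f K ` oriented_chains ?K' j = oriented_chains K j" for j
  proof (intro equalityI subsetI)
    fix c assume c: "c \<in> oriented_chains K j"
    have "relabel ?g ?K' c \<in> oriented_chains ?K' j"
      by (rule relabel_chain[OF g]) (use c id in simp)
    then show "c \<in> relabel f K ` oriented_chains ?K' j" using relabel_inverse[OF f c] by (metis imageI)
  qed (use relabel_chain[OF f] in blast)
  have Z: "relabel f K ` cycles ?K' j = cycles K j" for j
  proof (intro equalityI subsetI)
    fix c assume c: "c \<in> cycles K j"
    then have c': "c \<in> oriented_chains K j" using cycles_subset by blast
    have "relabel ?g ?K' c \<in> cycles ?K' j"
      by (rule relabel_cycle[OF g]) (use c id in simp)
    then show "c \<in> relabel f K ` cycles ?K' j" using relabel_inverse[OF f c'] by (metis imageI)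
  qed (use relabel_cycle[OF f] in blast)
  have "fun_dim (oriented_chains ?K' j) = fun_dim (oriented_chains K j)" for j
    by (rule fun_dim_eq_of_bij[OF finite_simplex_lists[OF K'] fun_subspace_chains oriented_chains_supported
          fun_linear_relabel C zero])
  moreover have "fun_dim (cycles ?K' j) = fun_dim (cycles K j)" for j
    by (rule fun_dim_eq_of_bij[OF finite_simplex_lists[OF K'] fun_subspace_cycles cycles_supported
          fun_linear_relabel Z zero[OF subsetD[OF cycles_subset]]])
  ultimately show ?thesis using betti_dimension[OF K, of k] betti_dimension[OF K', of k] by simp
qed

section \<open>Cech complexes of indexed points\<close>

text \<open>The event is attached to sets of indices instead of points, so that events for disjoint
  index sets are independent. Coinciding points are excluded automatically, by
  \<open>idx_empty_inj\<close>.\<close>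

definition idx_empty :: "real \<Rightarrow> ('i \<Rightarrow> 'a::metric_space) \<Rightarrow> 'i set \<Rightarrow> bool" where
  "idx_empty r x \<alpha> \<longleftrightarrow> (\<forall>i\<in>\<alpha>. (\<Inter>j\<in>\<alpha> - {i}. cball (x j) r) \<noteq> {}) \<and> (\<Inter>j\<in>\<alpha>. cball (x j) r) = {}"

lemma simplicial_complex_cech: "finite V \<Longrightarrow> simplicial_complex (cech_complex r V)"
  unfolding simplicial_complex_def
proof (intro conjI ballI allI impI)
  assume "finite V"
  then show "finite (cech_complex r V)"
    by (rule finite_subset[rotated, OF finite_Pow_iff[THEN iffD2]]) (auto simp: cech_complex_def)
next
  fix \<sigma> assume s: "\<sigma> \<in> cech_complex r V"
  then show "finite \<sigma>" "\<sigma> \<noteq> {}" by (simp_all add: cech_complex_def)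
  fix \<tau> assume t: "\<tau> \<subseteq> \<sigma>" "\<tau> \<noteq> {}"
  have "(\<Inter>x\<in>\<sigma>. cball x r) \<subseteq> (\<Inter>x\<in>\<tau>. cball x r)" using t by blast
  then show "\<tau> \<in> cech_complex r V"
    using s t finite_subset[OF t(1)] unfolding cech_complex_def by blast
qed

lemma cech_edge_dist:
  assumes "\<sigma> \<in> cech_complex r V" "u \<in> \<sigma>" "w \<in> \<sigma>"
  shows "dist u w \<le> 2 * r"
proof -
  have "(\<Inter>x\<in>\<sigma>. cball x r) \<noteq> {}" using assms(1) by (simp add: cech_complex_def)
  then obtain p where "p \<in> (\<Inter>x\<in>\<sigma>. cball x r)" by blast
  then have "dist u p \<le> r" "dist w p \<le> r" using assms by auto
  then show ?thesis using dist_triangle2[of u w p] by simp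
qed

lemma vertices_cech: "\<Union>(cech_complex r V) \<subseteq> V"
  unfolding cech_complex_def by blast

lemma delete_vertex_cech: "v \<notin> V \<Longrightarrow> delete_vertex v (cech_complex r (insert v V)) = cech_complex r V"
  unfolding delete_vertex_def cech_complex_def by blast

lemma nbrs_cech: "nbrs (cech_complex r (insert v V)) v \<subseteq> {u \<in> V. dist u v \<le> 2 * r}"
proof
  fix u assume "u \<in> nbrs (cech_complex r (insert v V)) v"
  then have u: "u \<noteq> v" "{u, v} \<in> cech_complex r (insert v V)" by (simp_all add: nbrs_def)
  then have "u \<in> V" unfolding cech_complex_def by blast
  then show "u \<in> {u \<in> V. dist u v \<le> 2 * r}" using cech_edge_dist[OF u(2), of u v] by simp
qed

text \<open>As \<open>S\<close> has a third vertex \<open>w\<close>, any two of its vertices lie in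
  a facet omitting such a \<open>w\<close>.\<close>

lemma empty_simplex_nbrs:
  assumes K: "simplicial_complex K" and e: "empty_simplex K S" and S: "finite S" "card S \<ge> 3" "v \<in> S"
  shows "S - {v} \<subseteq> nbrs K v"
proof
  fix u assume u: "u \<in> S - {v}"
  have "\<not> S \<subseteq> {u, v}" using card_mono[of "{u, v}" S] S(2) u by (auto simp: card_insert_if)
  then obtain w where w: "w \<in> S" "w \<noteq> u" "w \<noteq> v" by blast
  have "{u, v} \<in> K"
    by (rule simplicial_complex_face[OF K, of "S - {w}"]) (use e w u S in \<open>auto simp: empty_simplex_def\<close>)
  then show "u \<in> nbrs K v" using u by (simp add: nbrs_def)
qed

text \<open>Adjacent points are at distance at most \<open>2 * r\<close>, so a vertex adjacent to a
  neighbour of \<open>v\<close> is within \<open>4 * r\<close>: this is where the radius of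
  \<open>N\<close> comes from. If \<open>v\<close> has \<open>k + 1\<close> neighbours they exhaust
  \<open>N\<close>, and no edge leaves the star. If \<open>N\<close> is larger than the
  neighbourhood, the indicator is 0, since the vertices of an empty simplex are pairwise
  adjacent.\<close>

lemma betti_cech_insert:
  assumes V: "finite V" "v \<notin> V" and k: "k \<ge> 1" and r: "r > 0"
  defines "N \<equiv> {u \<in> V. dist u v \<le> 4 * r}"
  assumes n: "card N \<le> k + 1"
  shows "betti (cech_complex r (insert v V)) k = betti (cech_complex r V) k +
    of_bool (card N = k + 1 \<and> empty_simplex (cech_complex r (insert v V)) (insert v N))"
proof -
  let ?K = "cech_complex r (insert v V)"
  have K: "simplicial_complex ?K" using V by (intro simplicial_complex_cech) simp
  have fN: "finite N" using V by (simp add: N_def)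
  have sub: "nbrs ?K v \<subseteq> N"
    using nbrs_cech[of r v V] r unfolding N_def by fastforce
  have le: "card (nbrs ?K v) \<le> card N" by (rule card_mono[OF fN sub])
  have iso: "u \<in> insert v (nbrs ?K v)" if "card (nbrs ?K v) = k + 1" "w \<in> nbrs ?K v" "{u, w} \<in> ?K" for u w
  proof -
    have eq: "nbrs ?K v = N" using card_subset_eq[OF fN sub] that(1) n le by simp
    have "dist w v \<le> 2 * r" using nbrs_cech[of r v V] that(2) by blast
    moreover have "dist u w \<le> 2 * r" using cech_edge_dist[OF that(3)] by simp
    ultimately have "dist u v \<le> 4 * r" using dist_triangle[of u v w] by simp
    moreover have "u \<in> insert v V" using that(3) vertices_cech[of r "insert v V"] by blast
    ultimately show ?thesis unfolding eq N_def by blast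
  qed
  have "card (nbrs ?K v) = k + 1 \<and> empty_simplex ?K (insert v (nbrs ?K v)) \<longleftrightarrow>
    card N = k + 1 \<and> empty_simplex ?K (insert v N)"
  proof
    assume "card (nbrs ?K v) = k + 1 \<and> empty_simplex ?K (insert v (nbrs ?K v))"
    then show "card N = k + 1 \<and> empty_simplex ?K (insert v N)"
      using card_subset_eq[OF fN sub] n le by simp
  next
    assume *: "card N = k + 1 \<and> empty_simplex ?K (insert v N)"
    have vN: "v \<notin> N" using V by (simp add: N_def)
    have "insert v N - {v} \<subseteq> nbrs ?K v"
      by (rule empty_simplex_nbrs[OF K]) (use * fN vN k in auto)
    then have "nbrs ?K v = N" using sub vN by auto
    then show "card (nbrs ?K v) = k + 1 \<and> empty_simplex ?K (insert v (nbrs ?K v))" using * by simp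
  qed
  then show ?thesis
    using betti_delete_vertex_isolated[OF K k, of v] le n iso delete_vertex_cech[OF V(2), of r] by simp
qed

lemma betti_cech_insert_le:
  assumes V: "finite V" "v \<notin> V" and r: "r > 0"
  shows "\<bar>real (betti (cech_complex r (insert v V)) k) - real (betti (cech_complex r V) k)\<bar>
    \<le> 2 * (real (card {u \<in> V. dist u v \<le> 4 * r}) + 1) ^ (k + 2)"
proof -
  let ?K = "cech_complex r (insert v V)"
  have K: "simplicial_complex ?K" using V by (intro simplicial_complex_cech) simp
  have "card (nbrs ?K v) \<le> card {u \<in> V. dist u v \<le> 4 * r}"
    using nbrs_cech[of r v V] r V by (intro card_mono) fastforce+
  then have "2 * (real (card (nbrs ?K v)) + 1) ^ (k + 2) \<le> 2 * (real (card {u \<in> V. dist u v \<le> 4 * r}) + 1) ^ (k + 2)"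
    by (intro mult_left_mono power_mono) auto
  then show ?thesis
    using betti_delete_vertex_le[OF K, of k v] delete_vertex_cech[OF V(2), of r] by simp
qed

text \<open>Removing one vertex leaves \<open>k + 1\<close> points, where the Betti number is 0; the
  removed vertex accounts for the indicator. Its star is isolated because there are no further
  points.\<close>

lemma betti_cech_minimal:
  assumes V: "finite V" and c: "card V = k + 2" and k: "k \<ge> 1"
  shows "betti (cech_complex r V) k = of_bool (empty_simplex (cech_complex r V) V)"
proof -
  let ?K = "cech_complex r V"
  have K: "simplicial_complex ?K" by (rule simplicial_complex_cech[OF V])
  obtain v where v: "v \<in> V" using c by fastforce
  then obtain V' where V': "V = insert v V'" "v \<notin> V'" by (meson Set.set_insert)
  have fV': "finite V'" using V V' by simp
  have cV': "card V' = k + 1" using c V' fV' by simp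
  have sub: "nbrs ?K v \<subseteq> V'" using nbrs_cech[of r v V'] V' by auto
  have le: "card (nbrs ?K v) \<le> k + 1" using card_mono[OF fV' sub] cV' by simp
  have full: "nbrs ?K v = V'" if "card (nbrs ?K v) = k + 1"
    using card_subset_eq[OF fV' sub] that cV' by simp
  have fullV: "insert v (nbrs ?K v) = V" if "card (nbrs ?K v) = k + 1"
    using full[OF that] V'(1) by metis
  have "card (\<Union>(delete_vertex v ?K)) \<le> k + 1"
    using card_mono[OF fV', of "\<Union>(delete_vertex v ?K)"] vertices_cech[of r V'] delete_vertex_cech[OF V'(2), of r] V' cV' by simp
  then have 0: "betti (delete_vertex v ?K) k = 0"
    by (rule betti_few_vertices[OF simplicial_complex_delete_vertex[OF K] k])
  have "betti ?K k = betti (delete_vertex v ?K) k +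
    of_bool (card (nbrs ?K v) = k + 1 \<and> empty_simplex ?K (insert v (nbrs ?K v)))"
  proof (rule betti_delete_vertex_isolated[OF K k le])
    fix u w assume *: "card (nbrs ?K v) = k + 1" "{u, w} \<in> ?K"
    have "u \<in> V" using *(2) vertices_cech[of r V] by blast
    then show "u \<in> insert v (nbrs ?K v)" using fullV[OF *(1)] by (simp only:)
  qed
  moreover have "card (nbrs ?K v) = k + 1 \<and> empty_simplex ?K (insert v (nbrs ?K v)) \<longleftrightarrow> empty_simplex ?K V"
  proof
    assume "card (nbrs ?K v) = k + 1 \<and> empty_simplex ?K (insert v (nbrs ?K v))"
    then show "empty_simplex ?K V" using fullV by metis
  next
    assume *: "empty_simplex ?K V"
    have "V - {v} \<subseteq> nbrs ?K v" by (rule empty_simplex_nbrs[OF K * V]) (use c k v in auto)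
    then have "nbrs ?K v = V'" using sub V' by blast
    then have "card (nbrs ?K v) = k + 1" using cV' by metis
    then show "card (nbrs ?K v) = k + 1 \<and> empty_simplex ?K (insert v (nbrs ?K v))" using * fullV by metis
  qed
  ultimately show ?thesis using 0 by simp
qed

text \<open>If \<open>x i = x j\<close>, a common point of all balls but the \<open>i\<close>-th
  also lies in the \<open>i\<close>-th one, which equals the \<open>j\<close>-th.\<close>

lemma idx_empty_inj:
  assumes "idx_empty r x \<alpha>"
  shows "inj_on x \<alpha>"
proof (rule inj_onI, rule ccontr)
  fix i j assume ij: "i \<in> \<alpha>" "j \<in> \<alpha>" "x i = x j" "i \<noteq> j"
  have "(\<Inter>l\<in>\<alpha> - {i}. cball (x l) r) \<noteq> {}" using assms ij(1) unfolding idx_empty_def by blast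
  then obtain p where p: "p \<in> (\<Inter>l\<in>\<alpha> - {i}. cball (x l) r)" by blast
  have "p \<in> cball (x l) r" if "l \<in> \<alpha>" for l
  proof (cases "l = i")
    case True
    have "p \<in> cball (x j) r" using p ij by blast
    then show ?thesis using True ij(3) by simp
  qed (use p that in blast)
  then show False using assms unfolding idx_empty_def by blast
qed

lemma empty_simplex_image_iff:
  assumes "inj_on x \<alpha>" "finite \<alpha>" "card \<alpha> \<ge> 2" "x ` \<alpha> \<subseteq> V"
  shows "empty_simplex (cech_complex r V) (x ` \<alpha>) \<longleftrightarrow> idx_empty r x \<alpha>"
proof -
  have face: "x ` \<tau> \<in> cech_complex r V \<longleftrightarrow> (\<Inter>j\<in>\<tau>. cball (x j) r) \<noteq> {}" if "\<tau> \<subseteq> \<alpha>" "\<tau> \<noteq> {}" for \<tau>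
    using that assms(2,4) finite_subset[OF that(1)] unfolding cech_complex_def by auto
  have ne: "\<alpha> - {i} \<noteq> {}" for i using assms(3) card_mono[of "{i}" \<alpha>] by auto
  have img: "x ` \<alpha> - {x i} = x ` (\<alpha> - {i})" if "i \<in> \<alpha>" for i
    using inj_on_image_set_diff[OF assms(1), of \<alpha> "{i}"] that by simp
  have "(\<forall>u\<in>x ` \<alpha>. x ` \<alpha> - {u} \<in> cech_complex r V) \<longleftrightarrow> (\<forall>i\<in>\<alpha>. (\<Inter>j\<in>\<alpha> - {i}. cball (x j) r) \<noteq> {})"
    using img face[OF Diff_subset ne] by auto
  moreover have "\<alpha> \<noteq> {}" using ne by blast
  ultimately show ?thesis
    unfolding empty_simplex_def idx_empty_def face[OF order_refl \<open>\<alpha> \<noteq> {}\<close>] by (simp only: not_not)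
qed

lemma idx_empty_dist:
  assumes e: "idx_empty r x \<alpha>" and \<alpha>: "finite \<alpha>" "card \<alpha> \<ge> 3" "i \<in> \<alpha>" "j \<in> \<alpha>"
  shows "dist (x i) (x j) \<le> 2 * r"
proof -
  have "\<not> \<alpha> \<subseteq> {i, j}" using card_mono[of "{i, j}" \<alpha>] \<alpha>(2) by (auto simp: card_insert_if split: if_splits)
  then obtain l where l: "l \<in> \<alpha>" "l \<noteq> i" "l \<noteq> j" by blast
  have "(\<Inter>m\<in>\<alpha> - {l}. cball (x m) r) \<noteq> {}" using e l(1) unfolding idx_empty_def by blast
  then obtain p where "p \<in> (\<Inter>m\<in>\<alpha> - {l}. cball (x m) r)" by blast
  then have "dist (x i) p \<le> r" "dist (x j) p \<le> r" using l \<alpha> by auto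
  then show ?thesis using dist_triangle2[of "x i" "x j" p] by simp
qed

text \<open>Only the index \<open>i\<close> is left out: another index carrying the same point
  counts as near.\<close>

definition near :: "real \<Rightarrow> ('i \<Rightarrow> 'a::metric_space) \<Rightarrow> 'i \<Rightarrow> 'i set \<Rightarrow> 'i set" where
  "near r x i J = {j \<in> J. j \<noteq> i \<and> dist (x j) (x i) \<le> 4 * r}"

definition empties :: "real \<Rightarrow> nat \<Rightarrow> ('i \<Rightarrow> 'a::metric_space) \<Rightarrow> 'i set \<Rightarrow> 'i set set" where
  "empties r k x J = {\<alpha>. \<alpha> \<subseteq> J \<and> card \<alpha> = k + 2 \<and> idx_empty r x \<alpha>}"

definition betti_excess :: "real \<Rightarrow> nat \<Rightarrow> ('i \<Rightarrow> 'a::metric_space) \<Rightarrow> 'i set \<Rightarrow> real" where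
  "betti_excess r k x J = real (betti (cech_complex r (x ` J)) k) - real (card (empties r k x J))"

lemma finite_empties: "finite J \<Longrightarrow> finite (empties r k x J)"
  by (rule finite_subset[of _ "Pow J"]) (auto simp: empties_def)

lemma empties_at_subset:
  assumes J: "finite J" and k: "k \<ge> 1" and r: "r > 0" and \<alpha>: "\<alpha> \<in> empties r k x J" "i \<in> \<alpha>"
  shows "\<alpha> - {i} \<subseteq> near r x i J"
proof
  fix j assume j: "j \<in> \<alpha> - {i}"
  have f: "finite \<alpha>" using \<alpha> J finite_subset unfolding empties_def by blast
  have "dist (x j) (x i) \<le> 2 * r"
    using \<alpha> j k f by (intro idx_empty_dist[of r x \<alpha>]) (auto simp: empties_def)
  then show "j \<in> near r x i J" using j \<alpha> r unfolding near_def empties_def by auto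
qed

text \<open>Removing \<open>i\<close> maps these index sets injectively to
  \<open>(k + 1)\<close>-subsets of the near indices.\<close>

lemma card_empties_at:
  assumes J: "finite J" and k: "k \<ge> 1" and r: "r > 0"
  shows "card {\<alpha> \<in> empties r k x J. i \<in> \<alpha>} \<le> card (near r x i J) choose (k + 1)"
proof -
  have fn: "finite (near r x i J)" using J by (simp add: near_def)
  let ?T = "{\<tau>. \<tau> \<subseteq> near r x i J \<and> card \<tau> = k + 1}"
  have fT: "finite ?T" using fn by simp
  have "{\<alpha> \<in> empties r k x J. i \<in> \<alpha>} \<subseteq> insert i ` ?T"
  proof
    fix \<alpha> assume a: "\<alpha> \<in> {\<alpha> \<in> empties r k x J. i \<in> \<alpha>}"
    then have f: "finite \<alpha>" using J finite_subset unfolding empties_def by blast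
    have "\<alpha> - {i} \<in> ?T"
      using empties_at_subset[OF J k r, of \<alpha> x i] a f by (simp add: empties_def)
    then show "\<alpha> \<in> insert i ` ?T" using a by (intro image_eqI[of _ _ "\<alpha> - {i}"]) auto
  qed
  then have "card {\<alpha> \<in> empties r k x J. i \<in> \<alpha>} \<le> card (insert i ` ?T)"
    using fT by (intro card_mono) auto
  also have "\<dots> \<le> card ?T" by (rule card_image_le[OF fT])
  also have "\<dots> = card (near r x i J) choose (k + 1)" by (rule n_subsets[OF fn])
  finally show ?thesis .
qed

lemma card_empties_insert:
  assumes "finite I" "i \<notin> I"
  shows "card (empties r k x (insert i I)) = card (empties r k x I) + card {\<alpha> \<in> empties r k x (insert i I). i \<in> \<alpha>}"
proof -
  have "empties r k x (insert i I) = empties r k x I \<union> {\<alpha> \<in> empties r k x (insert i I). i \<in> \<alpha>}"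
    unfolding empties_def by blast
  moreover have "card (empties r k x I \<union> {\<alpha> \<in> empties r k x (insert i I). i \<in> \<alpha>}) =
    card (empties r k x I) + card {\<alpha> \<in> empties r k x (insert i I). i \<in> \<alpha>}"
  proof (rule card_Un_disjoint)
    show "finite (empties r k x I)" by (rule finite_empties[OF assms(1)])
    show "finite {\<alpha> \<in> empties r k x (insert i I). i \<in> \<alpha>}"
      by (rule finite_subset[OF _ finite_empties[of "insert i I" r k x]]) (use assms(1) in auto)
    show "empties r k x I \<inter> {\<alpha> \<in> empties r k x (insert i I). i \<in> \<alpha>} = {}"
      using assms(2) unfolding empties_def by blast
  qed
  ultimately show ?thesis by metis
qed

lemma near_insert: "i \<notin> I \<Longrightarrow> near r x i (insert i I) = near r x i I"
  unfolding near_def by auto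

lemma empties_at_few:
  assumes I: "finite I" "i \<notin> I" and k: "k \<ge> 1" and r: "r > 0" and n: "card (near r x i I) \<le> k + 1"
  shows "card {\<alpha> \<in> empties r k x (insert i I). i \<in> \<alpha>} =
    of_bool (card (near r x i I) = k + 1 \<and> idx_empty r x (insert i (near r x i I)))"
proof -
  let ?N = "near r x i I" and ?E = "{\<alpha> \<in> empties r k x (insert i I). i \<in> \<alpha>}"
  have fN: "finite ?N" using I by (simp add: near_def)
  have iN: "i \<notin> ?N" by (simp add: near_def)
  have "\<alpha> = insert i ?N \<and> card ?N = k + 1 \<and> idx_empty r x (insert i ?N)" if "\<alpha> \<in> ?E" for \<alpha>
  proof -
    have f: "finite \<alpha>" using that I finite_subset[of \<alpha> "insert i I"] unfolding empties_def by blast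
    have sub: "\<alpha> - {i} \<subseteq> ?N"
      using empties_at_subset[OF _ k r, of "insert i I" \<alpha> x i] that I near_insert[OF I(2), of r x] by auto
    have c: "card (\<alpha> - {i}) = k + 1" using that f by (simp add: empties_def)
    have "\<alpha> - {i} = ?N" using card_mono[OF fN sub] n c by (intro card_subset_eq[OF fN sub]) simp
    then have "\<alpha> = insert i ?N" using that by blast
    then show ?thesis using c \<open>\<alpha> - {i} = ?N\<close> that by (simp add: empties_def)
  qed
  moreover have "insert i ?N \<in> ?E" if "card ?N = k + 1" "idx_empty r x (insert i ?N)"
    using that fN iN I by (auto simp: empties_def near_def)
  ultimately have "?E = (if card ?N = k + 1 \<and> idx_empty r x (insert i ?N) then {insert i ?N} else {})"
    by auto
  then show ?thesis by simp
qed

text \<open>With at most \<open>k + 1\<close> near indices the only candidate for an empty simplex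
  through \<open>i\<close> is \<open>i\<close> together with all of them, so the count grows by the
  same indicator as the Betti number in \<open>betti_cech_insert\<close>. The work lies in passing
  between indices and points, which differ when points coincide.\<close>

lemma betti_excess_insert:
  assumes I: "finite I" "i \<notin> I" and k: "k \<ge> 1" and r: "r > 0" and n: "card (near r x i I) \<le> k + 1"
  shows "betti_excess r k x (insert i I) = betti_excess r k x I"
proof -
  let ?N = "near r x i I"
  have fN: "finite ?N" using I by (simp add: near_def)
  have iN: "i \<notin> ?N" by (simp add: near_def)
  have "betti (cech_complex r (x ` insert i I)) k = betti (cech_complex r (x ` I)) k +
    of_bool (card ?N = k + 1 \<and> idx_empty r x (insert i ?N))"
  proof (cases "x i \<in> x ` I")
    \<comment> \<open>The new point repeats an old one: the complex does not change, and the
      indicator is 0 because the repeated index is near.\<close>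
    case True
    then obtain j where j: "j \<in> I" "x j = x i" by auto
    then have "j \<in> ?N" using I r by (auto simp: near_def)
    then have "\<not> inj_on x (insert i ?N)" using j I(2) unfolding inj_on_def by auto
    then have "\<not> idx_empty r x (insert i ?N)" using idx_empty_inj by blast
    moreover have "x ` insert i I = x ` I" using True by auto
    ultimately show ?thesis by simp
  next
    case False
    have N: "{u \<in> x ` I. dist u (x i) \<le> 4 * r} = x ` ?N" using I unfolding near_def by auto
    have le: "card (x ` ?N) \<le> card ?N" by (rule card_image_le[OF fN])
    have "betti (cech_complex r (insert (x i) (x ` I))) k = betti (cech_complex r (x ` I)) k +
      of_bool (card (x ` ?N) = k + 1 \<and> empty_simplex (cech_complex r (insert (x i) (x ` I))) (insert (x i) (x ` ?N)))"
      using betti_cech_insert[of "x ` I" "x i" k r] I(1) False k r le n unfolding N by simp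
    moreover have "card (x ` ?N) = k + 1 \<and> empty_simplex (cech_complex r (insert (x i) (x ` I))) (insert (x i) (x ` ?N))
      \<longleftrightarrow> card ?N = k + 1 \<and> idx_empty r x (insert i ?N)"
    proof -
      have iff: "empty_simplex (cech_complex r (insert (x i) (x ` I))) (insert (x i) (x ` ?N)) \<longleftrightarrow>
        idx_empty r x (insert i ?N)" if "inj_on x ?N" "card ?N = k + 1"
      proof -
        have "inj_on x (insert i ?N)" using that False iN by (auto simp: near_def)
        then have "empty_simplex (cech_complex r (insert (x i) (x ` I))) (x ` insert i ?N) \<longleftrightarrow>
          idx_empty r x (insert i ?N)"
          using that fN iN by (intro empty_simplex_image_iff) (auto simp: near_def)
        then show ?thesis by simp
      qed
      show ?thesis
      proof
        assume *: "card (x ` ?N) = k + 1 \<and> empty_simplex (cech_complex r (insert (x i) (x ` I))) (insert (x i) (x ` ?N))"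
        then have "card ?N = k + 1" using le n by simp
        moreover have "inj_on x ?N" using * \<open>card ?N = k + 1\<close> fN by (simp add: eq_card_imp_inj_on)
        ultimately show "card ?N = k + 1 \<and> idx_empty r x (insert i ?N)" using iff * by blast
      next
        assume *: "card ?N = k + 1 \<and> idx_empty r x (insert i ?N)"
        then have "inj_on x ?N" using idx_empty_inj[of r x "insert i ?N"] by auto
        then show "card (x ` ?N) = k + 1 \<and> empty_simplex (cech_complex r (insert (x i) (x ` I))) (insert (x i) (x ` ?N))"
          using iff * by (simp add: card_image)
      qed
    qed
    ultimately show ?thesis by simp
  qed
  then show ?thesis
    using empties_at_few[OF I k r n] card_empties_insert[OF I, of r k x] by (simp add: betti_excess_def)
qed

text \<open>Crude bound for crowded points: the constant 3 adds the 2 of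
  \<open>betti_cech_insert_le\<close> and 1 for the new empty simplices, of which there are at most
  \<open>n choose (k + 1)\<close> when \<open>n\<close> indices are near.\<close>

lemma betti_excess_insert_le:
  assumes I: "finite I" "i \<notin> I" and k: "k \<ge> 1" and r: "r > 0"
  shows "\<bar>betti_excess r k x (insert i I) - betti_excess r k x I\<bar> \<le> 3 * (real (card (near r x i I)) + 1) ^ (k + 2)"
proof -
  let ?n = "card (near r x i I)"
  have "\<bar>real (betti (cech_complex r (x ` insert i I)) k) - real (betti (cech_complex r (x ` I)) k)\<bar>
    \<le> 2 * (real ?n + 1) ^ (k + 2)"
  proof (cases "x i \<in> x ` I")
    case True
    then have "x ` insert i I = x ` I" by auto
    then show ?thesis by simp
  next
    case False
    have "{u \<in> x ` I. dist u (x i) \<le> 4 * r} = x ` near r x i I" using I unfolding near_def by auto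
    then have "card {u \<in> x ` I. dist u (x i) \<le> 4 * r} \<le> ?n"
      using I by (simp add: card_image_le near_def)
    then have "2 * (real (card {u \<in> x ` I. dist u (x i) \<le> 4 * r}) + 1) ^ (k + 2) \<le> 2 * (real ?n + 1) ^ (k + 2)"
      by (intro mult_left_mono power_mono) auto
    then show ?thesis using betti_cech_insert_le[of "x ` I" "x i" r k] I False r by simp
  qed
  moreover have "real (card {\<alpha> \<in> empties r k x (insert i I). i \<in> \<alpha>}) \<le> (real ?n + 1) ^ (k + 2)"
  proof -
    have "card {\<alpha> \<in> empties r k x (insert i I). i \<in> \<alpha>} \<le> ?n choose (k + 1)"
      using card_empties_at[of "insert i I" k r x i] I k r near_insert[OF I(2), of r x] by simp
    also have "\<dots> \<le> ?n ^ (k + 1)"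
      by (cases "k + 1 \<le> ?n") (simp_all only: binomial_le_pow binomial_eq_0 not_le zero_le)
    also have "\<dots> \<le> (?n + 1) ^ (k + 1)" by (intro power_mono) auto
    also have "\<dots> \<le> (?n + 1) ^ (k + 2)" by (intro power_increasing) auto
    finally have "real (card {\<alpha> \<in> empties r k x (insert i I). i \<in> \<alpha>}) \<le> real ((?n + 1) ^ (k + 2))"
      by (rule of_nat_mono)
    then show ?thesis by (simp only: of_nat_power of_nat_add of_nat_1)
  qed
  ultimately show ?thesis using card_empties_insert[OF I, of r k x] unfolding betti_excess_def by linarith
qed

text \<open>Connectedness comes with the empty simplex, any two vertices of which are joined by an
  edge. If points coincide, at most \<open>k + 1\<close> vertices remain, the Betti number is 0, and
  \<open>idx_empty\<close> fails too. This identifies the event in \<open>cech_mu\<close> with the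
  one counted by \<open>W\<close>.\<close>

lemma betti_eq_one_iff:
  assumes k: "k \<ge> 1" and A: "finite A" "card A = k + 2"
  shows "complex_connected (cech_complex r (x ` A)) \<and> betti (cech_complex r (x ` A)) k = 1 \<longleftrightarrow> idx_empty r x A"
proof -
  let ?K = "cech_complex r (x ` A)"
  have K: "simplicial_complex ?K" using A by (intro simplicial_complex_cech) simp
  show ?thesis
  proof (cases "inj_on x A")
    case False
    then have "card (x ` A) \<le> k + 1" using A card_image_le[OF A(1), of x] eq_card_imp_inj_on[OF A(1), of x] by fastforce
    then have "card (\<Union>?K) \<le> k + 1"
      using card_mono[OF _ vertices_cech[of r "x ` A"]] A by fastforce
    then have "betti ?K k = 0" by (rule betti_few_vertices[OF K k])
    then show ?thesis using False idx_empty_inj by auto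
  next
    case True
    have c: "card (x ` A) = k + 2" using True A by (simp add: card_image)
    have "betti ?K k = of_bool (idx_empty r x A)"
      using betti_cech_minimal[of "x ` A" k r] empty_simplex_image_iff[OF True A(1), of "x ` A" r] A k c by simp
    moreover have "complex_connected ?K" if "idx_empty r x A"
    proof -
      have e: "empty_simplex ?K (x ` A)"
        using empty_simplex_image_iff[OF True A(1), of "x ` A" r] A that by simp
      have "(u, v) \<in> {(a, b). {a, b} \<in> ?K}\<^sup>*" if uv: "u \<in> \<Union>?K" "v \<in> \<Union>?K" for u v
      proof (cases "u = v")
        case False
        have "u \<in> x ` A" "v \<in> x ` A" using uv vertices_cech[of r "x ` A"] by blast+
        then have "u \<in> nbrs ?K v"
          using empty_simplex_nbrs[OF K e, of v] c k A False by auto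
        then show ?thesis by (auto simp: nbrs_def)
      qed simp
      then show ?thesis unfolding complex_connected_def by blast
    qed
    ultimately show ?thesis by auto
  qed
qed

text \<open>The map \<open>f\<close> sends \<open>x j\<close> to \<open>y j\<close>; it is well
  defined and injective by the second condition and carries faces to faces by the first. The Betti
  number is thus a function of a finite pattern of yes-no questions, on which its measurability
  rests.\<close>

lemma betti_cech_cong:
  fixes x y :: "'i \<Rightarrow> 'a::metric_space"
  assumes J: "finite J" and 1: "\<And>\<alpha>. \<alpha> \<subseteq> J \<Longrightarrow> (\<Inter>j\<in>\<alpha>. cball (x j) r) \<noteq> {} \<longleftrightarrow> (\<Inter>j\<in>\<alpha>. cball (y j) r) \<noteq> {}"
    and 2: "\<And>i j. i \<in> J \<Longrightarrow> j \<in> J \<Longrightarrow> x i = x j \<longleftrightarrow> y i = y j"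
  shows "betti (cech_complex r (x ` J)) k = betti (cech_complex r (y ` J)) k"
proof -
  define f where "f = (\<lambda>u. y (inv_into J x u))"
  have fx: "f (x j) = y j" if "j \<in> J" for j
  proof -
    have "inv_into J x (x j) \<in> J" "x (inv_into J x (x j)) = x j"
      using that by (auto intro: inv_into_into f_inv_into_f)
    then show ?thesis unfolding f_def using 2 that by blast
  qed
  have inj: "inj_on f (x ` J)" using 2 fx by (auto simp: inj_on_def)
  have face: "z ` \<alpha> \<in> cech_complex r (z ` J) \<longleftrightarrow> \<alpha> \<noteq> {} \<and> (\<Inter>j\<in>\<alpha>. cball (z j) r) \<noteq> {}"
    if "\<alpha> \<subseteq> J" for \<alpha> and z :: "'i \<Rightarrow> 'a"
    using that J finite_subset[OF that J] unfolding cech_complex_def by auto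
  have fimg: "f ` x ` \<alpha> = y ` \<alpha>" if "\<alpha> \<subseteq> J" for \<alpha> using fx that by (force simp: image_image)
  have "(`) f ` cech_complex r (x ` J) = cech_complex r (y ` J)"
  proof (intro equalityI subsetI)
    fix \<tau> assume "\<tau> \<in> (`) f ` cech_complex r (x ` J)"
    then obtain \<sigma> where s: "\<sigma> \<in> cech_complex r (x ` J)" "\<tau> = f ` \<sigma>" by blast
    have "\<sigma> \<subseteq> x ` J" using s(1) unfolding cech_complex_def by blast
    then obtain \<alpha> where a: "\<alpha> \<subseteq> J" "\<sigma> = x ` \<alpha>" by (meson subset_imageE)
    then have "\<alpha> \<noteq> {}" "(\<Inter>j\<in>\<alpha>. cball (x j) r) \<noteq> {}" using s(1) face[OF a(1), of x] by blast+
    then have "y ` \<alpha> \<in> cech_complex r (y ` J)" using face[OF a(1), of y] 1[OF a(1)] by blast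
    then show "\<tau> \<in> cech_complex r (y ` J)" unfolding s(2) a(2) fimg[OF a(1)] .
  next
    fix \<tau> assume t: "\<tau> \<in> cech_complex r (y ` J)"
    have "\<tau> \<subseteq> y ` J" using t unfolding cech_complex_def by blast
    then obtain \<alpha> where a: "\<alpha> \<subseteq> J" "\<tau> = y ` \<alpha>" by (meson subset_imageE)
    then have "\<alpha> \<noteq> {}" "(\<Inter>j\<in>\<alpha>. cball (y j) r) \<noteq> {}" using t face[OF a(1), of y] by blast+
    then have "x ` \<alpha> \<in> cech_complex r (x ` J)" using face[OF a(1), of x] 1[OF a(1)] by blast
    then have "f ` x ` \<alpha> \<in> (`) f ` cech_complex r (x ` J)" by (rule imageI)
    then show "\<tau> \<in> (`) f ` cech_complex r (x ` J)" unfolding fimg[OF a(1)] a(2) .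
  qed
  then show ?thesis
    using betti_image[OF simplicial_complex_cech[of "x ` J" r] inj_on_subset[OF inj vertices_cech]] J by simp
qed

section \<open>Poisson approximation of dissociated sums\<close>

lemma norm_iexp_diff_le: "cmod (iexp x - iexp y) \<le> \<bar>x - y\<bar>"
proof -
  have "iexp x - iexp y = iexp y * (iexp (x - y) - 1)"
    by (simp add: algebra_simps exp_add[symmetric])
  then have "cmod (iexp x - iexp y) = cmod (iexp (x - y) - 1)" by (simp add: norm_mult)
  also have "\<dots> \<le> \<bar>x - y\<bar>" using iexp_approx1[of "x - y" 0] by simp
  finally show ?thesis .
qed

lemma one_minus_cos_le: "1 - cos u \<le> u\<^sup>2 / (2::real)"
proof -
  have "1 - cos u = 2 * (sin (u / 2))\<^sup>2" using cos_double_sin[of "u / 2"] by simp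
  also have "(sin (u / 2))\<^sup>2 \<le> (u / 2)\<^sup>2" using abs_sin_x_le_abs_x[of "u / 2"] by (rule abs_le_square_iff[THEN iffD1])
  finally show ?thesis by (simp add: power2_eq_square)
qed

text \<open>Serves to write the characteristic function of a count as a finite trigonometric sum,
  which can be differentiated term by term.\<close>

lemma (in prob_space) expectation_finite_range:
  fixes W :: "'a \<Rightarrow> real" and g :: "real \<Rightarrow> complex"
  assumes W: "W \<in> borel_measurable M" and F: "finite F" "\<And>\<omega>. \<omega> \<in> space M \<Longrightarrow> W \<omega> \<in> F"
  shows "(CLINT \<omega>|M. g (W \<omega>)) = (\<Sum>m\<in>F. of_real (prob {\<omega> \<in> space M. W \<omega> = m}) * g m)"
proof -
  have "(CLINT \<omega>|M. g (W \<omega>)) = (CLINT \<omega>|M. (\<Sum>m\<in>F. indicator {\<omega> \<in> space M. W \<omega> = m} \<omega> *\<^sub>R g m))"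
  proof (rule Bochner_Integration.integral_cong)
    fix \<omega> assume w: "\<omega> \<in> space M"
    have "(\<Sum>m\<in>F. indicator {\<omega> \<in> space M. W \<omega> = m} \<omega> *\<^sub>R g m) = (\<Sum>m\<in>F. if m = W \<omega> then g m else 0)"
      using w by (intro sum.cong) (auto simp: indicator_def)
    also have "\<dots> = g (W \<omega>)" using F w by (simp add: sum.delta)
    finally show "g (W \<omega>) = (\<Sum>m\<in>F. indicator {\<omega> \<in> space M. W \<omega> = m} \<omega> *\<^sub>R g m)" by simp
  qed simp
  also have "\<dots> = (\<Sum>m\<in>F. (CLINT \<omega>|M. indicator {\<omega> \<in> space M. W \<omega> = m} \<omega> *\<^sub>R g m))"
    using W by (intro Bochner_Integration.integral_sum integrable_scaleR_left) (auto simp: integrable_indicator_iff emeasure_eq_measure)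
  also have "\<dots> = (\<Sum>m\<in>F. of_real (prob {\<omega> \<in> space M. W \<omega> = m}) * g m)"
  proof (intro sum.cong refl)
    fix m
    have [measurable]: "{\<omega> \<in> space M. W \<omega> = m} \<in> sets M" using W by measurable
    have "(CLINT \<omega>|M. indicator {\<omega> \<in> space M. W \<omega> = m} \<omega> *\<^sub>R g m) =
      (\<integral>\<omega>. indicator {\<omega> \<in> space M. W \<omega> = m} \<omega> \<partial>M) *\<^sub>R g m"
      by (rule integral_scaleR_left) (simp add: integrable_indicator_iff emeasure_eq_measure)
    then show "(CLINT \<omega>|M. indicator {\<omega> \<in> space M. W \<omega> = m} \<omega> *\<^sub>R g m) =
      of_real (prob {\<omega> \<in> space M. W \<omega> = m}) * g m" by (simp add: scaleR_conv_of_real)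
  qed
  finally show ?thesis .
qed

lemma (in prob_space) integrable_bounded:
  fixes g :: "'a \<Rightarrow> 'b::{banach, second_countable_topology}"
  assumes "g \<in> borel_measurable M" "\<And>\<omega>. \<omega> \<in> space M \<Longrightarrow> norm (g \<omega>) \<le> B"
  shows "integrable M g"
  using assms by (intro integrable_const_bound[of g B]) auto

lemma (in prob_space) norm_expectation_diff_le:
  fixes f g :: "'a \<Rightarrow> complex"
  assumes "integrable M f" "integrable M g" "integrable M h" "\<And>\<omega>. \<omega> \<in> space M \<Longrightarrow> cmod (f \<omega> - g \<omega>) \<le> h \<omega>"
  shows "cmod ((CLINT \<omega>|M. f \<omega>) - (CLINT \<omega>|M. g \<omega>)) \<le> expectation h"
proof -
  have "cmod ((CLINT \<omega>|M. f \<omega>) - (CLINT \<omega>|M. g \<omega>)) = cmod (CLINT \<omega>|M. f \<omega> - g \<omega>)"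
    using assms by simp
  also have "\<dots> \<le> (\<integral>\<omega>. cmod (f \<omega> - g \<omega>) \<partial>M)" by (rule integral_norm_bound)
  also have "\<dots> \<le> expectation h" using assms by (intro integral_mono) auto
  finally show ?thesis .
qed

text \<open>The Stein--Chen identity for the test function \<open>iexp (u * \<cdot>)\<close>; it becomes a perturbed
  differential equation for the characteristic function.\<close>

lemma (in prob_space) dissociated_stein:
  fixes \<xi> :: "'i \<Rightarrow> 'a \<Rightarrow> real"
  assumes A: "finite A" and m [measurable]: "\<And>\<alpha>. \<alpha> \<in> A \<Longrightarrow> \<xi> \<alpha> \<in> borel_measurable M"
    and \<xi>: "\<And>\<alpha> \<omega>. \<alpha> \<in> A \<Longrightarrow> \<omega> \<in> space M \<Longrightarrow> \<xi> \<alpha> \<omega> \<in> {0, 1}"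
    and nb: "\<And>\<alpha>. \<alpha> \<in> A \<Longrightarrow> \<alpha> \<in> nb \<alpha> \<and> nb \<alpha> \<subseteq> A"
    and indep: "\<And>\<alpha>. \<alpha> \<in> A \<Longrightarrow> indep_var borel (\<xi> \<alpha>) borel (\<lambda>\<omega>. \<Sum>\<beta>\<in>A - nb \<alpha>. \<xi> \<beta> \<omega>)"
  defines "W \<equiv> \<lambda>\<omega>. \<Sum>\<alpha>\<in>A. \<xi> \<alpha> \<omega>"
  shows "cmod ((CLINT \<omega>|M. W \<omega> * iexp (u * W \<omega>)) - of_real (\<Sum>\<alpha>\<in>A. expectation (\<xi> \<alpha>)) * iexp u * (CLINT \<omega>|M. iexp (u * W \<omega>)))
    \<le> \<bar>u\<bar> * (\<Sum>\<alpha>\<in>A. (\<Sum>\<beta>\<in>nb \<alpha>. expectation (\<xi> \<alpha>) * expectation (\<xi> \<beta>)) +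
         (\<Sum>\<beta>\<in>nb \<alpha> - {\<alpha>}. expectation (\<lambda>\<omega>. \<xi> \<alpha> \<omega> * \<xi> \<beta> \<omega>)))"
proof -
  have Wm [measurable]: "W \<in> borel_measurable M" unfolding W_def by measurable
  let ?\<phi> = "CLINT \<omega>|M. iexp (u * W \<omega>)"
  have bd: "\<bar>\<xi> \<alpha> \<omega>\<bar> \<le> 1" "0 \<le> \<xi> \<alpha> \<omega>" if "\<alpha> \<in> A" "\<omega> \<in> space M" for \<alpha> \<omega>
    using \<xi>[OF that] by auto
  have int\<xi>: "integrable M (\<xi> \<alpha>)" if "\<alpha> \<in> A" for \<alpha>
    using bd that by (intro integrable_bounded[of _ 1]) auto
  have int\<xi>\<xi>: "integrable M (\<lambda>\<omega>. \<xi> \<alpha> \<omega> * \<xi> \<beta> \<omega>)" if "\<alpha> \<in> A" "\<beta> \<in> A" for \<alpha> \<beta>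
    using bd that by (intro integrable_bounded[of _ 1]) (auto simp: abs_mult intro!: mult_le_one)
  have intW: "integrable M (\<lambda>\<omega>. \<xi> \<alpha> \<omega> * iexp (u * W \<omega>))" if "\<alpha> \<in> A" for \<alpha>
    using bd that by (intro integrable_bounded[of _ 1]) (auto simp: norm_mult)
  have each: "cmod ((CLINT \<omega>|M. \<xi> \<alpha> \<omega> * iexp (u * W \<omega>)) - of_real (expectation (\<xi> \<alpha>)) * iexp u * ?\<phi>)
    \<le> \<bar>u\<bar> * ((\<Sum>\<beta>\<in>nb \<alpha>. expectation (\<xi> \<alpha>) * expectation (\<xi> \<beta>)) +
         (\<Sum>\<beta>\<in>nb \<alpha> - {\<alpha>}. expectation (\<lambda>\<omega>. \<xi> \<alpha> \<omega> * \<xi> \<beta> \<omega>)))" if \<alpha>: "\<alpha> \<in> A" for \<alpha>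
  proof -
    \<comment> \<open>\<open>R\<close> collects the summands independent of
      \<open>\<xi> \<alpha>\<close>, \<open>V\<close> those around \<open>\<alpha>\<close>, and
      \<open>V'\<close> the same without \<open>\<alpha>\<close>. On
      \<open>\<xi> \<alpha> = 1\<close> one has \<open>W = 1 + R + V'\<close>, so replacing
      \<open>W\<close> by \<open>1 + R\<close> costs at most \<open>\<bar>u\<bar> * V'\<close>;
      returning from \<open>R\<close> to \<open>W\<close> after independence has been used costs at
      most \<open>\<bar>u\<bar> * V\<close>.\<close>
    define R where "R = (\<lambda>\<omega>. \<Sum>\<beta>\<in>A - nb \<alpha>. \<xi> \<beta> \<omega>)"
    define V where "V = (\<lambda>\<omega>. \<Sum>\<beta>\<in>nb \<alpha>. \<xi> \<beta> \<omega>)"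
    define V' where "V' = (\<lambda>\<omega>. \<Sum>\<beta>\<in>nb \<alpha> - {\<alpha>}. \<xi> \<beta> \<omega>)"
    have nbA: "nb \<alpha> \<subseteq> A" "\<alpha> \<in> nb \<alpha>" and fnb: "finite (nb \<alpha>)" using nb[OF \<alpha>] A finite_subset by auto
    have Rm [measurable]: "R \<in> borel_measurable M" unfolding R_def by measurable
    have WV: "W \<omega> = V \<omega> + R \<omega>" for \<omega>
      unfolding W_def V_def R_def using sum.subset_diff[OF nbA(1) A, of "\<lambda>\<beta>. \<xi> \<beta> \<omega>"] by simp
    have VV: "V \<omega> = \<xi> \<alpha> \<omega> + V' \<omega>" for \<omega>
      unfolding V_def V'_def using sum.remove[OF fnb nbA(2)] by blast
    have V0: "0 \<le> V \<omega>" "0 \<le> V' \<omega>" if "\<omega> \<in> space M" for \<omega>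
      unfolding V_def V'_def using bd nbA that by (auto intro!: sum_nonneg)
    have intV: "integrable M V" unfolding V_def using int\<xi> nbA by (intro Bochner_Integration.integrable_sum) auto
    have int\<xi>V: "integrable M (\<lambda>\<omega>. \<xi> \<alpha> \<omega> * V' \<omega>)" unfolding V'_def sum_distrib_left
      using int\<xi>\<xi> nbA \<alpha> by (intro Bochner_Integration.integrable_sum) auto
    have intR: "integrable M (\<lambda>\<omega>. iexp (u * R \<omega>))" by (intro integrable_bounded[of _ 1]) auto
    have int\<xi>R: "integrable M (\<lambda>\<omega>. \<xi> \<alpha> \<omega> * iexp (u * (1 + R \<omega>)))"
      using bd \<alpha> by (intro integrable_bounded[of _ 1]) (auto simp: norm_mult)
    have "cmod ((CLINT \<omega>|M. \<xi> \<alpha> \<omega> * iexp (u * W \<omega>)) - (CLINT \<omega>|M. \<xi> \<alpha> \<omega> * iexp (u * (1 + R \<omega>))))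
      \<le> expectation (\<lambda>\<omega>. \<bar>u\<bar> * (\<xi> \<alpha> \<omega> * V' \<omega>))"
    proof (rule norm_expectation_diff_le[OF intW[OF \<alpha>] int\<xi>R])
      show "integrable M (\<lambda>\<omega>. \<bar>u\<bar> * (\<xi> \<alpha> \<omega> * V' \<omega>))" using int\<xi>V by simp
      fix \<omega> assume w: "\<omega> \<in> space M"
      show "cmod (\<xi> \<alpha> \<omega> * iexp (u * W \<omega>) - \<xi> \<alpha> \<omega> * iexp (u * (1 + R \<omega>))) \<le> \<bar>u\<bar> * (\<xi> \<alpha> \<omega> * V' \<omega>)"
      proof (cases "\<xi> \<alpha> \<omega> = 1")
        case True
        have "cmod (iexp (u * W \<omega>) - iexp (u * (1 + R \<omega>))) \<le> \<bar>u * W \<omega> - u * (1 + R \<omega>)\<bar>"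
          by (rule norm_iexp_diff_le)
        also have "u * W \<omega> - u * (1 + R \<omega>) = u * V' \<omega>" using WV[of \<omega>] VV[of \<omega>] True by (simp add: algebra_simps)
        finally show ?thesis using True V0[OF w] by (simp add: abs_mult)
      next
        case False
        then show ?thesis using \<xi>[OF \<alpha> w] by simp
      qed
    qed
    also have "expectation (\<lambda>\<omega>. \<bar>u\<bar> * (\<xi> \<alpha> \<omega> * V' \<omega>)) = \<bar>u\<bar> * (\<Sum>\<beta>\<in>nb \<alpha> - {\<alpha>}. expectation (\<lambda>\<omega>. \<xi> \<alpha> \<omega> * \<xi> \<beta> \<omega>))"
      unfolding V'_def sum_distrib_left[of "\<xi> \<alpha> _"] using int\<xi>\<xi> nbA \<alpha>
      by (subst integral_mult_right_zero, subst Bochner_Integration.integral_sum) auto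
    finally have 1: "cmod ((CLINT \<omega>|M. \<xi> \<alpha> \<omega> * iexp (u * W \<omega>)) - (CLINT \<omega>|M. \<xi> \<alpha> \<omega> * iexp (u * (1 + R \<omega>))))
      \<le> \<bar>u\<bar> * (\<Sum>\<beta>\<in>nb \<alpha> - {\<alpha>}. expectation (\<lambda>\<omega>. \<xi> \<alpha> \<omega> * \<xi> \<beta> \<omega>))" .
    have 2: "(CLINT \<omega>|M. \<xi> \<alpha> \<omega> * iexp (u * (1 + R \<omega>))) = of_real (expectation (\<xi> \<alpha>)) * iexp u * (CLINT \<omega>|M. iexp (u * R \<omega>))"
    proof -
      have "indep_var borel (complex_of_real \<circ> \<xi> \<alpha>) borel ((\<lambda>x. iexp (u * x)) \<circ> R)"
        using indep[OF \<alpha>] unfolding R_def[symmetric] by (rule indep_var_compose) measurable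
      then have "(CLINT \<omega>|M. (complex_of_real \<circ> \<xi> \<alpha>) \<omega> * ((\<lambda>x. iexp (u * x)) \<circ> R) \<omega>) =
        (CLINT \<omega>|M. (complex_of_real \<circ> \<xi> \<alpha>) \<omega>) * (CLINT \<omega>|M. ((\<lambda>x. iexp (u * x)) \<circ> R) \<omega>)"
        using int\<xi>[OF \<alpha>] intR by (intro indep_var_lebesgue_integral) (auto simp: o_def)
      then have *: "(CLINT \<omega>|M. \<xi> \<alpha> \<omega> * iexp (u * R \<omega>)) = of_real (expectation (\<xi> \<alpha>)) * (CLINT \<omega>|M. iexp (u * R \<omega>))"
        using int\<xi>[OF \<alpha>] by (simp add: o_def)
      have "(CLINT \<omega>|M. \<xi> \<alpha> \<omega> * iexp (u * (1 + R \<omega>))) = (CLINT \<omega>|M. iexp u * (\<xi> \<alpha> \<omega> * iexp (u * R \<omega>)))"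
        by (intro Bochner_Integration.integral_cong refl) (simp add: algebra_simps exp_add)
      also have "\<dots> = iexp u * (CLINT \<omega>|M. \<xi> \<alpha> \<omega> * iexp (u * R \<omega>))" by (rule integral_mult_right_zero)
      finally show ?thesis unfolding * by (simp add: algebra_simps)
    qed
    have "cmod ((CLINT \<omega>|M. iexp (u * R \<omega>)) - ?\<phi>) \<le> expectation (\<lambda>\<omega>. \<bar>u\<bar> * V \<omega>)"
    proof (rule norm_expectation_diff_le[OF intR])
      show "integrable M (\<lambda>\<omega>. iexp (u * W \<omega>))" by (intro integrable_bounded[of _ 1]) auto
      show "integrable M (\<lambda>\<omega>. \<bar>u\<bar> * V \<omega>)" using intV by simp
      fix \<omega> assume w: "\<omega> \<in> space M"
      have "cmod (iexp (u * R \<omega>) - iexp (u * W \<omega>)) \<le> \<bar>u * R \<omega> - u * W \<omega>\<bar>" by (rule norm_iexp_diff_le)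
      also have "u * R \<omega> - u * W \<omega> = - (u * V \<omega>)" using WV[of \<omega>] by (simp add: algebra_simps)
      finally show "cmod (iexp (u * R \<omega>) - iexp (u * W \<omega>)) \<le> \<bar>u\<bar> * V \<omega>" using V0[OF w] by (simp add: abs_mult)
    qed
    also have "expectation (\<lambda>\<omega>. \<bar>u\<bar> * V \<omega>) = \<bar>u\<bar> * (\<Sum>\<beta>\<in>nb \<alpha>. expectation (\<xi> \<beta>))"
      unfolding V_def using int\<xi> nbA by (subst integral_mult_right_zero, subst Bochner_Integration.integral_sum) auto
    finally have 3: "cmod ((CLINT \<omega>|M. iexp (u * R \<omega>)) - ?\<phi>) \<le> \<bar>u\<bar> * (\<Sum>\<beta>\<in>nb \<alpha>. expectation (\<xi> \<beta>))" .
    have p0: "0 \<le> expectation (\<xi> \<alpha>)" using bd \<alpha> by (intro integral_nonneg_AE) auto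
    have "cmod ((CLINT \<omega>|M. \<xi> \<alpha> \<omega> * iexp (u * W \<omega>)) - of_real (expectation (\<xi> \<alpha>)) * iexp u * ?\<phi>) \<le>
      cmod ((CLINT \<omega>|M. \<xi> \<alpha> \<omega> * iexp (u * W \<omega>)) - (CLINT \<omega>|M. \<xi> \<alpha> \<omega> * iexp (u * (1 + R \<omega>)))) +
      cmod ((CLINT \<omega>|M. \<xi> \<alpha> \<omega> * iexp (u * (1 + R \<omega>))) - of_real (expectation (\<xi> \<alpha>)) * iexp u * ?\<phi>)"
      by (rule norm_diff_triangle_le) (rule order_refl)+
    also have "cmod ((CLINT \<omega>|M. \<xi> \<alpha> \<omega> * iexp (u * (1 + R \<omega>))) - of_real (expectation (\<xi> \<alpha>)) * iexp u * ?\<phi>) =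
      expectation (\<xi> \<alpha>) * cmod ((CLINT \<omega>|M. iexp (u * R \<omega>)) - ?\<phi>)"
      unfolding 2 right_diff_distrib[symmetric] norm_mult using p0 by simp
    also have "\<dots> \<le> expectation (\<xi> \<alpha>) * (\<bar>u\<bar> * (\<Sum>\<beta>\<in>nb \<alpha>. expectation (\<xi> \<beta>)))"
      by (rule mult_left_mono[OF 3 p0])
    finally show ?thesis using 1 by (simp add: sum_distrib_left algebra_simps)
  qed
  have "(CLINT \<omega>|M. W \<omega> * iexp (u * W \<omega>)) = (CLINT \<omega>|M. (\<Sum>\<alpha>\<in>A. \<xi> \<alpha> \<omega> * iexp (u * W \<omega>)))"
    by (intro Bochner_Integration.integral_cong refl) (simp add: W_def sum_distrib_right)
  also have "\<dots> = (\<Sum>\<alpha>\<in>A. (CLINT \<omega>|M. \<xi> \<alpha> \<omega> * iexp (u * W \<omega>)))"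
    using intW by (intro Bochner_Integration.integral_sum)
  finally have "(CLINT \<omega>|M. W \<omega> * iexp (u * W \<omega>)) - of_real (\<Sum>\<alpha>\<in>A. expectation (\<xi> \<alpha>)) * iexp u * ?\<phi> =
    (\<Sum>\<alpha>\<in>A. (CLINT \<omega>|M. \<xi> \<alpha> \<omega> * iexp (u * W \<omega>)) - of_real (expectation (\<xi> \<alpha>)) * iexp u * ?\<phi>)"
    by (simp add: sum_subtractf sum_distrib_right)
  also have "cmod \<dots> \<le> (\<Sum>\<alpha>\<in>A. \<bar>u\<bar> * ((\<Sum>\<beta>\<in>nb \<alpha>. expectation (\<xi> \<alpha>) * expectation (\<xi> \<beta>)) +
         (\<Sum>\<beta>\<in>nb \<alpha> - {\<alpha>}. expectation (\<lambda>\<omega>. \<xi> \<alpha> \<omega> * \<xi> \<beta> \<omega>))))"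
    by (rule sum_norm_le) (rule each)
  finally show ?thesis unfolding sum_distrib_left[symmetric] .
qed

text \<open>The unperturbed equation is solved by the Poisson characteristic function, so its
  reciprocal \<open>E\<close> serves as integrating factor: the derivative of
  \<open>G = \<phi> * E\<close> is the defect times \<open>E\<close>. The factor
  \<open>exp (l * s\<^sup>2 / 2)\<close> is the price of
  \<open>cmod (E u) = exp (l * (1 - cos u))\<close> and stays bounded as long as
  \<open>l * s\<^sup>2\<close> does. Multiplying back costs nothing, as the Poisson characteristic
  function has modulus at most 1.\<close>

lemma gronwall_poisson:
  fixes \<phi> \<phi>' :: "real \<Rightarrow> complex"
  assumes d: "\<And>u. (\<phi> has_vector_derivative \<phi>' u) (at u)" and 0: "\<phi> 0 = 1" and l: "l \<ge> 0" and b: "b \<ge> 0"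
    and est: "\<And>u. cmod (\<phi>' u - \<i> * of_real l * iexp u * \<phi> u) \<le> \<bar>u\<bar> * b"
  shows "cmod (\<phi> s - exp (of_real l * (iexp s - 1))) \<le> s\<^sup>2 * exp (l * s\<^sup>2 / 2) * b"
proof -
  define E where "E = (\<lambda>u. exp (- of_real l * (iexp u - 1)))"
  define G where "G = (\<lambda>u. \<phi> u * E u)"
  define G' where "G' = (\<lambda>u. (\<phi>' u - \<i> * of_real l * iexp u * \<phi> u) * E u)"
  have dE: "(E has_vector_derivative (- \<i> * of_real l * iexp u * E u)) (at u)" for u
  proof -
    have "((\<lambda>u. - of_real l * (iexp u - 1)) has_vector_derivative (- of_real l * (\<i> * iexp u))) (at u)"
      by (intro has_vector_derivative_mult_right) (auto intro!: derivative_eq_intros)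
    then have "(E has_vector_derivative ((- of_real l * (\<i> * iexp u)) * exp (- of_real l * (iexp u - 1)))) (at u)"
      unfolding E_def using field_vector_diff_chain_at[of "\<lambda>u. - of_real l * (iexp u - 1)" "- of_real l * (\<i> * iexp u)" u exp]
        DERIV_exp by (auto simp: o_def)
    then show ?thesis by (simp add: E_def algebra_simps)
  qed
  have dG: "(G has_vector_derivative G' u) (at u)" for u
    using has_vector_derivative_mult[OF d dE, of u] unfolding G_def G'_def by (simp add: algebra_simps)
  have nE: "cmod (E u) = exp (l * (1 - cos u))" for u
    by (simp add: E_def norm_exp_eq_Re algebra_simps Re_exp)
  have bound: "cmod (G' u) \<le> \<bar>s\<bar> * b * exp (l * s\<^sup>2 / 2)" if "\<bar>u\<bar> \<le> \<bar>s\<bar>" for u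
  proof -
    have "l * (1 - cos u) \<le> l * (u\<^sup>2 / 2)" by (rule mult_left_mono[OF one_minus_cos_le l])
    also have "\<dots> \<le> l * (s\<^sup>2 / 2)" using that l by (intro mult_left_mono) (auto simp: abs_le_square_iff)
    finally have "cmod (E u) \<le> exp (l * s\<^sup>2 / 2)" by (simp add: nE)
    moreover have "cmod (\<phi>' u - \<i> * of_real l * iexp u * \<phi> u) \<le> \<bar>s\<bar> * b"
      using est[of u] mult_right_mono[OF that b] by linarith
    ultimately show ?thesis unfolding G'_def norm_mult using b by (intro mult_mono) auto
  qed
  have "norm (G s - G 0) \<le> (\<bar>s\<bar> * b * exp (l * s\<^sup>2 / 2)) * norm (s - 0)"
  proof (rule differentiable_bound[of "{- \<bar>s\<bar>..\<bar>s\<bar>}" G "\<lambda>u h. h *\<^sub>R G' u"])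
    fix u assume u: "u \<in> {- \<bar>s\<bar>..\<bar>s\<bar>}"
    show "(G has_derivative (\<lambda>h. h *\<^sub>R G' u)) (at u within {- \<bar>s\<bar>..\<bar>s\<bar>})"
      using dG[of u] unfolding has_vector_derivative_def by (rule has_derivative_at_withinI)
    have "cmod (G' u) \<le> \<bar>s\<bar> * b * exp (l * s\<^sup>2 / 2)" using u by (intro bound) auto
    then show "onorm (\<lambda>h. h *\<^sub>R G' u) \<le> \<bar>s\<bar> * b * exp (l * s\<^sup>2 / 2)"
      by (intro onorm_le) (simp add: mult.commute[of "\<bar>s\<bar> * b * exp (l * s\<^sup>2 / 2)"] mult_left_mono)
  qed auto
  also have "(\<bar>s\<bar> * b * exp (l * s\<^sup>2 / 2)) * norm (s - 0) = (\<bar>s\<bar> * \<bar>s\<bar>) * exp (l * s\<^sup>2 / 2) * b"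
    by (simp only: mult_ac real_norm_def diff_zero)
  also have "\<bar>s\<bar> * \<bar>s\<bar> = s\<^sup>2" by (simp add: power2_eq_square)
  also have "G 0 = 1" by (simp add: G_def E_def 0)
  finally have G: "cmod (G s - 1) \<le> s\<^sup>2 * exp (l * s\<^sup>2 / 2) * b" .
  have EE: "E s * exp (of_real l * (iexp s - 1)) = 1"
    unfolding E_def by (simp add: exp_add[symmetric])
  have "\<phi> s - exp (of_real l * (iexp s - 1)) = (G s - 1) * exp (of_real l * (iexp s - 1))"
    using EE by (simp add: G_def left_diff_distrib mult.assoc)
  then have "cmod (\<phi> s - exp (of_real l * (iexp s - 1))) = cmod (G s - 1) * exp (l * (cos s - 1))"
    by (simp add: norm_mult norm_exp_eq_Re Re_exp)
  also have "\<dots> \<le> cmod (G s - 1) * 1"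
  proof (rule mult_left_mono)
    have "l * (cos s - 1) \<le> 0" using l by (intro mult_nonneg_nonpos) auto
    then show "exp (l * (cos s - 1)) \<le> 1" by simp
  qed simp
  finally show ?thesis using G by simp
qed

text \<open>As \<open>W\<close> takes finitely many values, the derivative of its characteristic
  function is \<open>\<i>\<close> times the expectation of \<open>W * iexp (u * W)\<close>;
  \<open>dissociated_stein\<close> then supplies the defect estimate for
  \<open>gronwall_poisson\<close>, with \<open>b\<close> independent of \<open>u\<close>.\<close>

theorem (in prob_space) dissociated_poisson:
  fixes \<xi> :: "'i \<Rightarrow> 'a \<Rightarrow> real"
  assumes A: "finite A" and m: "\<And>\<alpha>. \<alpha> \<in> A \<Longrightarrow> \<xi> \<alpha> \<in> borel_measurable M"
    and \<xi>: "\<And>\<alpha> \<omega>. \<alpha> \<in> A \<Longrightarrow> \<omega> \<in> space M \<Longrightarrow> \<xi> \<alpha> \<omega> \<in> {0, 1}"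
    and nb: "\<And>\<alpha>. \<alpha> \<in> A \<Longrightarrow> \<alpha> \<in> nb \<alpha> \<and> nb \<alpha> \<subseteq> A"
    and indep: "\<And>\<alpha>. \<alpha> \<in> A \<Longrightarrow> indep_var borel (\<xi> \<alpha>) borel (\<lambda>\<omega>. \<Sum>\<beta>\<in>A - nb \<alpha>. \<xi> \<beta> \<omega>)"
  defines "W \<equiv> \<lambda>\<omega>. \<Sum>\<alpha>\<in>A. \<xi> \<alpha> \<omega>" and "l \<equiv> \<Sum>\<alpha>\<in>A. expectation (\<xi> \<alpha>)"
    and "b \<equiv> \<Sum>\<alpha>\<in>A. (\<Sum>\<beta>\<in>nb \<alpha>. expectation (\<xi> \<alpha>) * expectation (\<xi> \<beta>)) +
         (\<Sum>\<beta>\<in>nb \<alpha> - {\<alpha>}. expectation (\<lambda>\<omega>. \<xi> \<alpha> \<omega> * \<xi> \<beta> \<omega>))"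
  shows "cmod ((CLINT \<omega>|M. iexp (s * W \<omega>)) - exp (of_real l * (iexp s - 1))) \<le> s\<^sup>2 * exp (l * s\<^sup>2 / 2) * b"
proof -
  have Wm: "W \<in> borel_measurable M" unfolding W_def using m by measurable
  let ?F = "real ` {..card A}"
  have WF: "W \<omega> \<in> ?F" if w: "\<omega> \<in> space M" for \<omega>
  proof -
    have "W \<omega> = (\<Sum>\<alpha>\<in>A. of_bool (\<xi> \<alpha> \<omega> = 1))" unfolding W_def using \<xi>[OF _ w] by (intro sum.cong) auto
    also have "\<dots> = real (card {\<alpha> \<in> A. \<xi> \<alpha> \<omega> = 1})" by (simp add: A of_bool_def sum.If_cases Int_def)
    finally show ?thesis using card_mono[OF A, of "{\<alpha> \<in> A. \<xi> \<alpha> \<omega> = 1}"] by auto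
  qed
  have E: "(CLINT \<omega>|M. g (W \<omega>)) = (\<Sum>m\<in>?F. of_real (prob {\<omega> \<in> space M. W \<omega> = m}) * g m)" for g :: "real \<Rightarrow> complex"
    by (rule expectation_finite_range[OF Wm _ WF]) simp
  have pos: "0 \<le> expectation (\<xi> \<alpha>)" if "\<alpha> \<in> A" for \<alpha> 
    using \<xi>[OF that] by (intro integral_nonneg_AE) fastforce
  have pos2: "0 \<le> expectation (\<lambda>\<omega>. \<xi> \<alpha> \<omega> * \<xi> \<beta> \<omega>)" if "\<alpha> \<in> A" "\<beta> \<in> A" for \<alpha> \<beta>
    using \<xi>[OF that(1)] \<xi>[OF that(2)] by (intro integral_nonneg_AE) fastforce
  show ?thesis
  proof (rule gronwall_poisson)
    show "l \<ge> 0" unfolding l_def using pos by (rule sum_nonneg)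
    show "b \<ge> 0" unfolding b_def using pos pos2 nb by (intro sum_nonneg add_nonneg_nonneg mult_nonneg_nonneg) blast+
    show "(CLINT \<omega>|M. iexp (0 * W \<omega>)) = 1" by (simp add: prob_space)
    fix u :: real
    have "((\<lambda>u. \<Sum>m\<in>?F. of_real (prob {\<omega> \<in> space M. W \<omega> = m}) * iexp (u * m)) has_vector_derivative
      (\<Sum>m\<in>?F. of_real (prob {\<omega> \<in> space M. W \<omega> = m}) * (\<i> * (m * iexp (u * m))))) (at u)"
    proof (intro has_vector_derivative_sum has_vector_derivative_mult_right)
      fix m :: real
      have "((iexp \<circ> (\<lambda>u. u * m)) has_vector_derivative (m *\<^sub>R (\<i> * iexp (u * m)))) (at u)"
        by (rule vector_diff_chain_at[OF _ has_vector_derivative_iexp])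
           (auto intro!: derivative_eq_intros simp: has_real_derivative_iff_has_vector_derivative[symmetric])
      then show "((\<lambda>u. iexp (u * m)) has_vector_derivative (\<i> * (m * iexp (u * m)))) (at u)"
        by (simp add: o_def scaleR_conv_of_real mult_ac)
    qed
    moreover have "(\<Sum>m\<in>?F. of_real (prob {\<omega> \<in> space M. W \<omega> = m}) * (\<i> * (m * iexp (u * m)))) =
      \<i> * (CLINT \<omega>|M. W \<omega> * iexp (u * W \<omega>))"
      unfolding E[of "\<lambda>m. m * iexp (u * m)"] sum_distrib_left by (intro sum.cong) (auto simp: mult_ac)
    ultimately show "((\<lambda>u. CLINT \<omega>|M. iexp (u * W \<omega>)) has_vector_derivative \<i> * (CLINT \<omega>|M. W \<omega> * iexp (u * W \<omega>))) (at u)"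
      unfolding E[of "\<lambda>m. iexp (_ * m)"] by simp
    have "cmod (\<i> * (CLINT \<omega>|M. W \<omega> * iexp (u * W \<omega>)) - \<i> * of_real l * iexp u * (CLINT \<omega>|M. iexp (u * W \<omega>))) =
      cmod ((CLINT \<omega>|M. W \<omega> * iexp (u * W \<omega>)) - of_real l * iexp u * (CLINT \<omega>|M. iexp (u * W \<omega>)))"
      unfolding mult.assoc right_diff_distrib[symmetric] norm_mult by simp
    also have "\<dots> \<le> \<bar>u\<bar> * b"
      using dissociated_stein[OF A m \<xi> nb indep, of u] unfolding W_def l_def b_def by simp
    finally show "cmod (\<i> * (CLINT \<omega>|M. W \<omega> * iexp (u * W \<omega>)) - \<i> * of_real l * iexp u * (CLINT \<omega>|M. iexp (u * W \<omega>)))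
      \<le> \<bar>u\<bar> * b" .
  qed
qed

section \<open>The Efron--Stein inequality\<close>

lemma (in prob_space) abs_expectation_le:
  fixes X :: "'a \<Rightarrow> real"
  assumes X: "X \<in> borel_measurable M" "\<And>\<omega>. \<omega> \<in> space M \<Longrightarrow> \<bar>X \<omega>\<bar> \<le> B"
  shows "\<bar>expectation X\<bar> \<le> B"
proof (rule order_trans[OF integral_abs_bound integral_le_const])
  show "integrable M (\<lambda>\<omega>. \<bar>X \<omega>\<bar>)" using X by (intro integrable_bounded[of _ B]) auto
  show "AE \<omega> in M. \<bar>X \<omega>\<bar> \<le> B" using X(2) by auto
qed

lemma (in prob_space) expectation_square_decomp:
  fixes X :: "'a \<Rightarrow> real"
  assumes X: "X \<in> borel_measurable M" "\<And>\<omega>. \<omega> \<in> space M \<Longrightarrow> \<bar>X \<omega>\<bar> \<le> B"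
  shows "expectation (\<lambda>\<omega>. (X \<omega> - c)\<^sup>2) = expectation (\<lambda>\<omega>. (X \<omega> - expectation X)\<^sup>2) + (expectation X - c)\<^sup>2"
proof -
  have i1: "integrable M X" by (rule integrable_bounded[OF X(1), of B]) (use X(2) in auto)
  have i2: "integrable M (\<lambda>\<omega>. (X \<omega>)\<^sup>2)"
  proof (rule integrable_bounded[of _ "B\<^sup>2"])
    show "(\<lambda>\<omega>. (X \<omega>)\<^sup>2) \<in> borel_measurable M" using X(1) by measurable
    fix \<omega> assume w: "\<omega> \<in> space M"
    have "\<bar>X \<omega>\<bar>\<^sup>2 \<le> B\<^sup>2" by (rule power_mono[OF X(2)[OF w]]) simp
    then show "norm ((X \<omega>)\<^sup>2) \<le> B\<^sup>2" by simp
  qed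
  have E: "expectation (\<lambda>\<omega>. (X \<omega> - a)\<^sup>2) = expectation (\<lambda>\<omega>. (X \<omega>)\<^sup>2) - 2 * a * expectation X + a\<^sup>2" for a
    using i1 i2 by (simp add: power2_diff prob_space algebra_simps)
  show ?thesis unfolding E by (simp add: power2_eq_square algebra_simps)
qed

lemma (in prob_space) expectation_square_ge:
  fixes X :: "'a \<Rightarrow> real"
  assumes "X \<in> borel_measurable M" "\<And>\<omega>. \<omega> \<in> space M \<Longrightarrow> \<bar>X \<omega>\<bar> \<le> B"
  shows "(expectation X)\<^sup>2 \<le> expectation (\<lambda>\<omega>. (X \<omega>)\<^sup>2)"
proof -
  have "0 \<le> expectation (\<lambda>\<omega>. (X \<omega> - expectation X)\<^sup>2)" by (intro integral_nonneg_AE) auto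
  then show ?thesis using expectation_square_decomp[OF assms, of 0] by simp
qed

text \<open>The competitors \<open>g i\<close> are arbitrary bounded measurable functions not
  depending on coordinate \<open>i\<close>, so the functional with point \<open>i\<close> deleted
  can be inserted directly and no independent copy of the sample is introduced. Integrating out
  \<open>i\<close> splits the variance of \<open>f\<close> into the mean conditional variance, which
  \<open>g i\<close> bounds because conditional means minimise squared distance, and the variance of
  the average \<open>G\<close>, to which the induction hypothesis applies with the averages
  \<open>g'\<close>.\<close>

lemma (in product_prob_space) efron_stein:
  fixes f :: "('i \<Rightarrow> 'a) \<Rightarrow> real" and g :: "'i \<Rightarrow> ('i \<Rightarrow> 'a) \<Rightarrow> real"
  assumes I: "finite I"
    and f: "f \<in> borel_measurable (PiM I M)" "\<And>x. x \<in> space (PiM I M) \<Longrightarrow> \<bar>f x\<bar> \<le> B"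
    and g: "\<And>i. i \<in> I \<Longrightarrow> g i \<in> borel_measurable (PiM I M)"
      "\<And>i x. i \<in> I \<Longrightarrow> x \<in> space (PiM I M) \<Longrightarrow> \<bar>g i x\<bar> \<le> B"
      "\<And>i x y. i \<in> I \<Longrightarrow> g i (x(i := y)) = g i x"
  shows "(\<integral>x. (f x - (\<integral>x. f x \<partial>PiM I M))\<^sup>2 \<partial>PiM I M) \<le> (\<Sum>i\<in>I. \<integral>x. (f x - g i x)\<^sup>2 \<partial>PiM I M)"
  using I f g
proof (induction I arbitrary: f g rule: finite_induct)
  case empty
  have "(\<integral>x. h x \<partial>PiM {} M) = h (\<lambda>_. undefined)" for h :: "('i \<Rightarrow> 'a) \<Rightarrow> real"
    by (simp add: PiM_empty lebesgue_integral_count_space_finite)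
  then show ?case by simp
next
  case (insert i I)
  let ?Q = "PiM (insert i I) M" and ?P = "PiM I M"
  note fm [measurable] = insert.prems(1) and fB = insert.prems(2)
  note gB = insert.prems(4) and gup = insert.prems(5)
  have gm [measurable]: "g j \<in> borel_measurable ?Q" if "j \<in> insert i I" for j using insert.prems(3) that .
  interpret PI: prob_space ?P by (rule prob_space_PiM) (rule prob_space)
  interpret QI: prob_space ?Q by (rule prob_space_PiM) (rule prob_space)
  have upd: "x(i := y) \<in> space ?Q" if "x \<in> space ?P" "y \<in> space (M i)" for x y
    using that by (auto simp: space_PiM PiE_def extensional_def)
  have m_upd [measurable]: "(\<lambda>(x, y). x(i := y)) \<in> measurable (?P \<Otimes>\<^sub>M M i) ?Q"
    by (rule measurable_add_dim)
  have m2: "(\<lambda>(x, y). h (x(i := y))) \<in> borel_measurable (?P \<Otimes>\<^sub>M M i)" if "h \<in> borel_measurable ?Q" for h :: "_ \<Rightarrow> real"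
    using measurable_compose[OF m_upd that] by (simp add: case_prod_beta')
  have m1: "(\<lambda>y. h (x(i := y))) \<in> borel_measurable (M i)" if "h \<in> borel_measurable ?Q" "x \<in> space ?P" for h :: "_ \<Rightarrow> real" and x
    using measurable_Pair2[OF m2[OF that(1)] that(2)] by simp
  have mI: "(\<lambda>x. \<integral>y. h (x(i := y)) \<partial>M i) \<in> borel_measurable ?P" if "h \<in> borel_measurable ?Q" for h :: "_ \<Rightarrow> real"
    by (rule M.borel_measurable_lebesgue_integral[OF m2[OF that]])
  have split: "(\<integral>x. h x \<partial>?Q) = (\<integral>x. (\<integral>y. h (x(i := y)) \<partial>M i) \<partial>?P)"
    if "h \<in> borel_measurable ?Q" "\<And>x. x \<in> space ?Q \<Longrightarrow> \<bar>h x\<bar> \<le> C" for h :: "_ \<Rightarrow> real" and C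
    using that by (intro product_integral_insert[OF insert.hyps] QI.integrable_bounded[of _ C]) auto
  have bI: "\<bar>\<integral>y. h (x(i := y)) \<partial>M i\<bar> \<le> C"
    if "h \<in> borel_measurable ?Q" "\<And>x. x \<in> space ?Q \<Longrightarrow> \<bar>h x\<bar> \<le> C" "x \<in> space ?P" for h :: "_ \<Rightarrow> real" and C x
    by (rule M.abs_expectation_le[OF m1[OF that(1,3)] that(2)[OF upd[OF that(3)]]])
  have sqb: "\<bar>(a - b)\<^sup>2\<bar> \<le> (2 * B)\<^sup>2" if "\<bar>a\<bar> \<le> B" "\<bar>b\<bar> \<le> B" for a b :: real
  proof -
    have "\<bar>a - b\<bar>\<^sup>2 \<le> (2 * B)\<^sup>2" using that by (intro power_mono) auto
    then show ?thesis by simp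
  qed
  define G where "G = (\<lambda>x. \<integral>y. f (x(i := y)) \<partial>M i)"
  define g' where "g' = (\<lambda>j x. \<integral>y. g j (x(i := y)) \<partial>M i)"
  define c where "c = (\<integral>x. f x \<partial>?Q)"
  have Gm [measurable]: "G \<in> borel_measurable ?P" unfolding G_def by (rule mI[OF fm])
  have GB: "\<bar>G x\<bar> \<le> B" if "x \<in> space ?P" for x unfolding G_def by (rule bI[OF fm fB that])
  have cG: "c = (\<integral>x. G x \<partial>?P)" unfolding c_def G_def by (rule split[OF fm fB])
  have cB: "\<bar>c\<bar> \<le> B"
    unfolding c_def by (rule QI.abs_expectation_le[OF fm fB])
  have inner: "(\<integral>y. (f (x(i := y)) - c)\<^sup>2 \<partial>M i) \<le> (\<integral>y. (f (x(i := y)) - g i (x(i := y)))\<^sup>2 \<partial>M i) + (G x - c)\<^sup>2"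
    if x: "x \<in> space ?P" for x
  proof -
    \<comment> \<open>The mean squared distance to any constant \<open>a\<close> is the conditional
      variance plus \<open>(G x - a)\<^sup>2\<close>; it is used with \<open>a = g i x\<close>,
      which is constant in \<open>y\<close>, and with \<open>a = c\<close>.\<close>
    have d: "(\<integral>y. (f (x(i := y)) - a)\<^sup>2 \<partial>M i) = (\<integral>y. (f (x(i := y)) - G x)\<^sup>2 \<partial>M i) + (G x - a)\<^sup>2" for a
      unfolding G_def by (rule M.expectation_square_decomp[OF m1[OF fm x] fB[OF upd[OF x]]])
    have "g i (x(i := y)) = g i x" for y by (rule gup) simp
    then have "(\<integral>y. (f (x(i := y)) - g i (x(i := y)))\<^sup>2 \<partial>M i) = (\<integral>y. (f (x(i := y)) - G x)\<^sup>2 \<partial>M i) + (G x - g i x)\<^sup>2"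
      using d[of "g i x"] by simp
    moreover have "(\<integral>y. (f (x(i := y)) - c)\<^sup>2 \<partial>M i) = (\<integral>y. (f (x(i := y)) - G x)\<^sup>2 \<partial>M i) + (G x - c)\<^sup>2"
      using d[of c] by simp
    ultimately show ?thesis by simp
  qed
  have mQ: "(\<lambda>x. (f x - g j x)\<^sup>2) \<in> borel_measurable ?Q" if "j \<in> insert i I" for j using gm[OF that] by measurable
  have bQ: "\<bar>(f x - g j x)\<^sup>2\<bar> \<le> (2 * B)\<^sup>2" if "j \<in> insert i I" "x \<in> space ?Q" for j x
    using sqb[OF fB[OF that(2)] gB[OF that]] .
  have "(\<integral>x. (f x - c)\<^sup>2 \<partial>?Q) = (\<integral>x. (\<integral>y. (f (x(i := y)) - c)\<^sup>2 \<partial>M i) \<partial>?P)"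
    by (rule split[of _ "(2 * B)\<^sup>2"]) (measurable, rule sqb[OF fB cB])
  also have "\<dots> \<le> (\<integral>x. (\<integral>y. (f (x(i := y)) - g i (x(i := y)))\<^sup>2 \<partial>M i) + (G x - c)\<^sup>2 \<partial>?P)"
  proof (rule integral_mono)
    show "integrable ?P (\<lambda>x. \<integral>y. (f (x(i := y)) - c)\<^sup>2 \<partial>M i)"
      by (rule PI.integrable_bounded[of _ "(2 * B)\<^sup>2"], rule mI, measurable)
         (use bI[of "\<lambda>x. (f x - c)\<^sup>2" "(2 * B)\<^sup>2"] sqb[OF fB cB] in auto)
    show "integrable ?P (\<lambda>x. (\<integral>y. (f (x(i := y)) - g i (x(i := y)))\<^sup>2 \<partial>M i) + (G x - c)\<^sup>2)"
    proof (rule Bochner_Integration.integrable_add)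
      show "integrable ?P (\<lambda>x. \<integral>y. (f (x(i := y)) - g i (x(i := y)))\<^sup>2 \<partial>M i)"
        by (rule PI.integrable_bounded[of _ "(2 * B)\<^sup>2", OF mI[OF mQ[OF insertI1]]])
           (use bI[OF mQ[OF insertI1] bQ[OF insertI1]] in auto)
      show "integrable ?P (\<lambda>x. (G x - c)\<^sup>2)"
        by (rule PI.integrable_bounded[of _ "(2 * B)\<^sup>2"], measurable) (use sqb[OF GB cB] in simp)
    qed
  qed (rule inner)
  also have "\<dots> = (\<integral>x. (\<integral>y. (f (x(i := y)) - g i (x(i := y)))\<^sup>2 \<partial>M i) \<partial>?P) + (\<integral>x. (G x - c)\<^sup>2 \<partial>?P)"
  proof (rule Bochner_Integration.integral_add)
    show "integrable ?P (\<lambda>x. \<integral>y. (f (x(i := y)) - g i (x(i := y)))\<^sup>2 \<partial>M i)"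
      by (rule PI.integrable_bounded[of _ "(2 * B)\<^sup>2", OF mI[OF mQ[OF insertI1]]])
         (use bI[OF mQ[OF insertI1] bQ[OF insertI1]] in auto)
    show "integrable ?P (\<lambda>x. (G x - c)\<^sup>2)"
      by (rule PI.integrable_bounded[of _ "(2 * B)\<^sup>2"], measurable) (use sqb[OF GB cB] in simp)
  qed
  also have "(\<integral>x. (\<integral>y. (f (x(i := y)) - g i (x(i := y)))\<^sup>2 \<partial>M i) \<partial>?P) = (\<integral>x. (f x - g i x)\<^sup>2 \<partial>?Q)"
    using split[OF mQ[OF insertI1] bQ[OF insertI1]] by simp
  also have "(\<integral>x. (G x - c)\<^sup>2 \<partial>?P) \<le> (\<Sum>j\<in>I. \<integral>x. (G x - g' j x)\<^sup>2 \<partial>?P)"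
    unfolding cG
  proof (rule insert.IH[OF Gm GB])
    fix j assume j: "j \<in> I"
    then have j': "j \<in> insert i I" "j \<noteq> i" using insert.hyps by auto
    show "g' j \<in> borel_measurable ?P" unfolding g'_def by (rule mI[OF gm[OF j'(1)]])
    show "\<bar>g' j x\<bar> \<le> B" if "x \<in> space ?P" for x
      unfolding g'_def by (rule bI[OF gm[OF j'(1)] gB[OF j'(1)] that])
    show "g' j (x(j := y)) = g' j x" for x y
    proof -
      have "g j (x(j := y, i := z)) = g j (x(i := z))" for z
        unfolding fun_upd_twist[OF j'(2)] by (rule gup[OF j'(1)])
      then show ?thesis unfolding g'_def by (simp only:)
    qed
  qed
  \<comment> \<open>Averaging over coordinate \<open>i\<close> does not increase a mean squared
    difference, by Jensen's inequality.\<close>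
  also have "(\<Sum>j\<in>I. \<integral>x. (G x - g' j x)\<^sup>2 \<partial>?P) \<le> (\<Sum>j\<in>I. \<integral>x. (f x - g j x)\<^sup>2 \<partial>?Q)"
  proof (rule sum_mono)
    fix j assume j: "j \<in> I"
    then have j': "j \<in> insert i I" by simp
    have g'm [measurable]: "g' j \<in> borel_measurable ?P" unfolding g'_def by (rule mI[OF gm[OF j']])
    have g'B: "\<bar>g' j x\<bar> \<le> B" if "x \<in> space ?P" for x
      unfolding g'_def by (rule bI[OF gm[OF j'] gB[OF j'] that])
    have "(\<integral>x. (G x - g' j x)\<^sup>2 \<partial>?P) \<le> (\<integral>x. (\<integral>y. (f (x(i := y)) - g j (x(i := y)))\<^sup>2 \<partial>M i) \<partial>?P)"
    proof (rule integral_mono)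
      show "integrable ?P (\<lambda>x. (G x - g' j x)\<^sup>2)"
        by (rule PI.integrable_bounded[of _ "(2 * B)\<^sup>2"], measurable) (use sqb[OF GB g'B] in simp)
      show "integrable ?P (\<lambda>x. \<integral>y. (f (x(i := y)) - g j (x(i := y)))\<^sup>2 \<partial>M i)"
        by (rule PI.integrable_bounded[of _ "(2 * B)\<^sup>2", OF mI[OF mQ[OF j']]])
           (use bI[OF mQ[OF j'] bQ[OF j']] in auto)
      fix x assume x: "x \<in> space ?P"
      have mf: "(\<lambda>y. f (x(i := y))) \<in> borel_measurable (M i)" by (rule m1[OF fm x])
      have mg: "(\<lambda>y. g j (x(i := y))) \<in> borel_measurable (M i)" by (rule m1[OF gm[OF j'] x])
      have bf: "\<bar>f (x(i := y))\<bar> \<le> B" if "y \<in> space (M i)" for y by (rule fB[OF upd[OF x that]])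
      have bg: "\<bar>g j (x(i := y))\<bar> \<le> B" if "y \<in> space (M i)" for y by (rule gB[OF j' upd[OF x that]])
      have "G x - g' j x = (\<integral>y. f (x(i := y)) - g j (x(i := y)) \<partial>M i)"
        unfolding G_def g'_def using mf mg bf bg
        by (intro Bochner_Integration.integral_diff[symmetric] M.integrable_bounded[where B = B]) auto
      moreover have "(\<integral>y. f (x(i := y)) - g j (x(i := y)) \<partial>M i)\<^sup>2 \<le> (\<integral>y. (f (x(i := y)) - g j (x(i := y)))\<^sup>2 \<partial>M i)"
      proof (rule M.expectation_square_ge[where B = "2 * B"])
        show "(\<lambda>y. f (x(i := y)) - g j (x(i := y))) \<in> borel_measurable (M i)"
          using mf mg by measurable
        show "\<bar>f (x(i := y)) - g j (x(i := y))\<bar> \<le> 2 * B" if "y \<in> space (M i)" for y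
          using bf[OF that] bg[OF that] by linarith
      qed
      ultimately show "(G x - g' j x)\<^sup>2 \<le> (\<integral>y. (f (x(i := y)) - g j (x(i := y)))\<^sup>2 \<partial>M i)" by simp
    qed
    also have "\<dots> = (\<integral>x. (f x - g j x)\<^sup>2 \<partial>?Q)" using split[OF mQ[OF j'] bQ[OF j']] by simp
    finally show "(\<integral>x. (G x - g' j x)\<^sup>2 \<partial>?P) \<le> (\<integral>x. (f x - g j x)\<^sup>2 \<partial>?Q)" .
  qed
  finally show ?case unfolding c_def using insert.hyps by simp
qed

section \<open>Measurability\<close>

text \<open>With the slack \<open>1 / (n + 1)\<close> the search for a common point becomes a search
  in a dense set \<open>D\<close>, which is countable in the application. Conversely, the
  approximate common points stay in a compact ball around one centre, and a limit of a subsequence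
  is a common point.\<close>

lemma common_point_iff:
  fixes x :: "'i \<Rightarrow> 'a::euclidean_space"
  assumes \<alpha>: "finite \<alpha>" "\<alpha> \<noteq> {}" and D: "\<And>U. open U \<Longrightarrow> U \<noteq> {} \<Longrightarrow> \<exists>d\<in>D. d \<in> U"
  shows "(\<Inter>j\<in>\<alpha>. cball (x j) r) \<noteq> {} \<longleftrightarrow> (\<forall>n::nat. \<exists>q\<in>D. \<forall>j\<in>\<alpha>. dist (x j) q \<le> r + 1 / real (Suc n))"
proof
  assume "(\<Inter>j\<in>\<alpha>. cball (x j) r) \<noteq> {}"
  then obtain p where "p \<in> (\<Inter>j\<in>\<alpha>. cball (x j) r)" by blast
  then have p: "\<And>j. j \<in> \<alpha> \<Longrightarrow> dist (x j) p \<le> r" by auto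
  show "\<forall>n::nat. \<exists>q\<in>D. \<forall>j\<in>\<alpha>. dist (x j) q \<le> r + 1 / real (Suc n)"
  proof
    fix n :: nat
    obtain q where q: "q \<in> D" "q \<in> ball p (1 / real (Suc n))" using D[of "ball p (1 / real (Suc n))"] by auto
    have "dist (x j) q \<le> r + 1 / real (Suc n)" if "j \<in> \<alpha>" for j
      using dist_triangle[of "x j" q p] p[OF that] q(2) by simp
    then show "\<exists>q\<in>D. \<forall>j\<in>\<alpha>. dist (x j) q \<le> r + 1 / real (Suc n)" using q(1) by blast
  qed
next
  assume "\<forall>n::nat. \<exists>q\<in>D. \<forall>j\<in>\<alpha>. dist (x j) q \<le> r + 1 / real (Suc n)"
  then obtain q where q: "\<And>n j. j \<in> \<alpha> \<Longrightarrow> dist (x j) (q n) \<le> r + 1 / real (Suc n)" by metis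
  obtain j0 where j0: "j0 \<in> \<alpha>" using \<alpha> by blast
  have "q n \<in> cball (x j0) (r + 1)" for n
  proof -
    have "1 / real (Suc n) \<le> 1" by simp
    then show ?thesis using q[OF j0, of n] unfolding mem_cball by linarith
  qed
  then obtain l s where l: "strict_mono (s :: nat \<Rightarrow> nat)" "(q \<circ> s) \<longlonglongrightarrow> l"
    using compact_cball[of "x j0" "r + 1"] unfolding compact_def by metis
  have "dist (x j) l \<le> r" if j: "j \<in> \<alpha>" for j
  proof (rule LIMSEQ_le)
    show "(\<lambda>n. dist (x j) ((q \<circ> s) n)) \<longlonglongrightarrow> dist (x j) l" by (intro tendsto_intros l)
    have "(\<lambda>n. 1 / real (Suc n)) \<longlonglongrightarrow> 0" using LIMSEQ_inverse_real_of_nat by (simp add: inverse_eq_divide)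
    from LIMSEQ_subseq_LIMSEQ[OF this l(1)] have "(\<lambda>n. 1 / real (Suc (s n))) \<longlonglongrightarrow> 0" by (simp add: o_def)
    from tendsto_add[OF tendsto_const this, of r] show "(\<lambda>n. r + 1 / real (Suc (s n))) \<longlonglongrightarrow> r" by simp
    show "\<exists>N. \<forall>n\<ge>N. dist (x j) ((q \<circ> s) n) \<le> r + 1 / real (Suc (s n))" using q[OF j] by auto
  qed
  then have "l \<in> (\<Inter>j\<in>\<alpha>. cball (x j) r)" by simp
  then show "(\<Inter>j\<in>\<alpha>. cball (x j) r) \<noteq> {}" by blast
qed

lemma measurable_common_point:
  fixes X :: "'i \<Rightarrow> 'w \<Rightarrow> 'a::euclidean_space"
  assumes \<alpha>: "finite \<alpha>" and X: "\<And>j. j \<in> \<alpha> \<Longrightarrow> X j \<in> borel_measurable M"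
  shows "Measurable.pred M (\<lambda>\<omega>. (\<Inter>j\<in>\<alpha>. cball (X j \<omega>) r) \<noteq> {})"
proof (cases "\<alpha> = {}")
  case False
  obtain D :: "'a set" where D: "countable D" "\<And>U. open U \<Longrightarrow> U \<noteq> {} \<Longrightarrow> \<exists>d\<in>D. d \<in> U"
    using countable_dense_setE by metis
  have [measurable]: "X j \<in> borel_measurable M" if "j \<in> \<alpha>" for j using X that .
  have ball: "Measurable.pred M (\<lambda>\<omega>. \<forall>j\<in>\<alpha>. dist (X j \<omega>) q \<le> r + 1 / real (Suc n))" for q and n :: nat
    using \<alpha> by (intro pred_intros_finite(3)) measurable
  have "Measurable.pred M (\<lambda>\<omega>. \<exists>q\<in>D. \<forall>j\<in>\<alpha>. dist (X j \<omega>) q \<le> r + 1 / real (Suc n))" for n :: nat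
  proof -
    have "{\<omega> \<in> space M. \<exists>q\<in>D. \<forall>j\<in>\<alpha>. dist (X j \<omega>) q \<le> r + 1 / real (Suc n)} =
      (\<Union>q\<in>D. {\<omega> \<in> space M. \<forall>j\<in>\<alpha>. dist (X j \<omega>) q \<le> r + 1 / real (Suc n)})" by blast
    also have "\<dots> \<in> sets M" by (rule sets.countable_UN'[OF D(1)]) (use ball in \<open>simp add: pred_def image_subset_iff\<close>)
    finally show ?thesis by (simp add: pred_def)
  qed
  then have "Measurable.pred M (\<lambda>\<omega>. \<forall>n::nat. \<exists>q\<in>D. \<forall>j\<in>\<alpha>. dist (X j \<omega>) q \<le> r + 1 / real (Suc n))"
    by (intro pred_intros_countable(1))
  moreover have "(\<Inter>j\<in>\<alpha>. cball (X j \<omega>) r) \<noteq> {} \<longleftrightarrow>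
      (\<forall>n::nat. \<exists>q\<in>D. \<forall>j\<in>\<alpha>. dist (X j \<omega>) q \<le> r + 1 / real (Suc n))" for \<omega>
    by (rule common_point_iff[OF \<alpha> False D(2)])
  ultimately show ?thesis by (simp only:)
qed simp

lemma measurable_idx_empty:
  fixes X :: "'i \<Rightarrow> 'w \<Rightarrow> 'a::euclidean_space"
  assumes \<alpha>: "finite \<alpha>" and X: "\<And>j. j \<in> \<alpha> \<Longrightarrow> X j \<in> borel_measurable M"
  shows "Measurable.pred M (\<lambda>\<omega>. idx_empty r (\<lambda>j. X j \<omega>) \<alpha>)"
proof -
  have 1: "Measurable.pred M (\<lambda>\<omega>. (\<Inter>j\<in>\<alpha> - {i}. cball (X j \<omega>) r) \<noteq> {})" for i
    using \<alpha> X by (intro measurable_common_point) auto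
  have 2: "Measurable.pred M (\<lambda>\<omega>. \<not> (\<Inter>j\<in>\<alpha>. cball (X j \<omega>) r) \<noteq> {})"
    using \<alpha> X by (intro pred_intros_logic measurable_common_point) auto
  show ?thesis unfolding idx_empty_def
    using 1 2 \<alpha> by (intro pred_intros_logic(3) pred_intros_finite(3)) auto
qed

text \<open>The predicates in \<open>\<Phi>\<close> cut the space into finitely many measurable
  pieces and \<open>g\<close> is constant on each, hence a simple function.\<close>

lemma measurable_of_finite_pattern:
  fixes g :: "'w \<Rightarrow> real"
  assumes \<Phi>: "finite \<Phi>" and P: "\<And>i. i \<in> \<Phi> \<Longrightarrow> Measurable.pred M (P i)"
    and g: "\<And>x y. x \<in> space M \<Longrightarrow> y \<in> space M \<Longrightarrow> (\<And>i. i \<in> \<Phi> \<Longrightarrow> P i x = P i y) \<Longrightarrow> g x = g y"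
  shows "g \<in> borel_measurable M"
proof -
  define \<pi> where "\<pi> x = {i \<in> \<Phi>. P i x}" for x
  have \<pi>: "g x = g y" if "x \<in> space M" "y \<in> space M" "\<pi> x = \<pi> y" for x y
    using that g unfolding \<pi>_def by blast
  have fin: "finite (\<pi> ` space M)"
    by (rule finite_subset[of _ "Pow \<Phi>"]) (use \<Phi> in \<open>auto simp: \<pi>_def\<close>)
  have meas: "{x \<in> space M. \<pi> x = T} \<in> sets M" for T
  proof (cases "T \<subseteq> \<Phi>")
    case True
    have "{x \<in> space M. \<pi> x = T} = {x \<in> space M. \<forall>i\<in>\<Phi>. P i x = (i \<in> T)}"
      using True unfolding \<pi>_def by blast
    also have "\<dots> \<in> sets M"
    proof -
      have "Measurable.pred M (\<lambda>x. \<forall>i\<in>\<Phi>. P i x = (i \<in> T))"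
        using P by (intro pred_intros_finite(3)[OF \<Phi>]) measurable
      then show ?thesis by simp
    qed
    finally show ?thesis .
  next
    case False
    then have "{x \<in> space M. \<pi> x = T} = {}" unfolding \<pi>_def by blast
    then show ?thesis by (simp only: sets.empty_sets)
  qed
  have "simple_function M g"
    unfolding simple_function_def
  proof
    define h where "h T = g (SOME x. x \<in> space M \<and> \<pi> x = T)" for T
    have h: "g x = h (\<pi> x)" if "x \<in> space M" for x
    proof -
      have "(SOME y. y \<in> space M \<and> \<pi> y = \<pi> x) \<in> space M \<and> \<pi> (SOME y. y \<in> space M \<and> \<pi> y = \<pi> x) = \<pi> x"
        by (rule someI[of _ x]) (use that in simp)
      then show ?thesis unfolding h_def using \<pi>[OF that] by metis
    qed
    have "g ` space M \<subseteq> h ` \<pi> ` space M" using h by auto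
    then show "finite (g ` space M)" using fin finite_subset by blast
    show "\<forall>y\<in>g ` space M. g -` {y} \<inter> space M \<in> sets M"
    proof
      fix y
      have "g -` {y} \<inter> space M = (\<Union>T\<in>{T \<in> \<pi> ` space M. h T = y}. {x \<in> space M. \<pi> x = T})"
        using h by auto
      also have "\<dots> \<in> sets M" using fin meas by (intro sets.finite_UN) auto
      finally show "g -` {y} \<inter> space M \<in> sets M" .
    qed
  qed
  then show ?thesis by (rule borel_measurable_simple_function)
qed

lemma measurable_betti_cech:
  fixes X :: "'i \<Rightarrow> 'w \<Rightarrow> 'a::euclidean_space"
  assumes J: "finite J" and X: "\<And>j. j \<in> J \<Longrightarrow> X j \<in> borel_measurable M"
  shows "(\<lambda>\<omega>. real (betti (cech_complex r ((\<lambda>j. X j \<omega>) ` J)) k)) \<in> borel_measurable M"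
proof (rule measurable_of_finite_pattern)
  \<comment> \<open>Two kinds of questions: \<open>Inl \<alpha>\<close> asks for a common point of
    the balls of \<open>\<alpha>\<close>, \<open>Inr (i, j)\<close> for a coincidence of two points;
    together they are the data of \<open>betti_cech_cong\<close>.\<close>
  let ?\<Phi> = "Inl ` Pow J \<union> Inr ` (J \<times> J) :: ('i set + 'i \<times> 'i) set"
  let ?P = "\<lambda>p \<omega>. case p of Inl \<alpha> \<Rightarrow> (\<Inter>j\<in>\<alpha>. cball (X j \<omega>) r) \<noteq> {} | Inr (i, j) \<Rightarrow> X i \<omega> = X j \<omega>"
  show "finite ?\<Phi>" using J by simp
  show "Measurable.pred M (?P p)" if p: "p \<in> ?\<Phi>" for p
  proof (cases p)
    case (Inl \<alpha>)
    then have "finite \<alpha>" "\<alpha> \<subseteq> J" using p J finite_subset by auto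
    then show ?thesis using Inl X measurable_common_point[of \<alpha> X M r] by auto
  next
    case (Inr q)
    then obtain i j where q: "p = Inr (i, j)" "i \<in> J" "j \<in> J" using p by auto
    have [measurable]: "X i \<in> borel_measurable M" "X j \<in> borel_measurable M" using X q by auto
    show ?thesis unfolding q(1) by simp
  qed
  fix x y assume *: "\<And>p. p \<in> ?\<Phi> \<Longrightarrow> ?P p x = ?P p y"
  have "betti (cech_complex r ((\<lambda>j. X j x) ` J)) k = betti (cech_complex r ((\<lambda>j. X j y) ` J)) k"
  proof (rule betti_cech_cong[OF J])
    fix \<alpha> assume "\<alpha> \<subseteq> J"
    then show "(\<Inter>j\<in>\<alpha>. cball (X j x) r) \<noteq> {} \<longleftrightarrow> (\<Inter>j\<in>\<alpha>. cball (X j y) r) \<noteq> {}"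
      using *[of "Inl \<alpha>"] by simp
  next
    fix i j assume "i \<in> J" "j \<in> J"
    then show "X i x = X j x \<longleftrightarrow> X i y = X j y" using *[of "Inr (i, j)"] by simp
  qed
  then show "real (betti (cech_complex r ((\<lambda>j. X j x) ` J)) k) = real (betti (cech_complex r ((\<lambda>j. X j y) ` J)) k)"
    by simp
qed

lemma card_empties_eq:
  assumes "finite J"
  shows "real (card (empties r k x J)) = (\<Sum>\<alpha>\<in>{\<alpha>. \<alpha> \<subseteq> J \<and> card \<alpha> = k + 2}. of_bool (idx_empty r x \<alpha>))"
proof -
  have "finite {\<alpha>. \<alpha> \<subseteq> J \<and> card \<alpha> = k + 2}" using assms by simp
  moreover have "empties r k x J = {\<alpha>. \<alpha> \<subseteq> J \<and> card \<alpha> = k + 2} \<inter> {\<alpha>. idx_empty r x \<alpha>}"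
    unfolding empties_def by blast
  ultimately show ?thesis by (simp add: of_bool_def sum.If_cases)
qed

lemma measurable_card_empties:
  fixes X :: "'i \<Rightarrow> 'w \<Rightarrow> 'a::euclidean_space"
  assumes J: "finite J" and X: "\<And>j. j \<in> J \<Longrightarrow> X j \<in> borel_measurable M"
  shows "(\<lambda>\<omega>. real (card (empties r k (\<lambda>j. X j \<omega>) J))) \<in> borel_measurable M"
  unfolding card_empties_eq[OF J]
proof (rule borel_measurable_sum)
  fix \<alpha> assume "\<alpha> \<in> {\<alpha>. \<alpha> \<subseteq> J \<and> card \<alpha> = k + 2}"
  then have "finite \<alpha>" "\<And>j. j \<in> \<alpha> \<Longrightarrow> X j \<in> borel_measurable M" using J X finite_subset by auto
  then have [measurable]: "Measurable.pred M (\<lambda>\<omega>. idx_empty r (\<lambda>j. X j \<omega>) \<alpha>)" by (rule measurable_idx_empty)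
  show "(\<lambda>\<omega>. of_bool (idx_empty r (\<lambda>j. X j \<omega>) \<alpha>) :: real) \<in> borel_measurable M" 
    unfolding of_bool_def by measurable
qed

lemma measurable_betti_excess:
  fixes X :: "'i \<Rightarrow> 'w \<Rightarrow> 'a::euclidean_space"
  assumes J: "finite J" and X: "\<And>j. j \<in> J \<Longrightarrow> X j \<in> borel_measurable M"
  shows "(\<lambda>\<omega>. betti_excess r k (\<lambda>j. X j \<omega>) J) \<in> borel_measurable M"
  unfolding betti_excess_def
  by (intro borel_measurable_diff measurable_betti_cech[OF J X] measurable_card_empties[OF J X])

text \<open>A deterministic bound obtained by inserting the points one by one. Its size is
  irrelevant to the asymptotics; it provides the boundedness and integrability that
  \<open>efron_stein\<close> and the expectations ask for.\<close>

lemma abs_betti_excess_le: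
  assumes J: "finite J" and k: "k \<ge> 1" and r: "r > 0"
  shows "\<bar>betti_excess r k x J\<bar> \<le> 3 * real (card J) * (real (card J) + 1) ^ (k + 2)"
  using J
proof (induction J rule: finite_induct)
  case empty
  have "\<Union>(cech_complex r ({} :: 'b set)) = {}" by (auto simp: cech_complex_def)
  then have "card (\<Union>(cech_complex r ({} :: 'b set))) \<le> k + 1" by (simp only: card.empty)
  then have "betti (cech_complex r (x ` {})) k = 0"
    unfolding image_empty by (rule betti_few_vertices[OF simplicial_complex_cech[OF finite.emptyI] k])
  moreover have "empties r k x {} = {}" by (auto simp: empties_def)
  ultimately show ?case by (simp add: betti_excess_def)
next
  case (insert i I)
  have cN: "real (card (near r x i I)) \<le> real (card I)"
    using insert.hyps(1) by (intro of_nat_mono card_mono) (auto simp: near_def)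
  have "3 * (real (card (near r x i I)) + 1) ^ (k + 2) \<le> 3 * (real (card I) + 2) ^ (k + 2)"
    using cN by (intro mult_left_mono power_mono) auto
  moreover have "3 * real (card I) * (real (card I) + 1) ^ (k + 2) \<le> 3 * real (card I) * (real (card I) + 2) ^ (k + 2)"
    by (intro mult_left_mono power_mono) auto
  ultimately have "\<bar>betti_excess r k x (insert i I)\<bar> \<le> 3 * (real (card I) + 2) ^ (k + 2) + 3 * real (card I) * (real (card I) + 2) ^ (k + 2)"
    using betti_excess_insert_le[OF insert.hyps k r, of x] insert.IH by linarith
  also have "\<dots> = 3 * (real (card I) + 1) * (real (card I) + 2) ^ (k + 2)" by (simp only: ring_distribs mult_1_right mult_1_left)
  finally have *: "\<bar>betti_excess r k x (insert i I)\<bar> \<le> 3 * (real (card I) + 1) * (real (card I) + 2) ^ (k + 2)" .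
  have "real (card (insert i I)) = real (card I) + 1" "real (card I) + 1 + 1 = real (card I) + 2"
    using insert.hyps by simp_all
  then show ?case using * by (simp only:)
qed

section \<open>Moments of neighbourhood counts\<close>

text \<open>Expectations of \<open>N choose l\<close> are sums of probabilities over
  \<open>l\<close>-subsets, so powers of a count are traded for binomial coefficients; the indicator
  of \<open>l \<le> N\<close> is what preserves smallness of the expectation. Between
  \<open>l\<close> and \<open>m + l\<close> the power is bounded by a constant, and from
  \<open>m + l\<close> on the bound is
  \<open>(N / (m + l)) ^ (m + l) \<le> N choose (m + l)\<close>.\<close>

lemma power_le_binomials:
  fixes N m l :: nat
  assumes "m + l \<ge> 1"
  shows "real N ^ m * of_bool (l \<le> N) \<le> real (m + l) ^ (m + l) * (real (N choose l) + real (N choose (m + l)))"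
proof -
  consider "N < l" | "l \<le> N" "N < m + l" | "m + l \<le> N" by linarith
  then show ?thesis
  proof cases
    case 2
    have "real N ^ m \<le> real (m + l) ^ m" using 2 by (intro power_mono) auto
    also have "\<dots> \<le> real (m + l) ^ (m + l)" using assms by (intro power_increasing) auto
    also have "\<dots> = real (m + l) ^ (m + l) * 1" by simp
    also have "\<dots> \<le> real (m + l) ^ (m + l) * (real (N choose l) + real (N choose (m + l)))"
    proof (rule mult_left_mono)
      have "N choose l \<ge> 1" using 2(1) by (simp add: Suc_leI zero_less_binomial)
      then show "1 \<le> real (N choose l) + real (N choose (m + l))" by linarith
    qed simp
    finally show ?thesis using 2 by simp
  next
    case 3
    have "real N ^ m \<le> real N ^ (m + l)" using 3 assms by (intro power_increasing) auto
    also have "\<dots> = real (m + l) ^ (m + l) * (real N / real (m + l)) ^ (m + l)"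
      using assms by (simp add: power_divide)
    also have "\<dots> \<le> real (m + l) ^ (m + l) * real (N choose (m + l))"
      using binomial_ge_n_over_k_pow_k[OF 3, where ?'a = real] by (intro mult_left_mono) auto
    also have "\<dots> \<le> real (m + l) ^ (m + l) * (real (N choose l) + real (N choose (m + l)))"
      by (intro mult_left_mono) auto
    finally show ?thesis using 3 by simp
  qed (simp)
qed

lemma idx_empty_cong: "(\<And>j. j \<in> \<alpha> \<Longrightarrow> x j = y j) \<Longrightarrow> idx_empty r x \<alpha> = idx_empty r y \<alpha>"
  unfolding idx_empty_def by auto

lemma real_card_near:
  "finite J \<Longrightarrow> real (card (near r x i J)) = (\<Sum>j\<in>J - {i}. of_bool (dist (x j) (x i) \<le> 4 * r))"
proof -
  assume "finite J"
  moreover have "near r x i J = (J - {i}) \<inter> {j. dist (x j) (x i) \<le> 4 * r}" unfolding near_def by blast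
  ultimately show ?thesis by (simp add: of_bool_def sum.If_cases)
qed

lemma real_card_empties_at:
  assumes "finite J"
  shows "real (card {\<alpha> \<in> empties r k x J. i \<in> \<alpha>}) =
    (\<Sum>\<alpha>\<in>{\<alpha>. \<alpha> \<subseteq> J \<and> card \<alpha> = k + 2}. of_bool (i \<in> \<alpha>) * of_bool (idx_empty r x \<alpha>))"
proof -
  have "finite {\<alpha>. \<alpha> \<subseteq> J \<and> card \<alpha> = k + 2}" using assms by simp
  moreover have "{\<alpha> \<in> empties r k x J. i \<in> \<alpha>} = {\<alpha>. \<alpha> \<subseteq> J \<and> card \<alpha> = k + 2} \<inter> {\<alpha>. i \<in> \<alpha> \<and> idx_empty r x \<alpha>}"
    unfolding empties_def by blast
  ultimately have "real (card {\<alpha> \<in> empties r k x J. i \<in> \<alpha>}) =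
    (\<Sum>\<alpha>\<in>{\<alpha>. \<alpha> \<subseteq> J \<and> card \<alpha> = k + 2}. of_bool (i \<in> \<alpha> \<and> idx_empty r x \<alpha>))"
    by (simp add: of_bool_def sum.If_cases)
  then show ?thesis by (simp only: of_bool_conj)
qed

locale iid_sample = prob_space M for M :: "'w measure" +
  fixes X :: "nat \<Rightarrow> 'w \<Rightarrow> 'a::euclidean_space" and f :: "'a \<Rightarrow> real" and B :: real
  assumes f_meas [measurable]: "f \<in> borel_measurable borel"
    and f_nonneg: "\<And>x. 0 \<le> f x" and f_le: "\<And>x. f x \<le> B"
    and X_density: "\<And>i. i \<ge> 1 \<Longrightarrow> distributed M lborel (X i) (\<lambda>x. ennreal (f x))"
    and X_indep: "indep_vars (\<lambda>_. borel) X {1..}"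
begin

lemma B_nonneg: "0 \<le> B"
  using f_nonneg f_le order_trans by blast

lemma X_measurable: "i \<ge> 1 \<Longrightarrow> X i \<in> borel_measurable M"
  using distributed_measurable[OF X_density] by simp

definition ball_mass :: "real \<Rightarrow> real" where
  "ball_mass R = B * (unit_ball_vol (real DIM('a)) * R ^ DIM('a))"

lemma ball_mass_nonneg: "R \<ge> 0 \<Longrightarrow> 0 \<le> ball_mass R"
  using B_nonneg by (simp add: ball_mass_def)

lemma prob_cball_le:
  assumes i: "i \<ge> 1" and R: "R \<ge> 0"
  shows "prob (X i -` cball y R \<inter> space M) \<le> ball_mass R"
proof -
  have "emeasure M (X i -` cball y R \<inter> space M) = (\<integral>\<^sup>+x. ennreal (f x) * indicator (cball y R) x \<partial>lborel)"
    by (rule distributed_emeasure[OF X_density[OF i]]) simp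
  also have "\<dots> \<le> (\<integral>\<^sup>+x. ennreal B * indicator (cball y R) x \<partial>lborel)"
    using f_le by (intro nn_integral_mono mult_right_mono ennreal_leI) auto
  also have "\<dots> = ennreal B * emeasure lborel (cball y R)" by (rule nn_integral_cmult_indicator) simp
  also have "\<dots> = ennreal (ball_mass R)"
    unfolding emeasure_cball[OF R] ball_mass_def using B_nonneg R by (subst ennreal_mult) auto
  finally show ?thesis
    using ball_mass_nonneg[OF R] by (simp add: emeasure_eq_measure)
qed

text \<open>Conditioning on the position of \<open>X i\<close>: the pair of \<open>X i\<close> and
  the remaining points has a product law, and for a fixed centre the points of \<open>T\<close> fall
  into the ball independently, each with probability at most \<open>ball_mass R\<close>.\<close>

lemma prob_all_near:
  assumes i: "i \<ge> 1" and T: "finite T" "T \<subseteq> {1..}" "i \<notin> T" and R: "R \<ge> 0"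
  shows "prob {\<omega> \<in> space M. \<forall>j\<in>T. dist (X j \<omega>) (X i \<omega>) \<le> R} \<le> ball_mass R ^ card T"
proof (cases "T = {}")
  case True
  then show ?thesis by (simp add: prob_space)
next
  case False
  let ?N = "PiM T (\<lambda>_. borel :: 'a measure)"
  let ?Y = "\<lambda>\<omega>. \<lambda>j\<in>T. X j \<omega>"
  let ?L = "PiM {i} (\<lambda>_. borel :: 'a measure)"
  let ?Z = "\<lambda>\<omega>. \<lambda>j\<in>{i}. X j \<omega>"
  have ind: "indep_var ?L ?Z ?N ?Y"
    using i T by (intro indep_var_restrict[OF X_indep]) auto
  have Y: "random_variable ?N ?Y" and Z: "random_variable ?L ?Z"
    using indep_var_rv1[OF ind] indep_var_rv2[OF ind] by auto
  interpret D: prob_space "distr M ?L ?Z" by (rule prob_space_distr[OF Z])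
  interpret D': prob_space "distr M ?N ?Y" by (rule prob_space_distr[OF Y])
  let ?A = "{p \<in> space (?L \<Otimes>\<^sub>M ?N). \<forall>j\<in>T. dist (snd p j) (fst p i) \<le> R}"
  have A: "?A \<in> sets (?L \<Otimes>\<^sub>M ?N)"
  proof -
    have "Measurable.pred (?L \<Otimes>\<^sub>M ?N) (\<lambda>p. \<forall>j\<in>T. dist (snd p j) (fst p i) \<le> R)"
    proof (rule pred_intros_finite(3)[OF T(1)])
      fix j assume "j \<in> T"
      then have [measurable]: "(\<lambda>p. snd p j) \<in> borel_measurable (?L \<Otimes>\<^sub>M ?N)"
        by (intro measurable_compose[OF measurable_snd] measurable_component_singleton)
      have [measurable]: "(\<lambda>p. fst p i) \<in> borel_measurable (?L \<Otimes>\<^sub>M ?N)"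
        by (intro measurable_compose[OF measurable_fst] measurable_component_singleton) simp
      show "Measurable.pred (?L \<Otimes>\<^sub>M ?N) (\<lambda>p. dist (snd p j) (fst p i) \<le> R)" by measurable
    qed
    then show ?thesis by (simp add: pred_def)
  qed
  have ZY: "(\<lambda>\<omega>. (?Z \<omega>, ?Y \<omega>)) \<in> measurable M (?L \<Otimes>\<^sub>M ?N)" using Z Y by (rule measurable_Pair)
  have "{\<omega> \<in> space M. \<forall>j\<in>T. dist (X j \<omega>) (X i \<omega>) \<le> R} = (\<lambda>\<omega>. (?Z \<omega>, ?Y \<omega>)) -` ?A \<inter> space M"
    by (auto simp: space_pair_measure space_PiM)
  then have "emeasure M {\<omega> \<in> space M. \<forall>j\<in>T. dist (X j \<omega>) (X i \<omega>) \<le> R} =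
    emeasure (distr M (?L \<Otimes>\<^sub>M ?N) (\<lambda>\<omega>. (?Z \<omega>, ?Y \<omega>))) ?A"
    using emeasure_distr[OF ZY A] by simp
  also have "\<dots> = emeasure (distr M ?L ?Z \<Otimes>\<^sub>M distr M ?N ?Y) ?A"
    using ind by (simp add: indep_var_distribution_eq)
  also have "\<dots> = (\<integral>\<^sup>+y. emeasure (distr M ?N ?Y) (Pair y -` ?A) \<partial>distr M ?L ?Z)"
    using A by (intro D'.emeasure_pair_measure_alt) (simp cong: sets_pair_measure_cong)
  also have "\<dots> \<le> (\<integral>\<^sup>+y. ennreal (ball_mass R ^ card T) \<partial>distr M ?L ?Z)"
  proof (rule nn_integral_mono)
    fix y assume y: "y \<in> space (distr M ?L ?Z)"
    have "Pair y -` ?A \<in> sets ?N" using sets_Pair1[OF A] .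
    moreover have "?Y -` (Pair y -` ?A) \<inter> space M = (\<Inter>j\<in>T. X j -` cball (y i) R \<inter> space M)"
      using False y by (auto simp: space_pair_measure space_PiM dist_commute)
    ultimately have "emeasure (distr M ?N ?Y) (Pair y -` ?A) = emeasure M (\<Inter>j\<in>T. X j -` cball (y i) R \<inter> space M)"
      using Y by (simp add: emeasure_distr)
    also have "\<dots> = ennreal (\<Prod>j\<in>T. prob (X j -` cball (y i) R \<inter> space M))"
      using indep_varsD[OF X_indep False T(1,2), of "\<lambda>_. cball (y i) R"] by (simp add: emeasure_eq_measure)
    also have "\<dots> \<le> ennreal (\<Prod>j\<in>T. ball_mass R)"
      using T R by (intro ennreal_leI prod_mono conjI prob_cball_le) auto
    finally show "emeasure (distr M ?N ?Y) (Pair y -` ?A) \<le> ennreal (ball_mass R ^ card T)" by simp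
  qed
  also have "\<dots> = ennreal (ball_mass R ^ card T)" using D.emeasure_space_1 by (simp del: space_distr)
  finally show ?thesis
    using ball_mass_nonneg[OF R] by (simp add: emeasure_eq_measure)
qed

context
  fixes J :: "nat set" and r :: real
  assumes J: "finite J" "J \<subseteq> {1..}" and r: "r > 0"
begin

lemma XJ: "j \<in> J \<Longrightarrow> X j \<in> borel_measurable M"
  using J X_measurable by auto

lemma measurable_card_near: "i \<ge> 1 \<Longrightarrow> (\<lambda>\<omega>. real (card (near r (\<lambda>j. X j \<omega>) i J))) \<in> borel_measurable M"
proof -
  assume "i \<ge> 1"
  then have [measurable]: "X i \<in> borel_measurable M" by (rule X_measurable)
  have [measurable]: "X j \<in> borel_measurable M" if "j \<in> J - {i}" for j using XJ that by blast
  show ?thesis unfolding real_card_near[OF J(1)] of_bool_def by measurable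
qed

lemma card_near_le: "card (near r x i J) \<le> card J"
  using J by (intro card_mono) (auto simp: near_def)

text \<open>The binomial coefficient counts the \<open>l\<close>-sets of indices all near
  \<open>i\<close>; there are at most \<open>card J ^ l\<close> such sets to consider, and
  \<open>prob_all_near\<close> bounds the probability of each.\<close>

lemma expectation_near_choose:
  assumes i: "i \<ge> 1"
  shows "expectation (\<lambda>\<omega>. real (card (near r (\<lambda>j. X j \<omega>) i J) choose l)) \<le> (real (card J) * ball_mass (4 * r)) ^ l"
proof -
  let ?T = "{T. T \<subseteq> J - {i} \<and> card T = l}"
  let ?E = "\<lambda>T. {\<omega> \<in> space M. \<forall>j\<in>T. dist (X j \<omega>) (X i \<omega>) \<le> 4 * r}"
  have fT: "finite ?T" using J by simp
  have mE: "?E T \<in> sets M" if "T \<in> ?T" for T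
  proof -
    have "finite T" using that J finite_subset[of T "J - {i}"] by auto
    moreover have [measurable]: "X i \<in> borel_measurable M" by (rule X_measurable[OF i])
    have [measurable]: "X j \<in> borel_measurable M" if "j \<in> T" for j using XJ that \<open>T \<in> ?T\<close> by blast
    ultimately have "Measurable.pred M (\<lambda>\<omega>. \<forall>j\<in>T. dist (X j \<omega>) (X i \<omega>) \<le> 4 * r)"
      by (intro pred_intros_finite(3)) measurable
    then show ?thesis by (simp add: pred_def)
  qed
  have "expectation (\<lambda>\<omega>. real (card (near r (\<lambda>j. X j \<omega>) i J) choose l)) = expectation (\<lambda>\<omega>. \<Sum>T\<in>?T. indicator (?E T) \<omega>)"
  proof (rule Bochner_Integration.integral_cong)
    fix \<omega> assume w: "\<omega> \<in> space M"
    let ?N = "near r (\<lambda>j. X j \<omega>) i J"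
    have "finite ?N" using J by (simp add: near_def)
    then have "real (card ?N choose l) = real (card {T. T \<subseteq> ?N \<and> card T = l})" by (simp add: n_subsets)
    also have "{T. T \<subseteq> ?N \<and> card T = l} = ?T \<inter> {T. \<omega> \<in> ?E T}" using w by (auto simp: near_def)
    also have "real (card (?T \<inter> {T. \<omega> \<in> ?E T})) = (\<Sum>T\<in>?T. indicator (?E T) \<omega>)"
      using fT by (simp add: indicator_def sum.If_cases)
    finally show "real (card ?N choose l) = (\<Sum>T\<in>?T. indicator (?E T) \<omega>)" .
  qed simp
  also have "\<dots> = (\<Sum>T\<in>?T. prob (?E T))"
    using mE by (subst Bochner_Integration.integral_sum) (auto simp: integrable_indicator_iff emeasure_eq_measure intro!: sum.cong)
  also have "\<dots> \<le> (\<Sum>T\<in>?T. ball_mass (4 * r) ^ l)"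
  proof (rule sum_mono)
    fix T assume T: "T \<in> ?T"
    then have "finite T" using J finite_subset[of T "J - {i}"] by auto
    then show "prob (?E T) \<le> ball_mass (4 * r) ^ l"
      using prob_all_near[OF i, of T "4 * r"] T J r by auto
  qed
  also have "\<dots> = real (card (J - {i}) choose l) * ball_mass (4 * r) ^ l"
    using J by (simp add: n_subsets)
  also have "\<dots> \<le> real (card J ^ l) * ball_mass (4 * r) ^ l"
  proof (intro mult_right_mono of_nat_mono)
    have "card (J - {i}) choose l \<le> card (J - {i}) ^ l"
      by (cases "l \<le> card (J - {i})") (simp_all only: binomial_le_pow binomial_eq_0 not_le zero_le)
    also have "\<dots> \<le> card J ^ l" using J by (intro power_mono card_mono) auto
    finally show "card (J - {i}) choose l \<le> card J ^ l" .
  qed (use ball_mass_nonneg r in auto)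
  finally show ?thesis by (simp add: power_mult_distrib)
qed

text \<open>The scale \<open>c\<close> bounds the mean number of near points and tends to 0 in the
  regime of the theorem, so \<open>c ^ l\<close> is the leading term: demanding \<open>l\<close>
  near points costs \<open>c ^ l\<close> whatever the power \<open>m\<close>.\<close>

lemma near_moment:
  assumes i: "i \<ge> 1" and ml: "m + l \<ge> 1"
  defines "c \<equiv> real (card J) * ball_mass (4 * r)"
  shows "expectation (\<lambda>\<omega>. real (card (near r (\<lambda>j. X j \<omega>) i J)) ^ m * of_bool (l \<le> card (near r (\<lambda>j. X j \<omega>) i J)))
    \<le> real (m + l) ^ (m + l) * (c ^ l + c ^ (m + l))"
proof -
  let ?N = "\<lambda>\<omega>. card (near r (\<lambda>j. X j \<omega>) i J)"
  note mN [measurable] = measurable_card_near[OF i]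
  have intg: "integrable M (\<lambda>\<omega>. g (?N \<omega>))" for g :: "nat \<Rightarrow> real"
  proof (rule integrable_bounded[of _ "Max ((\<lambda>n. norm (g n)) ` {..card J})"])
    \<comment> \<open>Measurability is known for the count as a real number; \<open>nat\<close> of
      its floor recovers the natural argument of \<open>g\<close>.\<close>
    have "(\<lambda>\<omega>. g (nat \<lfloor>real (?N \<omega>)\<rfloor>)) \<in> borel_measurable M" by measurable
    then show "(\<lambda>\<omega>. g (?N \<omega>)) \<in> borel_measurable M" by simp
    show "norm (g (?N \<omega>)) \<le> Max ((\<lambda>n. norm (g n)) ` {..card J})" for \<omega>
      using card_near_le by (intro Max_ge) auto
  qed
  have "expectation (\<lambda>\<omega>. real (?N \<omega>) ^ m * of_bool (l \<le> ?N \<omega>)) \<le>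
    expectation (\<lambda>\<omega>. real (m + l) ^ (m + l) * (real (?N \<omega> choose l) + real (?N \<omega> choose (m + l))))"
    by (rule integral_mono[OF intg intg]) (rule power_le_binomials[OF ml])
  also have "\<dots> = real (m + l) ^ (m + l) * (expectation (\<lambda>\<omega>. real (?N \<omega> choose l)) + expectation (\<lambda>\<omega>. real (?N \<omega> choose (m + l))))"
    using intg[of "\<lambda>n. real (n choose l)"] intg[of "\<lambda>n. real (n choose (m + l))"] by simp
  also have "\<dots> \<le> real (m + l) ^ (m + l) * (c ^ l + c ^ (m + l))"
    unfolding c_def using expectation_near_choose[OF i] by (intro mult_left_mono add_mono) auto
  finally show ?thesis .
qed

end
end

section \<open>Variance of the Betti excess of the sample\<close>

context iid_sample
begin

text \<open>One constant for the three moment bounds below: \<open>near_moment\<close> produces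
  \<open>(m + l) ^ (m + l)\<close> with \<open>m + l\<close> equal to \<open>3 * k + 6\<close>,
  \<open>3 * k + 4\<close> and \<open>2 * k + 2\<close>, and the largest is taken.\<close>

definition kC :: "nat \<Rightarrow> real" where "kC k = (3 * real k + 6) ^ (3 * k + 6)"

context
  fixes J :: "nat set" and r :: real and k :: nat
  assumes J: "finite J" "J \<subseteq> {1..}" "J \<noteq> {}" and r: "r > 0" and k: "k \<ge> 1"
begin

text \<open>Moves functionals of the sample to the product of the individual laws, the setting of
  \<open>efron_stein\<close>.\<close>

lemma distr_sample: "distr M (PiM J (\<lambda>_. borel)) (\<lambda>\<omega>. \<lambda>j\<in>J. X j \<omega>) = PiM J (\<lambda>_. density lborel f)"
proof -
  have "indep_vars (\<lambda>_. borel) X J" using indep_vars_subset[OF X_indep J(2)] .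
  then have "distr M (PiM J (\<lambda>_. borel)) (\<lambda>\<omega>. \<lambda>j\<in>J. X j \<omega>) = PiM J (\<lambda>j. distr M borel (X j))"
    using J X_measurable by (subst (asm) indep_vars_iff_distr_eq_PiM') auto
  also have "\<dots> = PiM J (\<lambda>_. density lborel f)"
  proof (rule PiM_cong[OF refl])
    fix j assume "j \<in> J"
    then have "j \<ge> 1" using J by auto
    have "distr M borel (X j) = distr M lborel (X j)" by (rule distr_cong) auto
    then show "distr M borel (X j) = density lborel f"
      using distributed_distr_eq_density[OF X_density[OF \<open>j \<ge> 1\<close>]] by simp
  qed
  finally show ?thesis .
qed

lemma prob_space_density: "prob_space (density lborel (\<lambda>x. ennreal (f x)))"
proof -
  have "distr M lborel (X 1) = density lborel f" using distributed_distr_eq_density[OF X_density[of 1]] by simp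
  moreover have "prob_space (distr M lborel (X 1))"
    by (rule prob_space_distr) (use X_measurable[of 1] in simp)
  ultimately show ?thesis by simp
qed

lemma betti_excess_cong: "(\<And>j. j \<in> J \<Longrightarrow> x j = y j) \<Longrightarrow> I \<subseteq> J \<Longrightarrow> betti_excess r k x I = betti_excess r k y I"
proof -
  assume *: "\<And>j. j \<in> J \<Longrightarrow> x j = y j" "I \<subseteq> J"
  have "x ` I = y ` I" using * by (intro image_cong) auto
  moreover have "empties r k x I = empties r k y I"
    proof -
    have "idx_empty r x \<alpha> = idx_empty r y \<alpha>" if "\<alpha> \<subseteq> I" for \<alpha>
      using that * by (intro idx_empty_cong) auto
    then show ?thesis unfolding empties_def by blast
  qed
  ultimately show ?thesis unfolding betti_excess_def by simp
qed

text \<open>The difference vanishes with at most \<open>k + 1\<close> near points; otherwise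
  \<open>n + 1 \<le> 2 * n\<close> simplifies the crude bound, and \<open>9 * 4 ^ (k + 2)\<close> is
  the square of \<open>3 * 2 ^ (k + 2)\<close>.\<close>

lemma betti_excess_diff_square_le:
  assumes i: "i \<in> J"
  shows "(betti_excess r k x J - betti_excess r k x (J - {i}))\<^sup>2 \<le>
    9 * 4 ^ (k + 2) * (real (card (near r x i J)) ^ (2 * k + 4) * of_bool (k + 2 \<le> card (near r x i J)))"
proof -
  let ?n = "card (near r x i J)"
  have I: "finite (J - {i})" "i \<notin> J - {i}" and JI: "insert i (J - {i}) = J" using J i by auto
  have near: "near r x i (J - {i}) = near r x i J" unfolding near_def by auto
  show ?thesis
  proof (cases "?n \<le> k + 1")
    case True
    then show ?thesis using betti_excess_insert[OF I k r, of x] near JI by simp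
  next
    case False
    then have n: "?n \<ge> k + 2" by simp
    have "\<bar>betti_excess r k x J - betti_excess r k x (J - {i})\<bar> \<le> 3 * (real ?n + 1) ^ (k + 2)"
      using betti_excess_insert_le[OF I k r, of x] near JI by simp
    also have "\<dots> \<le> 3 * (2 * real ?n) ^ (k + 2)" using n by (intro mult_left_mono power_mono) auto
    finally have "\<bar>betti_excess r k x J - betti_excess r k x (J - {i})\<bar>\<^sup>2 \<le> (3 * (2 * real ?n) ^ (k + 2))\<^sup>2"
      by (rule power_mono) simp
    also have "(3 * (2 * real ?n) ^ (k + 2))\<^sup>2 = 9 * ((2 * real ?n)\<^sup>2) ^ (k + 2)"
      unfolding power_mult_distrib[of 3] power_mult[symmetric] mult.commute[of "k + 2" 2] by simp
    also have "((2 * real ?n)\<^sup>2) ^ (k + 2) = 4 ^ (k + 2) * (real ?n) ^ (2 * (k + 2))"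
      unfolding power_mult power_mult_distrib by simp
    also have "2 * (k + 2) = 2 * k + 4" by simp
    finally show ?thesis using n by simp
  qed
qed

text \<open>The competitor in \<open>efron_stein\<close> is the excess of the sample without point
  \<open>i\<close>; \<open>near_moment\<close> is then used with \<open>m = 2 * k + 4\<close> and
  \<open>l = k + 2\<close>. The leading order \<open>n * c ^ (k + 2)\<close> has one factor
  \<open>c\<close> more than the normalisation, which is of order
  \<open>n * c ^ (k + 1)\<close>.\<close>

lemma variance_betti_excess:
  defines "c \<equiv> real (card J) * ball_mass (4 * r)" and "F \<equiv> \<lambda>\<omega>. betti_excess r k (\<lambda>j. X j \<omega>) J"
  shows "expectation (\<lambda>\<omega>. (F \<omega> - expectation F)\<^sup>2) \<le>
    real (card J) * (9 * 4 ^ (k + 2) * (kC k * (c ^ (k + 2) + c ^ (3 * k + 6))))"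
proof -
  let ?D = "density lborel (\<lambda>x. ennreal (f x))"
  let ?P = "PiM J (\<lambda>_. ?D)"
  let ?Y = "\<lambda>\<omega>. \<lambda>j\<in>J. X j \<omega>"
  interpret PS: product_prob_space "\<lambda>_. ?D" J
    using prob_space_density by (intro product_prob_spaceI) auto
  have sets: "sets ?P = sets (PiM J (\<lambda>_. borel))" by (intro sets_PiM_cong) auto
  have comp [measurable]: "(\<lambda>x. x j) \<in> borel_measurable ?P" if "j \<in> J" for j
    using measurable_component_singleton[OF that, of "\<lambda>_. borel :: 'a measure"] by (simp cong: measurable_cong_sets add: sets)
  have Ym: "?Y \<in> measurable M (PiM J (\<lambda>_. borel))"
    using J X_measurable by (intro measurable_restrict) auto
  have mE: "(\<lambda>x. betti_excess r k x I) \<in> borel_measurable ?P" if "I \<subseteq> J" for I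
    using measurable_betti_excess[of I "\<lambda>j x. x j" ?P r k] comp that finite_subset[OF that J(1)] by blast
  have transfer: "(\<integral>x. h x \<partial>?P) = expectation (\<lambda>\<omega>. h (?Y \<omega>))" if "h \<in> borel_measurable ?P" for h :: "_ \<Rightarrow> real"
  proof -
    have "h \<in> borel_measurable (PiM J (\<lambda>_. borel))" using that by (simp cong: measurable_cong_sets add: sets)
    then show ?thesis unfolding distr_sample[symmetric] by (rule integral_distr[OF Ym])
  qed
  have Y: "betti_excess r k (?Y \<omega>) I = betti_excess r k (\<lambda>j. X j \<omega>) I" if "I \<subseteq> J" for \<omega> I
    using that by (intro betti_excess_cong) auto
  define C where "C = 3 * real (card J) * (real (card J) + 1) ^ (k + 2)"
  have bound: "\<bar>betti_excess r k x I\<bar> \<le> C" if "I \<subseteq> J" for I and x :: "nat \<Rightarrow> 'a"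
  proof -
    have "card I \<le> card J" "finite I" by (rule card_mono[OF J(1) that], rule finite_subset[OF that J(1)])
    then have "3 * real (card I) * (real (card I) + 1) ^ (k + 2) \<le> C"
      unfolding C_def by (intro mult_mono power_mono) auto
    then show ?thesis using abs_betti_excess_le[OF \<open>finite I\<close> k r, of x] by linarith
  qed
  have "expectation (\<lambda>\<omega>. (F \<omega> - expectation F)\<^sup>2) =
    (\<integral>x. (betti_excess r k x J - (\<integral>x. betti_excess r k x J \<partial>?P))\<^sup>2 \<partial>?P)"
  proof -
    have m: "(\<lambda>x. (betti_excess r k x J - a)\<^sup>2) \<in> borel_measurable ?P" for a
      using mE[OF order_refl] by measurable
    show ?thesis unfolding transfer[OF m] transfer[OF mE[OF order_refl]] Y[OF order_refl] F_def ..
  qed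
  also have "\<dots> \<le> (\<Sum>i\<in>J. \<integral>x. (betti_excess r k x J - betti_excess r k x (J - {i}))\<^sup>2 \<partial>?P)"
  proof (rule PS.efron_stein[OF J(1)])
    show "betti_excess r k (x(i := y)) (J - {i}) = betti_excess r k x (J - {i})" if "i \<in> J" for i x y
    proof -
      have "(x(i := y)) ` (J - {i}) = x ` (J - {i})" by (intro image_cong) auto
      moreover have "empties r k (x(i := y)) (J - {i}) = empties r k x (J - {i})"
      proof -
        have "idx_empty r (x(i := y)) \<alpha> = idx_empty r x \<alpha>" if "\<alpha> \<subseteq> J - {i}" for \<alpha>
          using that by (intro idx_empty_cong) auto
        then show ?thesis unfolding empties_def by blast
      qed
      ultimately show ?thesis unfolding betti_excess_def by simp
    qed
  qed (use mE bound in auto)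
  also have "\<dots> \<le> (\<Sum>i\<in>J. 9 * 4 ^ (k + 2) * (kC k * (c ^ (k + 2) + c ^ (3 * k + 6))))"
  proof (rule sum_mono)
    fix i assume i: "i \<in> J"
    then have i1: "i \<ge> 1" using J by auto
    let ?N = "\<lambda>\<omega>. card (near r (\<lambda>j. X j \<omega>) i J)"
    have "(\<integral>x. (betti_excess r k x J - betti_excess r k x (J - {i}))\<^sup>2 \<partial>?P) =
      expectation (\<lambda>\<omega>. (betti_excess r k (\<lambda>j. X j \<omega>) J - betti_excess r k (\<lambda>j. X j \<omega>) (J - {i}))\<^sup>2)"
    proof -
      have m: "(\<lambda>x. (betti_excess r k x J - betti_excess r k x (J - {i}))\<^sup>2) \<in> borel_measurable ?P"
        using mE[OF order_refl] mE[OF Diff_subset] by measurable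
      show ?thesis unfolding transfer[OF m] Y[OF order_refl] Y[OF Diff_subset] ..
    qed
    also have "\<dots> \<le> expectation (\<lambda>\<omega>. 9 * 4 ^ (k + 2) * (real (?N \<omega>) ^ (2 * k + 4) * of_bool (k + 2 \<le> ?N \<omega>)))"
    proof (rule integral_mono')
      have m: "(\<lambda>\<omega>. real (?N \<omega>)) \<in> borel_measurable M" by (rule measurable_card_near[OF J(1,2) r i1])
      then have "(\<lambda>\<omega>. 9 * 4 ^ (k + 2) * (real (?N \<omega>) ^ (2 * k + 4) * of_bool (real (k + 2) \<le> real (?N \<omega>)))) \<in> borel_measurable M"
        unfolding of_bool_def by measurable
      then have m': "(\<lambda>\<omega>. 9 * 4 ^ (k + 2) * (real (?N \<omega>) ^ (2 * k + 4) * of_bool (k + 2 \<le> ?N \<omega>))) \<in> borel_measurable M"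
        by (simp only: of_nat_le_iff)
      show "integrable M (\<lambda>\<omega>. 9 * 4 ^ (k + 2) * (real (?N \<omega>) ^ (2 * k + 4) * of_bool (k + 2 \<le> ?N \<omega>)))"
      proof (rule integrable_bounded[OF m', of "9 * 4 ^ (k + 2) * (real (card J) ^ (2 * k + 4) * 1)"])
        fix \<omega>
        have "9 * 4 ^ (k + 2) * (real (?N \<omega>) ^ (2 * k + 4) * of_bool (k + 2 \<le> ?N \<omega>)) \<le>
          9 * 4 ^ (k + 2) * (real (card J) ^ (2 * k + 4) * 1)"
          using card_near_le[OF J(1,2) r, of "\<lambda>j. X j \<omega>" i] by (intro mult_mono power_mono) auto
        then show "norm (9 * 4 ^ (k + 2) * (real (?N \<omega>) ^ (2 * k + 4) * of_bool (k + 2 \<le> ?N \<omega>)))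
          \<le> 9 * 4 ^ (k + 2) * (real (card J) ^ (2 * k + 4) * 1)" by simp
      qed
    qed (rule betti_excess_diff_square_le[OF i], simp)
    also have "\<dots> = 9 * 4 ^ (k + 2) * expectation (\<lambda>\<omega>. real (?N \<omega>) ^ (2 * k + 4) * of_bool (k + 2 \<le> ?N \<omega>))"
      by (rule integral_mult_right_zero)
    also have "\<dots> \<le> 9 * 4 ^ (k + 2) * (kC k * (c ^ (k + 2) + c ^ (3 * k + 6)))"
    proof (rule mult_left_mono)
      have e: "(2 * k + 4) + (k + 2) = 3 * k + 6" "real ((2 * k + 4) + (k + 2)) = 3 * real k + 6" by simp_all
      show "expectation (\<lambda>\<omega>. real (?N \<omega>) ^ (2 * k + 4) * of_bool (k + 2 \<le> ?N \<omega>)) \<le> kC k * (c ^ (k + 2) + c ^ (3 * k + 6))"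
        using near_moment[OF J(1,2) r i1, of "2 * k + 4" "k + 2"] unfolding kC_def c_def e by simp
    qed simp
    finally show "(\<integral>x. (betti_excess r k x J - betti_excess r k x (J - {i}))\<^sup>2 \<partial>?P) \<le>
      9 * 4 ^ (k + 2) * (kC k * (c ^ (k + 2) + c ^ (3 * k + 6)))" .
  qed
  finally show ?thesis by simp
qed

section \<open>Poisson approximation of the number of empty simplices\<close>

definition "cells = {\<alpha>. \<alpha> \<subseteq> J \<and> card \<alpha> = k + 2}"
definition "cell_ind \<alpha> \<omega> = (of_bool (idx_empty r (\<lambda>j. X j \<omega>) \<alpha>) :: real)"
text \<open>The dependency neighbourhood: cells outside it use other sample points. A cell, being
  nonempty, belongs to its own neighbourhood, as the Stein--Chen bound expects.\<close>

definition "cell_nb \<alpha> = {\<beta> \<in> cells. \<beta> \<inter> \<alpha> \<noteq> {}}"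

lemma finite_cells: "finite cells" using J by (simp add: cells_def)

lemma cell_facts: "\<alpha> \<in> cells \<Longrightarrow> finite \<alpha> \<and> \<alpha> \<subseteq> J \<and> \<alpha> \<noteq> {}"
  using J finite_subset unfolding cells_def by fastforce

lemma cell_ind_measurable: "\<alpha> \<in> cells \<Longrightarrow> cell_ind \<alpha> \<in> borel_measurable M"
proof -
  assume "\<alpha> \<in> cells"
  then have "Measurable.pred M (\<lambda>\<omega>. idx_empty r (\<lambda>j. X j \<omega>) \<alpha>)"
    using cell_facts XJ[OF J(1,2) r] by (intro measurable_idx_empty) auto
  then show ?thesis unfolding cell_ind_def of_bool_def by measurable
qed

lemma cell_ind_01: "cell_ind \<alpha> \<omega> \<in> {0, 1}" by (simp add: cell_ind_def)

text \<open>Both variables are functions of restrictions of the sample, to the disjoint index sets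
  \<open>\<alpha>\<close> and \<open>J - \<alpha>\<close>.\<close>

lemma cell_indep:
  assumes \<alpha>: "\<alpha> \<in> cells"
  shows "indep_var borel (cell_ind \<alpha>) borel (\<lambda>\<omega>. \<Sum>\<beta>\<in>cells - cell_nb \<alpha>. cell_ind \<beta> \<omega>)"
proof -
  let ?A = "PiM \<alpha> (\<lambda>_. borel :: 'a measure)" and ?B = "PiM (J - \<alpha>) (\<lambda>_. borel :: 'a measure)"
  have m: "(\<lambda>x. of_bool (idx_empty r x \<beta>) :: real) \<in> borel_measurable (PiM L (\<lambda>_. borel :: 'a measure))"
    if "\<beta> \<subseteq> L" "finite \<beta>" for \<beta> L
  proof -
    have "Measurable.pred (PiM L (\<lambda>_. borel :: 'a measure)) (\<lambda>x. idx_empty r (\<lambda>j. x j) \<beta>)"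
      using that by (intro measurable_idx_empty measurable_component_singleton) auto
    then show ?thesis unfolding of_bool_def by measurable
  qed
  have sub: "\<beta> \<subseteq> J - \<alpha>" "finite \<beta>" if "\<beta> \<in> cells - cell_nb \<alpha>" for \<beta>
    using that cell_facts[of \<beta>] unfolding cell_nb_def by auto
  have "indep_var ?A (\<lambda>\<omega>. \<lambda>j\<in>\<alpha>. X j \<omega>) ?B (\<lambda>\<omega>. \<lambda>j\<in>J - \<alpha>. X j \<omega>)"
    using cell_facts[OF \<alpha>] J(2) by (intro indep_var_restrict[OF X_indep]) auto
  then have "indep_var borel ((\<lambda>x. of_bool (idx_empty r x \<alpha>) :: real) \<circ> (\<lambda>\<omega>. \<lambda>j\<in>\<alpha>. X j \<omega>))
    borel ((\<lambda>x. \<Sum>\<beta>\<in>cells - cell_nb \<alpha>. of_bool (idx_empty r x \<beta>) :: real) \<circ> (\<lambda>\<omega>. \<lambda>j\<in>J - \<alpha>. X j \<omega>))"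
    by (rule indep_var_compose)
       (use sub cell_facts[OF \<alpha>] in \<open>auto intro!: borel_measurable_sum m\<close>)
  moreover have "(\<lambda>x. of_bool (idx_empty r x \<alpha>) :: real) \<circ> (\<lambda>\<omega>. \<lambda>j\<in>\<alpha>. X j \<omega>) = cell_ind \<alpha>"
    unfolding cell_ind_def o_def by (intro ext arg_cong[of _ _ of_bool] idx_empty_cong) simp
  moreover have "(\<lambda>x. \<Sum>\<beta>\<in>cells - cell_nb \<alpha>. of_bool (idx_empty r x \<beta>) :: real) \<circ> (\<lambda>\<omega>. \<lambda>j\<in>J - \<alpha>. X j \<omega>) =
    (\<lambda>\<omega>. \<Sum>\<beta>\<in>cells - cell_nb \<alpha>. cell_ind \<beta> \<omega>)"
    unfolding cell_ind_def o_def using sub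
    by (intro ext sum.cong refl arg_cong[of _ _ of_bool] idx_empty_cong) auto
  ultimately show ?thesis by simp
qed

lemma cell_ind_integrable: "\<alpha> \<in> cells \<Longrightarrow> integrable M (cell_ind \<alpha>)"
  by (rule integrable_bounded[of _ 1, OF cell_ind_measurable]) (auto simp: cell_ind_def)

lemma cell_ind_integrable2: "\<alpha> \<in> cells \<Longrightarrow> \<beta> \<in> cells \<Longrightarrow> integrable M (\<lambda>\<omega>. cell_ind \<alpha> \<omega> * cell_ind \<beta> \<omega>)"
proof (rule integrable_bounded[of _ 1])
  assume "\<alpha> \<in> cells" "\<beta> \<in> cells"
  then have [measurable]: "cell_ind \<alpha> \<in> borel_measurable M" "cell_ind \<beta> \<in> borel_measurable M"
    by (simp_all add: cell_ind_measurable)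
  show "(\<lambda>\<omega>. cell_ind \<alpha> \<omega> * cell_ind \<beta> \<omega>) \<in> borel_measurable M" by measurable
qed (auto simp: cell_ind_def)

text \<open>Degree of \<open>i\<close> in the hypergraph of empty simplices. Overlapping pairs are
  organised by a shared index, which reduces both Stein--Chen error terms to moments of this
  degree.\<close>

definition "cell_deg i \<omega> = real (card {\<alpha> \<in> empties r k (\<lambda>j. X j \<omega>) J. i \<in> \<alpha>})"

lemma cell_deg_eq: "cell_deg i \<omega> = (\<Sum>\<alpha>\<in>cells. of_bool (i \<in> \<alpha>) * cell_ind \<alpha> \<omega>)"
  unfolding cell_deg_def cells_def cell_ind_def by (rule real_card_empties_at[OF J(1)])

lemma cell_deg_le:
  "cell_deg i \<omega> \<le> real (card (near r (\<lambda>j. X j \<omega>) i J)) ^ (k + 1) * of_bool (k + 1 \<le> card (near r (\<lambda>j. X j \<omega>) i J))"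
proof -
  let ?n = "card (near r (\<lambda>j. X j \<omega>) i J)"
  have "cell_deg i \<omega> \<le> real (?n choose (k + 1))"
    unfolding cell_deg_def by (rule of_nat_mono[OF card_empties_at[OF J(1) k r]])
  also have "\<dots> \<le> real ?n ^ (k + 1) * of_bool (k + 1 \<le> ?n)"
  proof (cases "k + 1 \<le> ?n")
    case True
    then have "real (?n choose (k + 1)) \<le> real (?n ^ (k + 1))" by (intro of_nat_mono binomial_le_pow)
    then show ?thesis using True by simp
  qed (simp add: binomial_eq_0)
  finally show ?thesis .
qed

text \<open>The left side is the number of ordered pairs of distinct empty simplices through
  \<open>i\<close>. With only \<open>k + 1\<close> near indices there is at most one such simplex
  and the number is 0; a pair forces \<open>k + 2\<close> near indices, which yields the additional
  factor \<open>c\<close> in \<open>overlaps_le\<close>.\<close>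

lemma cell_deg_pairs_le:
  "(cell_deg i \<omega>)\<^sup>2 - cell_deg i \<omega> \<le>
    real (card (near r (\<lambda>j. X j \<omega>) i J)) ^ (2 * k + 2) * of_bool (k + 2 \<le> card (near r (\<lambda>j. X j \<omega>) i J))"
proof -
  let ?n = "card (near r (\<lambda>j. X j \<omega>) i J)"
  have d0: "0 \<le> cell_deg i \<omega>" by (simp add: cell_deg_def)
  have dc: "cell_deg i \<omega> \<le> real (?n choose (k + 1))"
    unfolding cell_deg_def by (rule of_nat_mono[OF card_empties_at[OF J(1) k r]])
  show ?thesis
  proof (cases "k + 2 \<le> ?n")
    case True
    have "cell_deg i \<omega> \<le> real ?n ^ (k + 1)" using cell_deg_le[of i \<omega>] True by simp
    then have "(cell_deg i \<omega>)\<^sup>2 \<le> (real ?n ^ (k + 1))\<^sup>2" using d0 by (intro power_mono)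
    also have "\<dots> = real ?n ^ (2 * k + 2)" by (simp only: power_mult[symmetric]) (simp add: mult.commute)
    finally show ?thesis using True d0 by simp
  next
    case False
    then have "?n choose (k + 1) \<le> 1"
      by (cases "?n = k + 1") (simp_all add: binomial_eq_0)
    then have "cell_deg i \<omega> \<le> 1" using dc by linarith
    then have "(cell_deg i \<omega>)\<^sup>2 \<le> cell_deg i \<omega>" using d0 by (simp add: power2_eq_square mult_left_le)
    then show ?thesis using False by simp
  qed
qed

lemma cell_deg_integrable: "integrable M (cell_deg i)"
  unfolding cell_deg_eq[abs_def] using cell_ind_integrable
  by (intro Bochner_Integration.integrable_sum integrable_mult_right) auto

lemma near_power_integrable:
  assumes "i \<ge> 1"
  shows "integrable M (\<lambda>\<omega>. real (card (near r (\<lambda>j. X j \<omega>) i J)) ^ m * of_bool (l \<le> card (near r (\<lambda>j. X j \<omega>) i J)))"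
proof (rule integrable_bounded[of _ "real (card J) ^ m * 1"])
  have [measurable]: "(\<lambda>\<omega>. real (card (near r (\<lambda>j. X j \<omega>) i J))) \<in> borel_measurable M"
    by (rule measurable_card_near[OF J(1,2) r assms])
  have "(\<lambda>\<omega>. real (card (near r (\<lambda>j. X j \<omega>) i J)) ^ m * of_bool (real l \<le> real (card (near r (\<lambda>j. X j \<omega>) i J)))) \<in> borel_measurable M"
    unfolding of_bool_def by measurable
  then show "(\<lambda>\<omega>. real (card (near r (\<lambda>j. X j \<omega>) i J)) ^ m * of_bool (l \<le> card (near r (\<lambda>j. X j \<omega>) i J))) \<in> borel_measurable M"
    by (simp only: of_nat_le_iff)
  fix \<omega>
  have "real (card (near r (\<lambda>j. X j \<omega>) i J)) ^ m * of_bool (l \<le> card (near r (\<lambda>j. X j \<omega>) i J)) \<le> real (card J) ^ m * 1"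
    using card_near_le[OF J(1,2) r, of "\<lambda>j. X j \<omega>" i] by (intro mult_mono power_mono) auto
  then show "norm (real (card (near r (\<lambda>j. X j \<omega>) i J)) ^ m * of_bool (l \<le> card (near r (\<lambda>j. X j \<omega>) i J))) \<le> real (card J) ^ m * 1"
    by simp
qed

text \<open>Overlapping empty simplices share an index, so the pair is counted at least once on the
  right. At fixed \<open>i\<close> the sum may be extended from \<open>cell_nb \<alpha>\<close> to
  all cells, since the indicators of \<open>i \<in> \<alpha>\<close> and
  \<open>i \<in> \<beta>\<close> already enforce an overlap.\<close>

lemma sum_overlaps_le:
  "(\<Sum>\<alpha>\<in>cells. \<Sum>\<beta>\<in>cell_nb \<alpha> - {\<alpha>}. cell_ind \<alpha> \<omega> * cell_ind \<beta> \<omega>) \<le> (\<Sum>i\<in>J. (cell_deg i \<omega>)\<^sup>2 - cell_deg i \<omega>)"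
proof -
  let ?a = "\<lambda>i \<alpha>. of_bool (i \<in> \<alpha>) * cell_ind \<alpha> \<omega>"
  have "cell_ind \<alpha> \<omega> * cell_ind \<beta> \<omega> \<le> (\<Sum>i\<in>J. ?a i \<alpha> * ?a i \<beta>)" if "\<alpha> \<in> cells" "\<beta> \<in> cell_nb \<alpha> - {\<alpha>}" for \<alpha> \<beta>
  proof -
    have "\<exists>i. i \<in> \<alpha> \<and> i \<in> \<beta>" using that(2) unfolding cell_nb_def by blast
    then obtain i where i: "i \<in> \<alpha>" "i \<in> \<beta>" by blast
    then have "i \<in> J" using cell_facts[OF \<open>\<alpha> \<in> cells\<close>] by blast
    have "cell_ind \<alpha> \<omega> * cell_ind \<beta> \<omega> = ?a i \<alpha> * ?a i \<beta>" using i by simp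
    also have "\<dots> \<le> (\<Sum>i\<in>J. ?a i \<alpha> * ?a i \<beta>)"
      by (rule member_le_sum[OF \<open>i \<in> J\<close> _ J(1)]) (simp add: cell_ind_def)
    finally show ?thesis .
  qed
  then have "(\<Sum>\<alpha>\<in>cells. \<Sum>\<beta>\<in>cell_nb \<alpha> - {\<alpha>}. cell_ind \<alpha> \<omega> * cell_ind \<beta> \<omega>) \<le>
    (\<Sum>\<alpha>\<in>cells. \<Sum>\<beta>\<in>cell_nb \<alpha> - {\<alpha>}. \<Sum>i\<in>J. ?a i \<alpha> * ?a i \<beta>)"
    by (intro sum_mono) blast
  also have "\<dots> \<le> (\<Sum>\<alpha>\<in>cells. \<Sum>\<beta>\<in>cells - {\<alpha>}. \<Sum>i\<in>J. ?a i \<alpha> * ?a i \<beta>)"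
    using finite_cells by (intro sum_mono sum_mono2) (auto simp: cell_nb_def cell_ind_def intro!: sum_nonneg)
  also have "\<dots> = (\<Sum>\<alpha>\<in>cells. \<Sum>i\<in>J. \<Sum>\<beta>\<in>cells - {\<alpha>}. ?a i \<alpha> * ?a i \<beta>)"
    by (intro sum.cong refl, rule sum.swap)
  also have "\<dots> = (\<Sum>i\<in>J. \<Sum>\<alpha>\<in>cells. \<Sum>\<beta>\<in>cells - {\<alpha>}. ?a i \<alpha> * ?a i \<beta>)"
    by (rule sum.swap)
  also have "\<dots> = (\<Sum>i\<in>J. (cell_deg i \<omega>)\<^sup>2 - cell_deg i \<omega>)"
  proof (rule sum.cong[OF refl])
    fix i
    have "(\<Sum>\<beta>\<in>cells - {\<alpha>}. ?a i \<alpha> * ?a i \<beta>) = ?a i \<alpha> * cell_deg i \<omega> - ?a i \<alpha>" if "\<alpha> \<in> cells" for \<alpha>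
    proof -
      have sq: "?a i \<alpha> * ?a i \<alpha> = ?a i \<alpha>" using cell_ind_01[of \<alpha> \<omega>] by auto
      have "(\<Sum>\<beta>\<in>cells - {\<alpha>}. ?a i \<alpha> * ?a i \<beta>) = ?a i \<alpha> * (cell_deg i \<omega> - ?a i \<alpha>)"
        unfolding cell_deg_eq sum_distrib_left[symmetric] using sum_diff1[OF finite_cells, of "?a i" \<alpha>] that by simp
      also have "\<dots> = ?a i \<alpha> * cell_deg i \<omega> - ?a i \<alpha>" by (simp only: right_diff_distrib sq)
      finally show ?thesis .
    qed
    then have "(\<Sum>\<alpha>\<in>cells. \<Sum>\<beta>\<in>cells - {\<alpha>}. ?a i \<alpha> * ?a i \<beta>) = (\<Sum>\<alpha>\<in>cells. ?a i \<alpha> * cell_deg i \<omega> - ?a i \<alpha>)"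
      by (intro sum.cong refl)
    also have "\<dots> = (\<Sum>\<alpha>\<in>cells. ?a i \<alpha>) * cell_deg i \<omega> - (\<Sum>\<alpha>\<in>cells. ?a i \<alpha>)"
      by (simp only: sum_subtractf sum_distrib_right)
    also have "\<dots> = (cell_deg i \<omega>)\<^sup>2 - cell_deg i \<omega>" unfolding cell_deg_eq[symmetric] power2_eq_square ..
    finally show "(\<Sum>\<alpha>\<in>cells. \<Sum>\<beta>\<in>cells - {\<alpha>}. ?a i \<alpha> * ?a i \<beta>) = (cell_deg i \<omega>)\<^sup>2 - cell_deg i \<omega>" .
  qed
  finally show ?thesis .
qed

lemma kC_ge: "1 \<le> a \<Longrightarrow> a \<le> 3 * k + 6 \<Longrightarrow> real a ^ a \<le> kC k"
proof -
  assume a: "1 \<le> a" "a \<le> 3 * k + 6"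
  have "real a ^ a \<le> (3 * real k + 6) ^ a" using a by (intro power_mono) auto
  also have "\<dots> \<le> (3 * real k + 6) ^ (3 * k + 6)" using a by (intro power_increasing) auto
  finally show ?thesis by (simp add: kC_def)
qed

text \<open>\<open>near_moment\<close> with \<open>m = 2 * k + 2\<close> and
  \<open>l = k + 2\<close>: overlapping pairs have mean of order at most
  \<open>n * c ^ (k + 2)\<close>, one factor \<open>c\<close> below the normalisation.\<close>

lemma overlaps_le:
  defines "c \<equiv> real (card J) * ball_mass (4 * r)"
  shows "(\<Sum>\<alpha>\<in>cells. \<Sum>\<beta>\<in>cell_nb \<alpha> - {\<alpha>}. expectation (\<lambda>\<omega>. cell_ind \<alpha> \<omega> * cell_ind \<beta> \<omega>)) \<le>
    real (card J) * (kC k * (c ^ (k + 2) + c ^ (3 * k + 4)))"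
proof -
  have c0: "0 \<le> c" unfolding c_def using ball_mass_nonneg r by simp
  have nb: "\<beta> \<in> cells" if "\<beta> \<in> cell_nb \<alpha> - {\<alpha>}" for \<alpha> \<beta> using that by (simp add: cell_nb_def)
  have int2: "integrable M (\<lambda>\<omega>. cell_ind \<alpha> \<omega> * cell_ind \<beta> \<omega>)" if "\<alpha> \<in> cells" "\<beta> \<in> cell_nb \<alpha> - {\<alpha>}" for \<alpha> \<beta>
    by (rule cell_ind_integrable2[OF that(1) nb[OF that(2)]])
  have int1: "integrable M (\<lambda>\<omega>. \<Sum>\<beta>\<in>cell_nb \<alpha> - {\<alpha>}. cell_ind \<alpha> \<omega> * cell_ind \<beta> \<omega>)" if "\<alpha> \<in> cells" for \<alpha>
    by (rule Bochner_Integration.integrable_sum) (rule int2[OF that])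
  let ?b = "\<lambda>i \<omega>. real (card (near r (\<lambda>j. X j \<omega>) i J)) ^ (2 * k + 2) * of_bool (k + 2 \<le> card (near r (\<lambda>j. X j \<omega>) i J))"
  have "(\<Sum>\<alpha>\<in>cells. \<Sum>\<beta>\<in>cell_nb \<alpha> - {\<alpha>}. expectation (\<lambda>\<omega>. cell_ind \<alpha> \<omega> * cell_ind \<beta> \<omega>)) =
    (\<Sum>\<alpha>\<in>cells. expectation (\<lambda>\<omega>. \<Sum>\<beta>\<in>cell_nb \<alpha> - {\<alpha>}. cell_ind \<alpha> \<omega> * cell_ind \<beta> \<omega>))"
    by (intro sum.cong refl Bochner_Integration.integral_sum[symmetric] int2)
  also have "\<dots> = expectation (\<lambda>\<omega>. \<Sum>\<alpha>\<in>cells. \<Sum>\<beta>\<in>cell_nb \<alpha> - {\<alpha>}. cell_ind \<alpha> \<omega> * cell_ind \<beta> \<omega>)"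
    by (rule Bochner_Integration.integral_sum[symmetric]) (rule int1)
  also have "\<dots> \<le> expectation (\<lambda>\<omega>. \<Sum>i\<in>J. ?b i \<omega>)"
  proof (rule integral_mono)
    show "integrable M (\<lambda>\<omega>. \<Sum>\<alpha>\<in>cells. \<Sum>\<beta>\<in>cell_nb \<alpha> - {\<alpha>}. cell_ind \<alpha> \<omega> * cell_ind \<beta> \<omega>)"
      by (rule Bochner_Integration.integrable_sum) (rule int1)
    show "integrable M (\<lambda>\<omega>. \<Sum>i\<in>J. ?b i \<omega>)"
      using J(2) by (intro Bochner_Integration.integrable_sum near_power_integrable) auto
    fix \<omega>
    have "(\<Sum>i\<in>J. (cell_deg i \<omega>)\<^sup>2 - cell_deg i \<omega>) \<le> (\<Sum>i\<in>J. ?b i \<omega>)" by (intro sum_mono cell_deg_pairs_le)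
    then show "(\<Sum>\<alpha>\<in>cells. \<Sum>\<beta>\<in>cell_nb \<alpha> - {\<alpha>}. cell_ind \<alpha> \<omega> * cell_ind \<beta> \<omega>) \<le> (\<Sum>i\<in>J. ?b i \<omega>)"
      using sum_overlaps_le[of \<omega>] by linarith
  qed
  also have "\<dots> = (\<Sum>i\<in>J. expectation (?b i))"
    using J(2) by (intro Bochner_Integration.integral_sum near_power_integrable) auto
  also have "\<dots> \<le> (\<Sum>i\<in>J. kC k * (c ^ (k + 2) + c ^ (3 * k + 4)))"
  proof (rule sum_mono)
    fix i assume i: "i \<in> J"
    then have i1: "i \<ge> 1" using J by auto
    have e: "(2 * k + 2) + (k + 2) = 3 * k + 4" by simp
    have "expectation (?b i) \<le> real (3 * k + 4) ^ (3 * k + 4) * (c ^ (k + 2) + c ^ (3 * k + 4))"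
      using near_moment[OF J(1,2) r i1, of "2 * k + 2" "k + 2"] unfolding c_def e by simp
    also have "\<dots> \<le> kC k * (c ^ (k + 2) + c ^ (3 * k + 4))"
      using kC_ge[of "3 * k + 4"] c0 by (intro mult_right_mono) auto
    finally show "expectation (?b i) \<le> kC k * (c ^ (k + 2) + c ^ (3 * k + 4))" .
  qed
  finally show ?thesis by simp
qed

text \<open>Union bound over the \<open>k + 2\<close> indices of \<open>\<alpha>\<close>, each of
  which has mean degree of order at most \<open>c ^ (k + 1)\<close>. The total mean count is kept as
  a factor, to be compared with the normalisation later.\<close>

lemma products_le:
  defines "c \<equiv> real (card J) * ball_mass (4 * r)"
  shows "(\<Sum>\<alpha>\<in>cells. \<Sum>\<beta>\<in>cell_nb \<alpha>. expectation (cell_ind \<alpha>) * expectation (cell_ind \<beta>)) \<le>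
    (\<Sum>\<alpha>\<in>cells. expectation (cell_ind \<alpha>)) * ((real k + 2) * (kC k * (c ^ (k + 1) + c ^ (2 * k + 2))))"
proof -
  have c0: "0 \<le> c" unfolding c_def using ball_mass_nonneg r by simp
  have p0: "0 \<le> expectation (cell_ind \<beta>)" for \<beta> by (intro integral_nonneg_AE) (simp add: cell_ind_def)
  have deg: "expectation (cell_deg i) \<le> kC k * (c ^ (k + 1) + c ^ (2 * k + 2))" if i: "i \<in> J" for i
  proof -
    have i1: "i \<ge> 1" using J i by auto
    have e: "(k + 1) + (k + 1) = 2 * k + 2" by simp
    have "expectation (cell_deg i) \<le> expectation (\<lambda>\<omega>. real (card (near r (\<lambda>j. X j \<omega>) i J)) ^ (k + 1) * of_bool (k + 1 \<le> card (near r (\<lambda>j. X j \<omega>) i J)))"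
      by (rule integral_mono[OF cell_deg_integrable near_power_integrable[OF i1] cell_deg_le])
    also have "\<dots> \<le> real (2 * k + 2) ^ (2 * k + 2) * (c ^ (k + 1) + c ^ (2 * k + 2))"
      using near_moment[OF J(1,2) r i1, of "k + 1" "k + 1"] unfolding c_def e by simp
    also have "\<dots> \<le> kC k * (c ^ (k + 1) + c ^ (2 * k + 2))"
      using kC_ge[of "2 * k + 2"] c0 by (intro mult_right_mono) auto
    finally show ?thesis .
  qed
  have deg_eq: "expectation (cell_deg i) = (\<Sum>\<beta>\<in>cells. of_bool (i \<in> \<beta>) * expectation (cell_ind \<beta>))" for i
    unfolding cell_deg_eq[abs_def] using cell_ind_integrable
    by (subst Bochner_Integration.integral_sum) auto
  have "(\<Sum>\<beta>\<in>cell_nb \<alpha>. expectation (cell_ind \<beta>)) \<le> (real k + 2) * (kC k * (c ^ (k + 1) + c ^ (2 * k + 2)))"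
    if \<alpha>: "\<alpha> \<in> cells" for \<alpha>
  proof -
    have f\<alpha>: "finite \<alpha>" "\<alpha> \<subseteq> J" using cell_facts[OF \<alpha>] by auto
    have "(\<Sum>\<beta>\<in>cell_nb \<alpha>. expectation (cell_ind \<beta>)) \<le> (\<Sum>\<beta>\<in>cell_nb \<alpha>. \<Sum>i\<in>\<alpha>. of_bool (i \<in> \<beta>) * expectation (cell_ind \<beta>))"
    proof (rule sum_mono)
      fix \<beta> assume "\<beta> \<in> cell_nb \<alpha>"
      then obtain i where i: "i \<in> \<alpha>" "i \<in> \<beta>" unfolding cell_nb_def by blast
      have "expectation (cell_ind \<beta>) = of_bool (i \<in> \<beta>) * expectation (cell_ind \<beta>)" using i by simp
      also have "\<dots> \<le> (\<Sum>i\<in>\<alpha>. of_bool (i \<in> \<beta>) * expectation (cell_ind \<beta>))"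
        by (rule member_le_sum[OF i(1) _ f\<alpha>(1)]) (use p0 in simp)
      finally show "expectation (cell_ind \<beta>) \<le> (\<Sum>i\<in>\<alpha>. of_bool (i \<in> \<beta>) * expectation (cell_ind \<beta>))" .
    qed
    also have "\<dots> \<le> (\<Sum>\<beta>\<in>cells. \<Sum>i\<in>\<alpha>. of_bool (i \<in> \<beta>) * expectation (cell_ind \<beta>))"
      using p0 finite_cells by (intro sum_mono2 sum_nonneg) (auto simp: cell_nb_def)
    also have "\<dots> = (\<Sum>i\<in>\<alpha>. expectation (cell_deg i))" unfolding deg_eq by (rule sum.swap)
    also have "\<dots> \<le> (\<Sum>i\<in>\<alpha>. kC k * (c ^ (k + 1) + c ^ (2 * k + 2)))"
      using f\<alpha> deg by (intro sum_mono) auto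
    also have "\<dots> = (real k + 2) * (kC k * (c ^ (k + 1) + c ^ (2 * k + 2)))" using \<alpha> by (simp add: cells_def)
    finally show ?thesis .
  qed
  then have "(\<Sum>\<alpha>\<in>cells. expectation (cell_ind \<alpha>) * (\<Sum>\<beta>\<in>cell_nb \<alpha>. expectation (cell_ind \<beta>))) \<le>
    (\<Sum>\<alpha>\<in>cells. expectation (cell_ind \<alpha>) * ((real k + 2) * (kC k * (c ^ (k + 1) + c ^ (2 * k + 2)))))"
    by (intro sum_mono mult_left_mono p0)
  then show ?thesis by (simp only: sum_distrib_left[symmetric] sum_distrib_right[symmetric])
qed

theorem char_card_empties:
  fixes s :: real
  defines "c \<equiv> real (card J) * ball_mass (4 * r)"
    and "l \<equiv> (\<Sum>\<alpha>\<in>{\<alpha>. \<alpha> \<subseteq> J \<and> card \<alpha> = k + 2}. prob {\<omega> \<in> space M. idx_empty r (\<lambda>j. X j \<omega>) \<alpha>})"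
  shows "cmod ((CLINT \<omega>|M. iexp (s * real (card (empties r k (\<lambda>j. X j \<omega>) J)))) - exp (of_real l * (iexp s - 1))) \<le>
    s\<^sup>2 * exp (l * s\<^sup>2 / 2) * (l * ((real k + 2) * (kC k * (c ^ (k + 1) + c ^ (2 * k + 2)))) +
      real (card J) * (kC k * (c ^ (k + 2) + c ^ (3 * k + 4))))"
    and "expectation (\<lambda>\<omega>. real (card (empties r k (\<lambda>j. X j \<omega>) J))) = l"
    and "integrable M (\<lambda>\<omega>. real (card (empties r k (\<lambda>j. X j \<omega>) J)))"
proof -
  have W: "real (card (empties r k (\<lambda>j. X j \<omega>) J)) = (\<Sum>\<alpha>\<in>cells. cell_ind \<alpha> \<omega>)" for \<omega>
    unfolding cells_def cell_ind_def by (rule card_empties_eq[OF J(1)])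
  have p: "expectation (cell_ind \<alpha>) = prob {\<omega> \<in> space M. idx_empty r (\<lambda>j. X j \<omega>) \<alpha>}" if "\<alpha> \<in> cells" for \<alpha>
  proof -
    have "Measurable.pred M (\<lambda>\<omega>. idx_empty r (\<lambda>j. X j \<omega>) \<alpha>)"
      using cell_facts[OF that] XJ[OF J(1,2) r] by (intro measurable_idx_empty) auto
    then have "{\<omega> \<in> space M. idx_empty r (\<lambda>j. X j \<omega>) \<alpha>} \<in> sets M" by (simp add: pred_def)
    moreover have "expectation (cell_ind \<alpha>) = expectation (indicator {\<omega> \<in> space M. idx_empty r (\<lambda>j. X j \<omega>) \<alpha>})"
      by (intro Bochner_Integration.integral_cong) (auto simp: cell_ind_def indicator_def)
    ultimately show ?thesis by simp
  qed
  have l: "l = (\<Sum>\<alpha>\<in>cells. expectation (cell_ind \<alpha>))" unfolding l_def cells_def[symmetric] using p by simp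
  show "expectation (\<lambda>\<omega>. real (card (empties r k (\<lambda>j. X j \<omega>) J))) = l"
    unfolding W l using cell_ind_integrable by (intro Bochner_Integration.integral_sum)
  show "integrable M (\<lambda>\<omega>. real (card (empties r k (\<lambda>j. X j \<omega>) J)))"
    unfolding W using cell_ind_integrable by (intro Bochner_Integration.integrable_sum)
  let ?b = "\<Sum>\<alpha>\<in>cells. (\<Sum>\<beta>\<in>cell_nb \<alpha>. expectation (cell_ind \<alpha>) * expectation (cell_ind \<beta>)) +
         (\<Sum>\<beta>\<in>cell_nb \<alpha> - {\<alpha>}. expectation (\<lambda>\<omega>. cell_ind \<alpha> \<omega> * cell_ind \<beta> \<omega>))"
  have "cmod ((CLINT \<omega>|M. iexp (s * (\<Sum>\<alpha>\<in>cells. cell_ind \<alpha> \<omega>))) - exp (of_real l * (iexp s - 1))) \<le>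
    s\<^sup>2 * exp (l * s\<^sup>2 / 2) * ?b"
    unfolding l
  proof (rule dissociated_poisson[OF finite_cells cell_ind_measurable cell_ind_01 _ cell_indep])
    fix \<alpha> assume "\<alpha> \<in> cells"
    then show "\<alpha> \<in> cell_nb \<alpha> \<and> cell_nb \<alpha> \<subseteq> cells" using cell_facts unfolding cell_nb_def by blast
  qed
  also have "\<dots> \<le> s\<^sup>2 * exp (l * s\<^sup>2 / 2) * (l * ((real k + 2) * (kC k * (c ^ (k + 1) + c ^ (2 * k + 2)))) +
      real (card J) * (kC k * (c ^ (k + 2) + c ^ (3 * k + 4))))"
    unfolding sum.distrib l c_def by (intro mult_left_mono add_mono products_le overlaps_le) auto
  finally show "cmod ((CLINT \<omega>|M. iexp (s * real (card (empties r k (\<lambda>j. X j \<omega>) J)))) - exp (of_real l * (iexp s - 1))) \<le>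
    s\<^sup>2 * exp (l * s\<^sup>2 / 2) * (l * ((real k + 2) * (kC k * (c ^ (k + 1) + c ^ (2 * k + 2)))) +
      real (card J) * (kC k * (c ^ (k + 2) + c ^ (3 * k + 4))))"
    unfolding W .
qed

end
end

section \<open>Continuity of translation in the mean\<close>

text \<open>The \<open>L\<^sup>1\<close> modulus of continuity, valued in \<open>ennreal\<close> so
  that no integrability has to be carried along.\<close>

definition shift_diff :: "('a::euclidean_space \<Rightarrow> real) \<Rightarrow> 'a \<Rightarrow> ennreal" where
  "shift_diff g v = (\<integral>\<^sup>+x. ennreal \<bar>g (x + v) - g x\<bar> \<partial>lborel)"

lemma nn_integral_translate:
  fixes v :: "'a::euclidean_space"
  assumes "g \<in> borel_measurable borel"
  shows "(\<integral>\<^sup>+x. g (x + v) \<partial>lborel) = (\<integral>\<^sup>+x. g x \<partial>lborel)"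
proof -
  have "(\<integral>\<^sup>+x. g x \<partial>lborel) = (\<integral>\<^sup>+x. g x \<partial>distr lborel borel ((+) v))" by (simp only: lborel_distr_plus)
  also have "\<dots> = (\<integral>\<^sup>+x. g (v + x) \<partial>lborel)" using assms by (intro nn_integral_distr) auto
  finally show ?thesis by (simp add: add.commute)
qed

lemma shift_diff_approx:
  fixes g h :: "'a::euclidean_space \<Rightarrow> real"
  assumes [measurable]: "g \<in> borel_measurable borel" "h \<in> borel_measurable borel"
  shows "shift_diff g v \<le> shift_diff h v + 2 * (\<integral>\<^sup>+x. ennreal \<bar>g x - h x\<bar> \<partial>lborel)"
proof -
  have "shift_diff g v \<le> (\<integral>\<^sup>+x. ennreal \<bar>h (x + v) - h x\<bar> + (ennreal \<bar>g (x + v) - h (x + v)\<bar> + ennreal \<bar>g x - h x\<bar>) \<partial>lborel)"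
    unfolding shift_diff_def by (intro nn_integral_mono) (simp add: ennreal_plus[symmetric] del: ennreal_plus)
  also have "\<dots> = shift_diff h v + ((\<integral>\<^sup>+x. ennreal \<bar>g (x + v) - h (x + v)\<bar> \<partial>lborel) + (\<integral>\<^sup>+x. ennreal \<bar>g x - h x\<bar> \<partial>lborel))"
    unfolding shift_diff_def by (simp add: nn_integral_add)
  also have "(\<integral>\<^sup>+x. ennreal \<bar>g (x + v) - h (x + v)\<bar> \<partial>lborel) = (\<integral>\<^sup>+x. ennreal \<bar>g x - h x\<bar> \<partial>lborel)"
    by (rule nn_integral_translate) measurable
  finally show ?thesis by (simp add: mult_2)
qed

text \<open>By \<open>shift_diff_approx\<close> the functions whose modulus vanishes along
  \<open>v\<close> are closed under \<open>L\<^sup>1\<close> approximation. Both the passage from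
  open to measurable sets and the limit step for integrable functions go through this.\<close>

lemma shift_diff_tendsto_approx:
  fixes g :: "'a::euclidean_space \<Rightarrow> real"
  assumes g: "g \<in> borel_measurable borel"
    and h: "\<And>e::real. e > 0 \<Longrightarrow> \<exists>h. h \<in> borel_measurable borel \<and> (\<integral>\<^sup>+x. ennreal \<bar>g x - h x\<bar> \<partial>lborel) \<le> ennreal e \<and>
      (\<lambda>n. shift_diff h (v n)) \<longlonglongrightarrow> 0"
  shows "(\<lambda>n. shift_diff g (v n)) \<longlonglongrightarrow> 0"
proof (rule tendsto_0_if_Limsup_eq_0_ennreal)
  have lims: "limsup (\<lambda>n. shift_diff g (v n)) \<le> 0 + ennreal e" if e: "0 < e" for e
  proof -
    obtain h where h: "h \<in> borel_measurable borel" "(\<integral>\<^sup>+x. ennreal \<bar>g x - h x\<bar> \<partial>lborel) \<le> ennreal (e / 2)"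
      "(\<lambda>n. shift_diff h (v n)) \<longlonglongrightarrow> 0" using h[of "e / 2"] e by auto
    have "shift_diff g (v n) \<le> shift_diff h (v n) + ennreal e" for n
    proof -
      have "2 * (\<integral>\<^sup>+x. ennreal \<bar>g x - h x\<bar> \<partial>lborel) \<le> 2 * ennreal (e / 2)" by (intro mult_left_mono h) simp
      also have "\<dots> = ennreal (2 * (e / 2))" using e by (subst ennreal_mult) auto
      finally have "2 * (\<integral>\<^sup>+x. ennreal \<bar>g x - h x\<bar> \<partial>lborel) \<le> ennreal e" by simp
      then show ?thesis by (rule order_trans[OF shift_diff_approx[OF g h(1)] add_left_mono])
    qed
    then have "limsup (\<lambda>n. shift_diff g (v n)) \<le> limsup (\<lambda>n. shift_diff h (v n) + ennreal e)"
      by (intro Limsup_mono) simp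
    also have "\<dots> = 0 + ennreal e"
      by (intro lim_imp_Limsup tendsto_add h tendsto_const) simp
    finally show ?thesis .
  qed
  have "limsup (\<lambda>n. shift_diff g (v n)) \<le> 0" by (rule ennreal_le_epsilon) (rule lims)
  then show "limsup (\<lambda>n. shift_diff g (v n)) = 0" by simp
qed

text \<open>Translation preserves the measure of \<open>U\<close>, so the mass gained equals the
  mass lost and the modulus is twice the latter. A point of the open set \<open>U\<close> stays in
  \<open>U\<close> under small shifts, and dominated convergence applies.\<close>

lemma shift_diff_open:
  fixes U :: "'a::euclidean_space set"
  assumes U: "open U" "emeasure lborel U < \<infinity>" and v: "v \<longlonglongrightarrow> 0"
  shows "(\<lambda>n. shift_diff (indicator U) (v n)) \<longlonglongrightarrow> 0"
proof -
  have [measurable]: "U \<in> sets borel" using U(1) by simp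
  have fin: "(\<integral>\<^sup>+x. indicator U x \<partial>lborel) = emeasure lborel U" by simp
  have "shift_diff (indicator U) (v n) = 2 * (\<integral>\<^sup>+x. ennreal (indicator U x - indicator U x * indicator U (x + v n)) \<partial>lborel)" for n
  proof -
    let ?I = "\<integral>\<^sup>+x. ennreal (indicator U x - indicator U x * indicator U (x + v n)) \<partial>lborel"
    have tr: "(\<integral>\<^sup>+x. indicator U (x + v n) \<partial>lborel) = emeasure lborel U"
      using nn_integral_translate[of "indicator U" "v n"] fin by simp
    \<comment> \<open>For \<open>a\<close> and \<open>b\<close> in \<open>{0, 1}\<close>, here the
      indicators at \<open>x\<close> and at \<open>x + v n\<close>, one has
      \<open>\<bar>b - a\<bar> + a = 2 * (a - a * b) + b\<close>. Adding the finite measure of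
      \<open>U\<close> and cancelling it at the end avoids subtraction in
      \<open>ennreal\<close>.\<close>
    have "shift_diff (indicator U) (v n) + emeasure lborel U =
      (\<integral>\<^sup>+x. ennreal \<bar>indicator U (x + v n) - indicator U x\<bar> + indicator U x \<partial>lborel)"
      unfolding shift_diff_def fin[symmetric] by (rule nn_integral_add[symmetric]) measurable
    also have "\<dots> = (\<integral>\<^sup>+x. 2 * ennreal (indicator U x - indicator U x * indicator U (x + v n)) + indicator U (x + v n) \<partial>lborel)"
      by (intro nn_integral_cong) (auto simp: indicator_def)
    also have "\<dots> = (\<integral>\<^sup>+x. 2 * ennreal (indicator U x - indicator U x * indicator U (x + v n)) \<partial>lborel) + (\<integral>\<^sup>+x. indicator U (x + v n) \<partial>lborel)"
      by (rule nn_integral_add) measurable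
    also have "(\<integral>\<^sup>+x. 2 * ennreal (indicator U x - indicator U x * indicator U (x + v n)) \<partial>lborel) = 2 * ?I"
      by (rule nn_integral_cmult) measurable
    finally have "emeasure lborel U + shift_diff (indicator U) (v n) = emeasure lborel U + 2 * ?I"
      unfolding tr by (simp only: add.commute)
    then show ?thesis using U(2) by (auto simp: ennreal_add_left_cancel)
  qed
  moreover have "(\<lambda>n. 2 * (\<integral>\<^sup>+x. ennreal (indicator U x - indicator U x * indicator U (x + v n)) \<partial>lborel)) \<longlonglongrightarrow> 2 * (\<integral>\<^sup>+x. 0 \<partial>(lborel :: 'a measure))"
  proof (rule ennreal_tendsto_cmult)
    show "(\<lambda>n. \<integral>\<^sup>+x. ennreal (indicator U x - indicator U x * indicator U (x + v n)) \<partial>lborel) \<longlonglongrightarrow> (\<integral>\<^sup>+x. 0 \<partial>(lborel :: 'a measure))"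
    proof (rule nn_integral_dominated_convergence[where w = "indicator U"])
      show "(\<integral>\<^sup>+x. indicator U x \<partial>lborel) < \<infinity>" unfolding fin by (rule U(2))
      show "AE x in lborel. (\<lambda>n. ennreal (indicator U x - indicator U x * indicator U (x + v n))) \<longlonglongrightarrow> 0"
      proof (rule AE_I2)
        fix x :: 'a
        show "(\<lambda>n. ennreal (indicator U x - indicator U x * indicator U (x + v n))) \<longlonglongrightarrow> 0"
        proof (cases "x \<in> U")
          case True
          have "(\<lambda>n. x + v n) \<longlonglongrightarrow> x + 0" by (intro tendsto_add tendsto_const v)
          then have "eventually (\<lambda>n. x + v n \<in> U) sequentially"
            using topological_tendstoD[OF _ U(1)] True by (metis add_0_right)
          then have "eventually (\<lambda>n. ennreal (indicator U x - indicator U x * indicator U (x + v n)) = 0) sequentially"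
            by eventually_elim (use True in simp)
          then show ?thesis by (rule tendsto_eventually)
        qed simp
      qed
    qed (auto simp: indicator_def)
  qed simp
  ultimately show ?thesis by simp
qed

text \<open>Density argument: sets of finite measure are approximated from outside by open ones, and
  the property passes to multiples, sums and \<open>L\<^sup>1\<close> limits.\<close>

lemma shift_diff_tendsto:
  fixes g :: "'a::euclidean_space \<Rightarrow> real"
  assumes g: "integrable lborel g" and v: "v \<longlonglongrightarrow> 0"
  shows "(\<lambda>n. shift_diff g (v n)) \<longlonglongrightarrow> 0"
  using g
proof (induction rule: integrable_induct)
  case (base A c)
  then have A [measurable]: "A \<in> sets borel" and fA: "emeasure lborel A < \<infinity>" by auto
  have ind: "(\<lambda>n. shift_diff (indicator A) (v n)) \<longlonglongrightarrow> 0"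
  proof (rule shift_diff_tendsto_approx)
    fix e :: real assume e: "e > 0"
    obtain U where U: "open U" "A \<subseteq> U" "emeasure lborel (U - A) < e" using outer_regular_lborel[OF A e] .
    have [measurable]: "U \<in> sets borel" using U(1) by simp
    have "emeasure lborel U = emeasure lborel (A \<union> (U - A))" using U(2) by (simp add: Un_absorb1)
    also have "\<dots> \<le> emeasure lborel A + emeasure lborel (U - A)" by (rule emeasure_subadditive) auto
    also have "\<dots> < \<infinity>" using fA U(3) by (auto simp: top.not_eq_extremum less_top intro: order_less_trans)
    finally have fU: "emeasure lborel U < \<infinity>" .
    have "(\<integral>\<^sup>+x. ennreal \<bar>indicator A x - indicator U x\<bar> \<partial>lborel) = (\<integral>\<^sup>+x. indicator (U - A) x \<partial>lborel)"
      using U(2) by (intro nn_integral_cong) (auto simp: indicator_def)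
    then have "(\<integral>\<^sup>+x. ennreal \<bar>indicator A x - indicator U x\<bar> \<partial>lborel) \<le> ennreal e" using U(3) by simp
    then show "\<exists>h. h \<in> borel_measurable borel \<and> (\<integral>\<^sup>+x. ennreal \<bar>indicator A x - h x\<bar> \<partial>lborel) \<le> ennreal e \<and>
      (\<lambda>n. shift_diff h (v n)) \<longlonglongrightarrow> 0"
      using shift_diff_open[OF U(1) fU v] by (intro exI[of _ "indicator U"]) auto
  qed measurable
  have "shift_diff (\<lambda>x. indicator A x *\<^sub>R c) w = ennreal \<bar>c\<bar> * shift_diff (indicator A) w" for w
    unfolding shift_diff_def
    by (subst nn_integral_cmult[symmetric]) (auto intro!: nn_integral_cong simp: ennreal_mult[symmetric] abs_mult[symmetric] algebra_simps)
  moreover have "(\<lambda>n. ennreal \<bar>c\<bar> * shift_diff (indicator A) (v n)) \<longlonglongrightarrow> ennreal \<bar>c\<bar> * 0"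
    by (rule ennreal_tendsto_cmult[OF _ ind]) simp
  ultimately show ?case by simp
next
  case (add g h)
  have [measurable]: "g \<in> borel_measurable borel" "h \<in> borel_measurable borel" using add by auto
  have "shift_diff (\<lambda>x. g x + h x) w \<le> shift_diff g w + shift_diff h w" for w
  proof -
    have "shift_diff (\<lambda>x. g x + h x) w \<le> (\<integral>\<^sup>+x. ennreal \<bar>g (x + w) - g x\<bar> + ennreal \<bar>h (x + w) - h x\<bar> \<partial>lborel)"
      unfolding shift_diff_def by (intro nn_integral_mono) (simp add: ennreal_plus[symmetric] del: ennreal_plus)
    then show ?thesis unfolding shift_diff_def by (simp add: nn_integral_add)
  qed
  moreover have "(\<lambda>n. shift_diff g (v n) + shift_diff h (v n)) \<longlonglongrightarrow> 0 + 0" by (intro tendsto_add add)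
  ultimately have le: "\<And>n. shift_diff (\<lambda>x. g x + h x) (v n) \<le> shift_diff g (v n) + shift_diff h (v n)"
    and lim0: "(\<lambda>n. shift_diff g (v n) + shift_diff h (v n)) \<longlonglongrightarrow> 0" by (simp_all only: add_0)
  show ?case
    by (rule tendsto_sandwich[OF always_eventually[OF allI[OF zero_le]] always_eventually[OF allI[OF le]] tendsto_const lim0])
next
  case (lim f s)
  have [measurable]: "f \<in> borel_measurable borel" "\<And>i. s i \<in> borel_measurable borel"
    using borel_measurable_integrable[OF lim.hyps(4)] borel_measurable_integrable[OF lim.hyps(1)]
    by (simp_all only: measurable_lborel2)
  show ?case
  proof (rule shift_diff_tendsto_approx)
    fix e :: real assume e: "e > 0"
    have "(\<lambda>i. (\<integral>\<^sup>+x. norm (f x - s i x) \<partial>lborel)) \<longlonglongrightarrow> 0"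
    proof (rule nn_integral_dominated_convergence_norm[where w = "\<lambda>x. 2 * norm (f x)"])
      have "integrable lborel (\<lambda>x. 2 * norm (f x))" using lim.hyps(4) by simp
      then have "(\<integral>\<^sup>+x. ennreal (norm (2 * norm (f x))) \<partial>lborel) < \<infinity>" unfolding integrable_iff_bounded by (rule conjunct2)
      moreover have "norm (2 * norm (f x)) = 2 * norm (f x)" for x by simp
      ultimately show "(\<integral>\<^sup>+x. ennreal (2 * norm (f x)) \<partial>lborel) < \<infinity>" by (simp only:)
      show "AE x in lborel. norm (s j x) \<le> 2 * norm (f x)" for j using lim.hyps(3) by simp
      show "AE x in lborel. (\<lambda>i. s i x) \<longlonglongrightarrow> f x" using lim.hyps(2) by simp
    qed simp_all
    then have "eventually (\<lambda>i. (\<integral>\<^sup>+x. norm (f x - s i x) \<partial>lborel) < ennreal e) sequentially"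
      using e by (intro order_tendstoD) auto
    then obtain i where "(\<integral>\<^sup>+x. norm (f x - s i x) \<partial>lborel) < ennreal e" by (auto simp: eventually_sequentially)
    then show "\<exists>h. h \<in> borel_measurable borel \<and> (\<integral>\<^sup>+x. ennreal \<bar>f x - h x\<bar> \<partial>lborel) \<le> ennreal e \<and>
      (\<lambda>n. shift_diff h (v n)) \<longlonglongrightarrow> 0"
      using lim.IH[of i] by (intro exI[of _ "s i"]) auto
  qed measurable
qed

section \<open>Rescaled probability of an empty simplex\<close>

lemma nn_integral_lborel_affine:
  fixes v :: "'a::euclidean_space"
  assumes g [measurable]: "g \<in> borel_measurable borel" and r: "r > 0"
  shows "(\<integral>\<^sup>+x. g x \<partial>lborel) = ennreal (r ^ DIM('a)) * (\<integral>\<^sup>+x. g (v + r *\<^sub>R x) \<partial>lborel)"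
proof -
  have "(\<integral>\<^sup>+x. g x \<partial>lborel) = (\<integral>\<^sup>+x. g x \<partial>density (distr lborel borel (\<lambda>x. v + r *\<^sub>R x)) (\<lambda>_. \<bar>r\<bar> ^ DIM('a)))"
    using lborel_affine[of r v] r by simp
  also have "\<dots> = (\<integral>\<^sup>+x. ennreal (r ^ DIM('a)) * g x \<partial>distr lborel borel (\<lambda>x. v + r *\<^sub>R x))"
    using r by (subst nn_integral_density) auto
  also have "\<dots> = ennreal (r ^ DIM('a)) * (\<integral>\<^sup>+x. g (v + r *\<^sub>R x) \<partial>lborel)"
    by (simp add: nn_integral_cmult nn_integral_distr)
  finally show ?thesis .
qed

interpretation lborel_prod: product_sigma_finite "\<lambda>_. lborel :: 'a::euclidean_space measure"
  by standard

text \<open>One coordinate at a time, each contributing the Jacobian \<open>r ^ DIM('a)\<close> of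
  the affine map in a single factor.\<close>

lemma nn_integral_PiM_affine:
  fixes v :: "'a::euclidean_space"
  assumes I: "finite I" and r: "r > 0" and h: "h \<in> borel_measurable (PiM I (\<lambda>_. lborel :: 'a measure))"
  shows "(\<integral>\<^sup>+x. h x \<partial>PiM I (\<lambda>_. lborel)) =
    ennreal (r ^ (DIM('a) * card I)) * (\<integral>\<^sup>+z. h (\<lambda>j\<in>I. v + r *\<^sub>R z j) \<partial>PiM I (\<lambda>_. lborel))"
  using I h
proof (induction I arbitrary: h rule: finite_induct)
  case empty
  show ?case by (simp add: PiM_empty nn_integral_count_space_finite)
next
  case (insert i I)
  let ?P = "PiM I (\<lambda>_. lborel :: 'a measure)" and ?Q = "PiM (insert i I) (\<lambda>_. lborel :: 'a measure)"
  note h [measurable] = insert.prems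
  have m_upd: "(\<lambda>(x, y). x(i := y)) \<in> measurable (?P \<Otimes>\<^sub>M lborel) ?Q" by (rule measurable_add_dim)
  have m2 [measurable]: "(\<lambda>(x, y). h (x(i := y))) \<in> borel_measurable (?P \<Otimes>\<^sub>M lborel)"
    using measurable_compose[OF m_upd h] by (simp add: case_prod_beta')
  have maff [measurable]: "(\<lambda>z. \<lambda>j\<in>L. v + r *\<^sub>R z j) \<in> measurable (PiM L (\<lambda>_. lborel)) (PiM L (\<lambda>_. lborel :: 'a measure))" for L :: "'b set"
  proof (rule measurable_restrict)
    fix j assume "j \<in> L"
    then have [measurable]: "(\<lambda>z. z j) \<in> borel_measurable (PiM L (\<lambda>_. lborel :: 'a measure))"
      using measurable_component_singleton[of j L "\<lambda>_. lborel :: 'a measure"] by simp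
    show "(\<lambda>z. v + r *\<^sub>R z j) \<in> measurable (PiM L (\<lambda>_. lborel)) lborel" by simp
  qed
  have upd: "(\<lambda>j\<in>I. v + r *\<^sub>R z j)(i := v + r *\<^sub>R y) = (\<lambda>j\<in>insert i I. v + r *\<^sub>R (z(i := y)) j)" for z y
    using insert.hyps by (auto simp: fun_eq_iff restrict_def)
  have "(\<integral>\<^sup>+x. h x \<partial>?Q) = (\<integral>\<^sup>+x. (\<integral>\<^sup>+y. h (x(i := y)) \<partial>lborel) \<partial>?P)"
    by (rule lborel_prod.product_nn_integral_insert[OF insert.hyps h])
  also have "\<dots> = ennreal (r ^ (DIM('a) * card I)) * (\<integral>\<^sup>+z. (\<integral>\<^sup>+y. h ((\<lambda>j\<in>I. v + r *\<^sub>R z j)(i := y)) \<partial>lborel) \<partial>?P)"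
    by (rule insert.IH) (rule lborel.borel_measurable_nn_integral[OF m2])
  also have "(\<integral>\<^sup>+z. (\<integral>\<^sup>+y. h ((\<lambda>j\<in>I. v + r *\<^sub>R z j)(i := y)) \<partial>lborel) \<partial>?P) =
    (\<integral>\<^sup>+z. ennreal (r ^ DIM('a)) * (\<integral>\<^sup>+y. h (\<lambda>j\<in>insert i I. v + r *\<^sub>R (z(i := y)) j) \<partial>lborel) \<partial>?P)"
  proof (rule nn_integral_cong)
    fix z assume z: "z \<in> space ?P"
    have "(\<lambda>j\<in>I. v + r *\<^sub>R z j) \<in> space ?P" by (simp add: space_PiM)
    then have "(\<lambda>y. h ((\<lambda>j\<in>I. v + r *\<^sub>R z j)(i := y))) \<in> borel_measurable borel"
      using measurable_Pair2[OF m2] by simp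
    from nn_integral_lborel_affine[OF this r, of v]
    show "(\<integral>\<^sup>+y. h ((\<lambda>j\<in>I. v + r *\<^sub>R z j)(i := y)) \<partial>lborel) =
      ennreal (r ^ DIM('a)) * (\<integral>\<^sup>+y. h (\<lambda>j\<in>insert i I. v + r *\<^sub>R (z(i := y)) j) \<partial>lborel)"
      by (simp only: upd)
  qed
  also have "\<dots> = ennreal (r ^ DIM('a)) * (\<integral>\<^sup>+z. (\<integral>\<^sup>+y. h (\<lambda>j\<in>insert i I. v + r *\<^sub>R (z(i := y)) j) \<partial>lborel) \<partial>?P)"
  proof (rule nn_integral_cmult)
    have hm: "(\<lambda>z. h (\<lambda>j\<in>insert i I. v + r *\<^sub>R z j)) \<in> borel_measurable ?Q"
      by (rule measurable_compose[OF maff h])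
    have "(\<lambda>(x, y). h (\<lambda>j\<in>insert i I. v + r *\<^sub>R (x(i := y)) j)) \<in> borel_measurable (?P \<Otimes>\<^sub>M lborel)"
      using measurable_compose[OF m_upd hm] by (simp add: case_prod_beta')
    then show "(\<lambda>z. \<integral>\<^sup>+y. h (\<lambda>j\<in>insert i I. v + r *\<^sub>R (z(i := y)) j) \<partial>lborel) \<in> borel_measurable ?P"
      by (rule lborel.borel_measurable_nn_integral)
  qed
  also have "(\<integral>\<^sup>+z. (\<integral>\<^sup>+y. h (\<lambda>j\<in>insert i I. v + r *\<^sub>R (z(i := y)) j) \<partial>lborel) \<partial>?P) =
    (\<integral>\<^sup>+z. h (\<lambda>j\<in>insert i I. v + r *\<^sub>R z j) \<partial>?Q)"
    by (rule lborel_prod.product_nn_integral_insert[OF insert.hyps measurable_compose[OF maff h], symmetric])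
  finally have eq: "(\<integral>\<^sup>+x. h x \<partial>?Q) = ennreal (r ^ (DIM('a) * card I)) *
    (ennreal (r ^ DIM('a)) * (\<integral>\<^sup>+z. h (\<lambda>j\<in>insert i I. v + r *\<^sub>R z j) \<partial>?Q))" .
  have "ennreal (r ^ (DIM('a) * card I)) * ennreal (r ^ DIM('a)) = ennreal (r ^ (DIM('a) * card (insert i I)))"
    using insert.hyps r by (subst ennreal_mult[symmetric]) (simp_all add: power_add mult.commute)
  then show ?case unfolding eq mult.assoc[symmetric] by (simp only:)
qed

text \<open>Induction over the coordinates; \<open>F\<close> being a probability density makes the
  factors on the left sigma-finite, as the insertion rule for product integrals demands.\<close>

lemma nn_integral_PiM_density:
  fixes F :: "'a::euclidean_space \<Rightarrow> ennreal"
  assumes I: "finite I" and F [measurable]: "F \<in> borel_measurable borel" and D: "prob_space (density lborel F)"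
    and h: "h \<in> borel_measurable (PiM I (\<lambda>_. lborel :: 'a measure))"
  shows "(\<integral>\<^sup>+x. h x \<partial>PiM I (\<lambda>_. density lborel F)) = (\<integral>\<^sup>+x. (\<Prod>i\<in>I. F (x i)) * h x \<partial>PiM I (\<lambda>_. lborel))"
  using I h
proof (induction I arbitrary: h rule: finite_induct)
  case empty
  show ?case by (simp add: PiM_empty nn_integral_count_space_finite)
next
  case (insert i I)
  let ?P = "PiM I (\<lambda>_. lborel :: 'a measure)" and ?Q = "PiM (insert i I) (\<lambda>_. lborel :: 'a measure)"
  note h [measurable] = insert.prems
  interpret D: prob_space "density lborel F" by (rule D)
  interpret DP: product_sigma_finite "\<lambda>_. density lborel F" by (simp add: product_sigma_finite_def D.sigma_finite_measure_axioms)
  have m_upd: "(\<lambda>(x, y). x(i := y)) \<in> measurable (?P \<Otimes>\<^sub>M lborel) ?Q" by (rule measurable_add_dim)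
  have m2 [measurable]: "(\<lambda>(x, y). h (x(i := y))) \<in> borel_measurable (?P \<Otimes>\<^sub>M lborel)"
    using measurable_compose[OF m_upd h] by (simp add: case_prod_beta')
  have m1: "(\<lambda>y. h (x(i := y))) \<in> borel_measurable borel" if "x \<in> space ?P" for x
    using measurable_Pair2[OF m2 that] by simp
  have FP [measurable]: "(\<lambda>x. \<Prod>i\<in>L. F (x i)) \<in> borel_measurable (PiM L (\<lambda>_. lborel :: 'a measure))" for L :: "'b set"
  proof (rule borel_measurable_prod_ennreal)
    fix j assume "j \<in> L"
    then have "(\<lambda>z. z j) \<in> borel_measurable (PiM L (\<lambda>_. lborel :: 'a measure))"
      using measurable_component_singleton[of j L "\<lambda>_. lborel :: 'a measure"] by simp
    then show "(\<lambda>x. F (x j)) \<in> borel_measurable (PiM L (\<lambda>_. lborel :: 'a measure))" by measurable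
  qed
  have sets: "sets (PiM L (\<lambda>_. density lborel F)) = sets (PiM L (\<lambda>_. lborel :: 'a measure))" for L :: "'b set"
    by (rule sets_PiM_cong) auto
  have hD: "h \<in> borel_measurable (PiM (insert i I) (\<lambda>_. density lborel F))"
    using h by (simp cong: measurable_cong_sets add: sets)
  have "(\<integral>\<^sup>+x. h x \<partial>PiM (insert i I) (\<lambda>_. density lborel F)) =
    (\<integral>\<^sup>+x. (\<integral>\<^sup>+y. h (x(i := y)) \<partial>density lborel F) \<partial>PiM I (\<lambda>_. density lborel F))"
    by (rule DP.product_nn_integral_insert[OF insert.hyps hD])
  also have "\<dots> = (\<integral>\<^sup>+x. (\<integral>\<^sup>+y. F y * h (x(i := y)) \<partial>lborel) \<partial>PiM I (\<lambda>_. density lborel F))"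
  proof (rule nn_integral_cong)
    fix x assume "x \<in> space (PiM I (\<lambda>_. density lborel F))"
    then have "x \<in> space ?P" by (simp add: space_PiM)
    then show "(\<integral>\<^sup>+y. h (x(i := y)) \<partial>density lborel F) = (\<integral>\<^sup>+y. F y * h (x(i := y)) \<partial>lborel)"
      using m1 by (intro nn_integral_density) auto
  qed
  also have "\<dots> = (\<integral>\<^sup>+x. (\<Prod>i\<in>I. F (x i)) * (\<integral>\<^sup>+y. F y * h (x(i := y)) \<partial>lborel) \<partial>?P)"
    by (rule insert.IH) measurable
  also have "\<dots> = (\<integral>\<^sup>+x. (\<integral>\<^sup>+y. (\<Prod>j\<in>insert i I. F ((x(i := y)) j)) * h (x(i := y)) \<partial>lborel) \<partial>?P)"
  proof (rule nn_integral_cong)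
    fix x assume x: "x \<in> space ?P"
    have pr: "(\<Prod>j\<in>insert i I. F ((x(i := y)) j)) = (\<Prod>i\<in>I. F (x i)) * F y" for y
    proof -
      have "(\<Prod>j\<in>I. F ((x(i := y)) j)) = (\<Prod>i\<in>I. F (x i))"
        using insert.hyps(2) by (intro prod.cong refl) auto
      then show ?thesis unfolding prod.insert[OF insert.hyps] by (simp add: mult.commute)
    qed
    show "(\<Prod>i\<in>I. F (x i)) * (\<integral>\<^sup>+y. F y * h (x(i := y)) \<partial>lborel) =
      (\<integral>\<^sup>+y. (\<Prod>j\<in>insert i I. F ((x(i := y)) j)) * h (x(i := y)) \<partial>lborel)"
    proof -
      have [measurable]: "(\<lambda>y. h (x(i := y))) \<in> borel_measurable borel" by (rule m1[OF x])
      have "(\<lambda>y. F y * h (x(i := y))) \<in> borel_measurable lborel" by simp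
      from nn_integral_cmult[OF this, of "\<Prod>i\<in>I. F (x i)"] show ?thesis
        unfolding pr mult.assoc by (rule sym)
    qed
  qed
  also have "\<dots> = (\<integral>\<^sup>+x. (\<Prod>i\<in>insert i I. F (x i)) * h x \<partial>?Q)"
  proof -
    have "(\<lambda>x. (\<Prod>i\<in>insert i I. F (x i)) * h x) \<in> borel_measurable ?Q"
      by (intro borel_measurable_times_ennreal FP h)
    from lborel_prod.product_nn_integral_insert[OF insert.hyps this] show ?thesis by (rule sym)
  qed
  finally show ?case .
qed

text \<open>Intersection patterns of balls are invariant under translation and under simultaneous
  dilation of centres and radius. The relation between \<open>x\<close> and \<open>z\<close> is
  asked on \<open>\<alpha>\<close> only, so configurations patched by a pinned point
  qualify.\<close>

lemma idx_empty_scale: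
  fixes z :: "'i \<Rightarrow> 'a::euclidean_space"
  assumes r: "r > 0" and x: "\<And>j. j \<in> \<alpha> \<Longrightarrow> x j = v + r *\<^sub>R z j"
  shows "idx_empty r x \<alpha> \<longleftrightarrow> idx_empty 1 z \<alpha>"
proof -
  have c: "v + r *\<^sub>R q \<in> cball (v + r *\<^sub>R p) r \<longleftrightarrow> q \<in> cball p 1" for p q :: 'a
  proof -
    have "dist (v + r *\<^sub>R p) (v + r *\<^sub>R q) = r * dist p q"
      using r by (simp add: dist_norm scaleR_diff_right[symmetric])
    then show ?thesis using r by simp
  qed
  have "(\<Inter>j\<in>\<tau>. cball (x j) r) \<noteq> {} \<longleftrightarrow> (\<Inter>j\<in>\<tau>. cball (z j) 1) \<noteq> {}" if "\<tau> \<subseteq> \<alpha>" for \<tau>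
  proof
    assume "(\<Inter>j\<in>\<tau>. cball (x j) r) \<noteq> {}"
    then obtain p where p: "\<And>j. j \<in> \<tau> \<Longrightarrow> p \<in> cball (x j) r" by blast
    have "p = v + r *\<^sub>R ((1 / r) *\<^sub>R (p - v))" using r by simp
    then have "(1 / r) *\<^sub>R (p - v) \<in> cball (z j) 1" if "j \<in> \<tau>" for j
      using p[OF that] x[of j] c[of "(1 / r) *\<^sub>R (p - v)" "z j"] that \<open>\<tau> \<subseteq> \<alpha>\<close> by auto
    then show "(\<Inter>j\<in>\<tau>. cball (z j) 1) \<noteq> {}" by blast
  next
    assume "(\<Inter>j\<in>\<tau>. cball (z j) 1) \<noteq> {}"
    then obtain q where q: "\<And>j. j \<in> \<tau> \<Longrightarrow> q \<in> cball (z j) 1" by blast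
    have "v + r *\<^sub>R q \<in> cball (x j) r" if "j \<in> \<tau>" for j
      using q[OF that] x[of j] c[of q "z j"] that \<open>\<tau> \<subseteq> \<alpha>\<close> by auto
    then show "(\<Inter>j\<in>\<tau>. cball (x j) r) \<noteq> {}" by blast
  qed
  then have *: "(\<Inter>j\<in>\<tau>. cball (x j) r) = {} \<longleftrightarrow> (\<Inter>j\<in>\<tau>. cball (z j) 1) = {}" if "\<tau> \<subseteq> \<alpha>" for \<tau>
    using that by blast
  show ?thesis unfolding idx_empty_def using *[OF order_refl] *[OF Diff_subset] by simp
qed

lemma measurable_indicator_Collect:
  assumes [measurable]: "Measurable.pred N P"
  shows "(indicator {x. P x} :: 'b \<Rightarrow> ennreal) \<in> borel_measurable N"
proof -
  have "(indicator {x. P x} :: 'b \<Rightarrow> ennreal) = (\<lambda>x. if P x then 1 else 0)" by (auto simp: indicator_def)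
  then show ?thesis by simp
qed

context iid_sample
begin

lemma density_prob_space: "prob_space (density lborel (\<lambda>x. ennreal (f x)))"
  by (rule prob_space_density[of "{1}" 1 1]) auto

lemma nn_integral_f: "(\<integral>\<^sup>+x. ennreal (f x) \<partial>lborel) = 1"
  using prob_space.emeasure_space_1[OF density_prob_space] by (simp add: emeasure_density)

lemma integrable_f: "integrable lborel f"
  using nn_integral_f f_nonneg by (simp add: integrable_iff_bounded)

lemma emeasure_idx_empty:
  assumes \<alpha>: "finite \<alpha>" "\<alpha> \<subseteq> {1..}" "\<alpha> \<noteq> {}"
  shows "emeasure M {\<omega> \<in> space M. idx_empty r (\<lambda>j. X j \<omega>) \<alpha>} =
    (\<integral>\<^sup>+x. indicator {x. idx_empty r x \<alpha>} x \<partial>PiM \<alpha> (\<lambda>_. density lborel (\<lambda>x. ennreal (f x))))"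
proof -
  let ?N = "PiM \<alpha> (\<lambda>_. borel :: 'a measure)" and ?Y = "\<lambda>\<omega>. \<lambda>j\<in>\<alpha>. X j \<omega>"
  let ?A = "{x \<in> space ?N. idx_empty r x \<alpha>}"
  have Y: "?Y \<in> measurable M ?N" using X_measurable \<alpha> by (intro measurable_restrict) auto
  have "Measurable.pred ?N (\<lambda>x. idx_empty r (\<lambda>j. x j) \<alpha>)"
    using \<alpha> by (intro measurable_idx_empty measurable_component_singleton) auto
  then have A: "?A \<in> sets ?N" by (simp add: pred_def)
  have dist: "distr M ?N ?Y = PiM \<alpha> (\<lambda>_. density lborel (\<lambda>x. ennreal (f x)))"
    by (rule distr_sample[where r = 1 and k = 1]) (use \<alpha> in auto)
  have "{\<omega> \<in> space M. idx_empty r (\<lambda>j. X j \<omega>) \<alpha>} = ?Y -` ?A \<inter> space M"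
  proof -
    have "idx_empty r (?Y \<omega>) \<alpha> = idx_empty r (\<lambda>j. X j \<omega>) \<alpha>" for \<omega> by (rule idx_empty_cong) simp
    then show ?thesis by (auto simp: space_PiM)
  qed
  then have "emeasure M {\<omega> \<in> space M. idx_empty r (\<lambda>j. X j \<omega>) \<alpha>} = emeasure (distr M ?N ?Y) ?A"
    using emeasure_distr[OF Y A] by simp
  also have "\<dots> = (\<integral>\<^sup>+x. indicator ?A x \<partial>distr M ?N ?Y)" using A by simp
  also have "\<dots> = (\<integral>\<^sup>+x. indicator {x. idx_empty r x \<alpha>} x \<partial>distr M ?N ?Y)"
    by (intro nn_integral_cong) (auto simp: indicator_def)
  finally show ?thesis unfolding dist .
qed

text \<open>Exchangeability: a bijection of the index sets carries one product law to the other. It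
  allows the mean count to be written with the single probability for
  \<open>{1..k + 2}\<close>.\<close>

lemma prob_idx_empty_eq:
  assumes \<alpha>: "finite \<alpha>" "\<alpha> \<subseteq> {1..}" "\<alpha> \<noteq> {}" and \<beta>: "finite \<beta>" "\<beta> \<subseteq> {1..}" and c: "card \<alpha> = card \<beta>"
  shows "prob {\<omega> \<in> space M. idx_empty r (\<lambda>j. X j \<omega>) \<alpha>} = prob {\<omega> \<in> space M. idx_empty r (\<lambda>j. X j \<omega>) \<beta>}"
proof -
  let ?D = "density lborel (\<lambda>x. ennreal (f x))"
  have \<beta>0: "\<beta> \<noteq> {}" using \<alpha> \<beta> c by auto
  obtain b where b: "bij_betw b \<beta> \<alpha>" using finite_same_card_bij[OF \<beta>(1) \<alpha>(1)] c by auto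
  let ?t = "\<lambda>x. \<lambda>n\<in>\<beta>. x (b n)"
  have t: "distr (PiM \<alpha> (\<lambda>_. ?D)) (PiM \<beta> (\<lambda>_. ?D)) ?t = PiM \<beta> (\<lambda>_. ?D)"
    using distr_PiM_reindex[of \<alpha> "\<lambda>_. ?D" b \<beta>] density_prob_space b by (auto simp: bij_betw_def)
  have tm: "?t \<in> measurable (PiM \<alpha> (\<lambda>_. ?D)) (PiM \<beta> (\<lambda>_. ?D))"
    using b by (intro measurable_restrict measurable_component_singleton) (auto simp: bij_betw_def)
  have m: "(indicator {x. idx_empty r x \<beta>} :: _ \<Rightarrow> ennreal) \<in> borel_measurable (PiM \<beta> (\<lambda>_. ?D))"
  proof -
    have "Measurable.pred (PiM \<beta> (\<lambda>_. ?D)) (\<lambda>x. idx_empty r (\<lambda>j. x j) \<beta>)"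
      using \<beta> measurable_component_singleton[of _ \<beta> "\<lambda>_. ?D"] by (intro measurable_idx_empty) auto
    then show ?thesis by (rule measurable_indicator_Collect)
  qed
  have "(\<integral>\<^sup>+x. indicator {x. idx_empty r x \<beta>} x \<partial>PiM \<beta> (\<lambda>_. ?D)) =
    (\<integral>\<^sup>+x. indicator {x. idx_empty r x \<beta>} (?t x) \<partial>PiM \<alpha> (\<lambda>_. ?D))"
    by (subst t[symmetric], rule nn_integral_distr[OF tm]) (use m in simp)
  also have "\<dots> = (\<integral>\<^sup>+x. indicator {x. idx_empty r x \<alpha>} x \<partial>PiM \<alpha> (\<lambda>_. ?D))"
  proof (rule nn_integral_cong)
    fix x :: "nat \<Rightarrow> 'a"
    have im: "b ` \<beta> = \<alpha>" and inj: "inj_on b \<beta>" using b by (auto simp: bij_betw_def)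
    have 1: "(\<Inter>j\<in>\<beta>. cball (?t x j) r) = (\<Inter>i\<in>\<alpha>. cball (x i) r)" unfolding im[symmetric] by auto
    have 2: "(\<Inter>j\<in>\<beta> - {i}. cball (?t x j) r) = (\<Inter>i\<in>\<alpha> - {b i}. cball (x i) r)" if "i \<in> \<beta>" for i
    proof -
      have "\<alpha> - {b i} = b ` (\<beta> - {i})" using inj_on_image_set_diff[OF inj, of \<beta> "{i}"] that im by auto
      then show ?thesis by auto
    qed
    have "idx_empty r (?t x) \<beta> = idx_empty r x \<alpha>"
    proof -
      have "(\<forall>i\<in>\<beta>. (\<Inter>j\<in>\<beta> - {i}. cball (?t x j) r) \<noteq> {}) \<longleftrightarrow> (\<forall>i\<in>\<beta>. (\<Inter>j\<in>\<alpha> - {b i}. cball (x j) r) \<noteq> {})"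
        by (rule ball_cong[OF refl]) (simp only: 2)
      also have "\<dots> \<longleftrightarrow> (\<forall>i\<in>b ` \<beta>. (\<Inter>j\<in>\<alpha> - {i}. cball (x j) r) \<noteq> {})" by blast
      finally show ?thesis unfolding idx_empty_def 1 im by (simp only:)
    qed
    then show "indicator {x. idx_empty r x \<beta>} (?t x) = (indicator {x. idx_empty r x \<alpha>} x :: ennreal)"
      by (simp add: indicator_def)
  qed
  finally have "emeasure M {\<omega> \<in> space M. idx_empty r (\<lambda>j. X j \<omega>) \<alpha>} = emeasure M {\<omega> \<in> space M. idx_empty r (\<lambda>j. X j \<omega>) \<beta>}"
    unfolding emeasure_idx_empty[OF \<alpha>] emeasure_idx_empty[OF \<beta> \<beta>0] by simp
  then show ?thesis by (simp add: measure_def)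
qed

text \<open>Density of a cluster of shape \<open>z\<close> and size \<open>t\<close>: with the
  reference point at \<open>y\<close> the others sit at \<open>y + t *\<^sub>R z j\<close>, and
  \<open>y\<close> is integrated out. At \<open>t = 0\<close> this is the integral of
  \<open>f ^ (card L + 1)\<close> when \<open>L\<close> is finite.\<close>

definition shifted_mass :: "nat set \<Rightarrow> real \<Rightarrow> (nat \<Rightarrow> 'a) \<Rightarrow> ennreal" where
  "shifted_mass L t z = (\<integral>\<^sup>+y. ennreal (f y * (\<Prod>j\<in>L. f (y + t *\<^sub>R z j))) \<partial>lborel)"

lemma prod_f_bounds: "0 \<le> (\<Prod>j\<in>L. f (g j))" "(\<Prod>j\<in>L. f (g j)) \<le> B ^ card L"
proof -
  show "0 \<le> (\<Prod>j\<in>L. f (g j))" using f_nonneg by (intro prod_nonneg) auto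
  have "(\<Prod>j\<in>L. f (g j)) \<le> (\<Prod>j\<in>L. B)" using f_nonneg f_le by (intro prod_mono) auto
  then show "(\<Prod>j\<in>L. f (g j)) \<le> B ^ card L" by simp
qed

lemma shifted_mass_le: "shifted_mass L t z \<le> ennreal (B ^ card L)"
proof -
  have "shifted_mass L t z \<le> (\<integral>\<^sup>+y. ennreal (B ^ card L) * ennreal (f y) \<partial>lborel)"
    unfolding shifted_mass_def
  proof (rule nn_integral_mono)
    fix y
    have "f y * (\<Prod>j\<in>L. f (y + t *\<^sub>R z j)) \<le> f y * B ^ card L" by (intro mult_left_mono prod_f_bounds f_nonneg)
    then show "ennreal (f y * (\<Prod>j\<in>L. f (y + t *\<^sub>R z j))) \<le> ennreal (B ^ card L) * ennreal (f y)"
      using B_nonneg f_nonneg by (simp add: ennreal_mult[symmetric] mult.commute ennreal_leI)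
  qed
  also have "\<dots> = ennreal (B ^ card L)" by (simp add: nn_integral_cmult nn_integral_f)
  finally show ?thesis .
qed

text \<open>Replacing the factors one by one bounds the difference of products by a sum of
  differences \<open>\<bar>f (y + t *\<^sub>R z j) - f y\<bar>\<close>, whose integrals vanish by
  \<open>shift_diff_tendsto\<close>. As \<open>f\<close> is merely measurable, convergence is
  obtained after integration over \<open>y\<close> and not pointwise in \<open>y\<close>.\<close>

lemma shifted_mass_tendsto:
  assumes \<rho>: "\<rho> \<longlonglongrightarrow> 0"
  shows "(\<lambda>n. shifted_mass L (\<rho> n) z) \<longlonglongrightarrow> shifted_mass L 0 z"
proof -
  \<comment> \<open>\<open>norm_prod_diff\<close> asks for factors of norm at most 1, so
    \<open>f\<close> is divided by \<open>C\<close>; the summand 1 makes \<open>C\<close> positive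
    given only \<open>B \<ge> 0\<close>.\<close>
  define C where "C = B + 1"
  have C: "C > 0" "\<And>x. f x / C \<le> 1" "\<And>x. 0 \<le> f x / C"
    using B_nonneg f_le f_nonneg by (auto simp: C_def divide_le_eq add_nonneg_pos intro: order_trans[OF f_le])
  define \<phi> where "\<phi> t y = f y * (\<Prod>j\<in>L. f (y + t *\<^sub>R z j))" for t y
  have \<phi>m [measurable]: "\<phi> t \<in> borel_measurable borel" for t unfolding \<phi>_def by measurable
  have \<phi>0: "0 \<le> \<phi> t y" for t y unfolding \<phi>_def by (rule mult_nonneg_nonneg[OF f_nonneg prod_f_bounds(1)])
  have int: "integrable lborel (\<phi> t)" for t
  proof (rule Bochner_Integration.integrable_bound[of lborel "\<lambda>y. B ^ card L * f y"])
    show "integrable lborel (\<lambda>y. B ^ card L * f y)" using integrable_f by simp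
    show "AE y in lborel. norm (\<phi> t y) \<le> norm (B ^ card L * f y)"
    proof (rule AE_I2)
      fix y
      have "\<phi> t y \<le> f y * B ^ card L" unfolding \<phi>_def by (intro mult_left_mono prod_f_bounds f_nonneg)
      then show "norm (\<phi> t y) \<le> norm (B ^ card L * f y)" using \<phi>0[of t y] by (simp add: mult.commute)
    qed
  qed simp
  have eq: "shifted_mass L t z = ennreal (\<integral>y. \<phi> t y \<partial>lborel)" for t
    unfolding shifted_mass_def \<phi>_def[symmetric] using int \<phi>0 by (intro nn_integral_eq_integral) auto
  have diff: "\<bar>\<phi> t y - \<phi> 0 y\<bar> \<le> C ^ card L * (\<Sum>j\<in>L. \<bar>f (y + t *\<^sub>R z j) - f y\<bar>)" for t y
  proof -
    have "\<phi> t y - \<phi> 0 y = f y * C ^ card L * ((\<Prod>j\<in>L. f (y + t *\<^sub>R z j) / C) - (\<Prod>j\<in>L. f y / C))"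
      using C(1) by (simp add: \<phi>_def prod_dividef power_divide right_diff_distrib)
    then have "\<bar>\<phi> t y - \<phi> 0 y\<bar> = f y * C ^ card L * \<bar>(\<Prod>j\<in>L. f (y + t *\<^sub>R z j) / C) - (\<Prod>j\<in>L. f y / C)\<bar>"
      using C(1) f_nonneg[of y] by (simp add: abs_mult)
    also have "\<dots> \<le> f y * C ^ card L * (\<Sum>j\<in>L. \<bar>f (y + t *\<^sub>R z j) / C - f y / C\<bar>)"
    proof (rule mult_left_mono)
      have "norm (f x / C) \<le> 1" for x unfolding real_norm_def abs_of_nonneg[OF C(3)] by (rule C(2))
      then have "norm ((\<Prod>j\<in>L. f (y + t *\<^sub>R z j) / C) - (\<Prod>j\<in>L. f y / C)) \<le> (\<Sum>j\<in>L. norm (f (y + t *\<^sub>R z j) / C - f y / C))"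
        by (intro norm_prod_diff)
      then show "\<bar>(\<Prod>j\<in>L. f (y + t *\<^sub>R z j) / C) - (\<Prod>j\<in>L. f y / C)\<bar> \<le> (\<Sum>j\<in>L. \<bar>f (y + t *\<^sub>R z j) / C - f y / C\<bar>)"
        by (simp only: real_norm_def)
    qed (use C f_nonneg in simp)
    also have "\<dots> = C ^ card L * ((f y / C) * (\<Sum>j\<in>L. \<bar>f (y + t *\<^sub>R z j) - f y\<bar>))"
      using C(1) by (simp add: diff_divide_distrib[symmetric] abs_divide sum_divide_distrib[symmetric])
    also have "\<dots> \<le> C ^ card L * (1 * (\<Sum>j\<in>L. \<bar>f (y + t *\<^sub>R z j) - f y\<bar>))"
      using C by (intro mult_left_mono mult_right_mono sum_nonneg) auto
    finally show ?thesis by simp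
  qed
  have "ennreal \<bar>(\<integral>y. \<phi> t y \<partial>lborel) - (\<integral>y. \<phi> 0 y \<partial>lborel)\<bar> \<le> ennreal (C ^ card L) * (\<Sum>j\<in>L. shift_diff f (t *\<^sub>R z j))" for t
  proof -
    have "ennreal \<bar>(\<integral>y. \<phi> t y \<partial>lborel) - (\<integral>y. \<phi> 0 y \<partial>lborel)\<bar> = ennreal (norm (\<integral>y. \<phi> t y - \<phi> 0 y \<partial>lborel))"
      using int by simp
    also have "\<dots> \<le> (\<integral>\<^sup>+y. ennreal (norm (\<phi> t y - \<phi> 0 y)) \<partial>lborel)"
      using int by (intro integral_norm_bound_ennreal) auto
    also have "\<dots> \<le> (\<integral>\<^sup>+y. ennreal (C ^ card L) * (\<Sum>j\<in>L. ennreal \<bar>f (y + t *\<^sub>R z j) - f y\<bar>) \<partial>lborel)"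
      using diff C(1) by (intro nn_integral_mono) (simp add: sum_ennreal ennreal_mult[symmetric] sum_nonneg ennreal_leI)
    also have "\<dots> = ennreal (C ^ card L) * (\<Sum>j\<in>L. shift_diff f (t *\<^sub>R z j))"
    proof -
      have m: "(\<lambda>y. ennreal \<bar>f (y + t *\<^sub>R z j) - f y\<bar>) \<in> borel_measurable lborel" for j by simp
      show ?thesis unfolding shift_diff_def
        by (subst nn_integral_cmult[OF borel_measurable_sum[OF m]], subst nn_integral_sum[OF m], rule refl)
    qed
    finally show ?thesis .
  qed
  moreover have "(\<lambda>n. ennreal (C ^ card L) * (\<Sum>j\<in>L. shift_diff f (\<rho> n *\<^sub>R z j))) \<longlonglongrightarrow> ennreal (C ^ card L) * (\<Sum>j\<in>L. 0)"
  proof (intro ennreal_tendsto_cmult tendsto_sum shift_diff_tendsto[OF integrable_f])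
    fix j
    have "(\<lambda>n. \<rho> n *\<^sub>R z j) \<longlonglongrightarrow> 0 *\<^sub>R z j" by (intro tendsto_scaleR \<rho> tendsto_const)
    then show "(\<lambda>n. \<rho> n *\<^sub>R z j) \<longlonglongrightarrow> 0" by simp
  qed simp
  then have lim0: "(\<lambda>n. ennreal (C ^ card L) * (\<Sum>j\<in>L. shift_diff f (\<rho> n *\<^sub>R z j))) \<longlonglongrightarrow> 0" by simp
  ultimately have "(\<lambda>n. ennreal \<bar>(\<integral>y. \<phi> (\<rho> n) y \<partial>lborel) - (\<integral>y. \<phi> 0 y \<partial>lborel)\<bar>) \<longlonglongrightarrow> 0"
    by (intro tendsto_sandwich[OF always_eventually[OF allI[OF zero_le]] always_eventually tendsto_const lim0]) blast
  then have "(\<lambda>n. \<bar>(\<integral>y. \<phi> (\<rho> n) y \<partial>lborel) - (\<integral>y. \<phi> 0 y \<partial>lborel)\<bar>) \<longlonglongrightarrow> 0"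
    by (subst (asm) ennreal_0[symmetric], subst (asm) tendsto_ennreal_iff) auto
  then have "(\<lambda>n. (\<integral>y. \<phi> (\<rho> n) y \<partial>lborel)) \<longlonglongrightarrow> (\<integral>y. \<phi> 0 y \<partial>lborel)"
    by (simp add: tendsto_rabs_zero_iff LIM_zero_iff)
  then show ?thesis unfolding eq by (rule tendsto_ennrealI)
qed

text \<open>The rescaled probability at scale \<open>t\<close>. Index 1 is the reference point,
  pinned at the origin by \<open>z(1 := 0)\<close>, and integration runs over the relative positions
  of the others. For \<open>L = {2..k + 2}\<close> and \<open>K = {1..k + 2}\<close> the value at
  \<open>t = 0\<close> is the constant \<open>\<mu>\<close>.\<close>

definition limit_mass :: "nat set \<Rightarrow> nat set \<Rightarrow> real \<Rightarrow> ennreal" where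
  "limit_mass L K t = (\<integral>\<^sup>+z. indicator {z. idx_empty 1 (z(1 := 0)) K} z * shifted_mass L t z \<partial>PiM L (\<lambda>_. lborel))"

context
  fixes L :: "nat set"
  assumes L: "finite L" "L \<subseteq> {1..}" "1 \<notin> L"
begin

lemma idx_measurable_lborel:
  "finite K \<Longrightarrow> K \<subseteq> L' \<Longrightarrow> (indicator {x. idx_empty r x K} :: _ \<Rightarrow> ennreal) \<in> borel_measurable (PiM L' (\<lambda>_. lborel :: 'a measure))"
proof -
  assume K: "finite K" "K \<subseteq> L'"
  have "Measurable.pred (PiM L' (\<lambda>_. lborel :: 'a measure)) (\<lambda>x. idx_empty r (\<lambda>j. x j) K)"
    using K measurable_component_singleton[of _ L' "\<lambda>_. lborel :: 'a measure"] by (intro measurable_idx_empty) auto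
  then show ?thesis by (rule measurable_indicator_Collect)
qed

lemma pinned_measurable: "(indicator {z. idx_empty 1 (z(1 := 0)) (insert 1 L)} :: _ \<Rightarrow> ennreal) \<in> borel_measurable (PiM L (\<lambda>_. lborel :: 'a measure))"
proof -
  have "(\<lambda>z. (z(1 := 0)) j) \<in> borel_measurable (PiM L (\<lambda>_. lborel :: 'a measure))" if "j \<in> insert 1 L" for j
    using that measurable_component_singleton[of j L "\<lambda>_. lborel :: 'a measure"] L(3) by (cases "j = 1") auto
  then have "Measurable.pred (PiM L (\<lambda>_. lborel :: 'a measure)) (\<lambda>z. idx_empty 1 (\<lambda>j. (z(1 := 0)) j) (insert 1 L))"
    using L by (intro measurable_idx_empty) auto
  then show ?thesis by (rule measurable_indicator_Collect)
qed

lemma comp_lborel: "j \<in> L \<Longrightarrow> (\<lambda>z. z j) \<in> borel_measurable (PiM L (\<lambda>_. lborel :: 'a measure))"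
  using measurable_component_singleton[of j L "\<lambda>_. lborel :: 'a measure"] by simp

lemma shifted_integrand_measurable:
  "(\<lambda>(z, y). ennreal (f y * (\<Prod>j\<in>L. f (y + t *\<^sub>R z j)))) \<in> borel_measurable (PiM L (\<lambda>_. lborel) \<Otimes>\<^sub>M lborel)"
proof -
  have "(\<lambda>p. f (snd p + t *\<^sub>R (fst p) j)) \<in> borel_measurable (PiM L (\<lambda>_. lborel) \<Otimes>\<^sub>M lborel)" if "j \<in> L" for j
  proof -
    have [measurable]: "(\<lambda>p. (fst p) j) \<in> borel_measurable (PiM L (\<lambda>_. lborel :: 'a measure) \<Otimes>\<^sub>M (lborel :: 'a measure))"
      by (rule measurable_compose[OF measurable_fst comp_lborel[OF that]])
    show ?thesis by measurable
  qed
  then have "(\<lambda>p. ennreal (f (snd p) * (\<Prod>j\<in>L. f (snd p + t *\<^sub>R (fst p) j)))) \<in> borel_measurable (PiM L (\<lambda>_. lborel) \<Otimes>\<^sub>M lborel)"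
    by measurable
  then show ?thesis by (simp add: case_prod_beta')
qed

lemma shifted_mass_measurable: "shifted_mass L t \<in> borel_measurable (PiM L (\<lambda>_. lborel))"
  unfolding shifted_mass_def[abs_def] by (rule lborel.borel_measurable_nn_integral[OF shifted_integrand_measurable])

text \<open>Substitution \<open>x j = y + r *\<^sub>R z j\<close> around \<open>y = x 1\<close> for
  the indices of \<open>L\<close>: the Jacobian is the power of \<open>r\<close>, and
  \<open>idx_empty_scale\<close> frees the event from \<open>r\<close> and \<open>y\<close>. Tonelli
  then moves the integral over \<open>y\<close> inside, where it forms
  \<open>shifted_mass\<close>.\<close>

lemma emeasure_idx_empty_scaled:
  assumes r: "r > 0"
  shows "emeasure M {\<omega> \<in> space M. idx_empty r (\<lambda>j. X j \<omega>) (insert 1 L)} =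
    ennreal (r ^ (DIM('a) * card L)) * limit_mass L (insert 1 L) r"
proof -
  let ?K = "insert 1 L" and ?F = "\<lambda>x. ennreal (f x)" and ?P = "PiM L (\<lambda>_. lborel :: 'a measure)"
  let ?I = "\<lambda>x. indicator {x. idx_empty r x ?K} x :: ennreal"
  let ?H = "\<lambda>z. indicator {z. idx_empty 1 (z(1 := 0)) ?K} z :: ennreal"
  have fK: "finite ?K" using L by simp
  have Im: "?I \<in> borel_measurable (PiM ?K (\<lambda>_. lborel :: 'a measure))" using idx_measurable_lborel[OF fK order_refl] .
  let ?G = "\<lambda>x. (\<Prod>i\<in>?K. ?F (x i)) * ?I x"
  have Gm: "?G \<in> borel_measurable (PiM ?K (\<lambda>_. lborel :: 'a measure))"
  proof (rule borel_measurable_times_ennreal[OF borel_measurable_prod_ennreal Im])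
    fix j assume "j \<in> ?K"
    then have "(\<lambda>z. z j) \<in> borel_measurable (PiM ?K (\<lambda>_. lborel :: 'a measure))"
      using measurable_component_singleton[of j ?K "\<lambda>_. lborel :: 'a measure"] by simp
    then show "(\<lambda>x. ?F (x j)) \<in> borel_measurable (PiM ?K (\<lambda>_. lborel :: 'a measure))" by measurable
  qed
  have "emeasure M {\<omega> \<in> space M. idx_empty r (\<lambda>j. X j \<omega>) ?K} = (\<integral>\<^sup>+x. ?I x \<partial>PiM ?K (\<lambda>_. density lborel ?F))"
    by (rule emeasure_idx_empty) (use L in auto)
  also have "\<dots> = (\<integral>\<^sup>+x. ?G x \<partial>PiM ?K (\<lambda>_. lborel))"
    by (rule nn_integral_PiM_density[OF fK _ density_prob_space Im]) simp
  also have "\<dots> = (\<integral>\<^sup>+y. (\<integral>\<^sup>+x. ?G (x(1 := y)) \<partial>?P) \<partial>lborel)"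
    by (rule lborel_prod.product_nn_integral_insert_rev[OF L(1,3) Gm])
  also have "\<dots> = (\<integral>\<^sup>+y. ennreal (r ^ (DIM('a) * card L)) *
      (\<integral>\<^sup>+z. ?H z * ennreal (f y * (\<Prod>j\<in>L. f (y + r *\<^sub>R z j))) \<partial>?P) \<partial>lborel)"
  proof (rule nn_integral_cong)
    fix y :: 'a
    have "(\<lambda>x. x(1 := y)) \<in> measurable ?P (PiM ?K (\<lambda>_. lborel :: 'a measure))"
    proof -
      have "(\<lambda>(x, y). x(1 := y)) \<in> measurable (?P \<Otimes>\<^sub>M (lborel :: 'a measure)) (PiM ?K (\<lambda>_. lborel :: 'a measure))"
        by (rule measurable_add_dim)
      from measurable_Pair1[OF this, of y] show ?thesis by simp
    qed
    then have m: "(\<lambda>x. ?G (x(1 := y))) \<in> borel_measurable ?P" by (rule measurable_compose[OF _ Gm])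
    have "?G ((\<lambda>j\<in>L. y + r *\<^sub>R z j)(1 := y)) = ?H z * ennreal (f y * (\<Prod>j\<in>L. f (y + r *\<^sub>R z j)))" for z
    proof -
      let ?x = "(\<lambda>j\<in>L. y + r *\<^sub>R z j)(1 := y)"
      have "idx_empty r ?x ?K = idx_empty 1 (z(1 := 0)) ?K"
        by (rule idx_empty_scale[OF r, of _ _ y]) (use L in auto)
      moreover have "(\<Prod>i\<in>?K. ?F (?x i)) = ennreal (f y * (\<Prod>j\<in>L. f (y + r *\<^sub>R z j)))"
      proof -
        have "(\<Prod>i\<in>L. ?F (?x i)) = (\<Prod>j\<in>L. ?F (y + r *\<^sub>R z j))" using L(3) by (intro prod.cong refl) auto
        also have "\<dots> = ennreal (\<Prod>j\<in>L. f (y + r *\<^sub>R z j))" using f_nonneg by (intro prod_ennreal) simp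
        finally have "(\<Prod>i\<in>?K. ?F (?x i)) = ?F y * ennreal (\<Prod>j\<in>L. f (y + r *\<^sub>R z j))"
          unfolding prod.insert[OF L(1,3)] by (simp only: fun_upd_same)
        also have "\<dots> = ennreal (f y * (\<Prod>j\<in>L. f (y + r *\<^sub>R z j)))"
          by (rule ennreal_mult[symmetric, OF f_nonneg prod_f_bounds(1)])
        finally show ?thesis .
      qed
      ultimately show ?thesis by (simp add: indicator_def mult.commute)
    qed
    then show "(\<integral>\<^sup>+x. ?G (x(1 := y)) \<partial>?P) = ennreal (r ^ (DIM('a) * card L)) *
      (\<integral>\<^sup>+z. ?H z * ennreal (f y * (\<Prod>j\<in>L. f (y + r *\<^sub>R z j))) \<partial>?P)"
      using nn_integral_PiM_affine[OF L(1) r m, of y] by (simp only:)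
  qed
  also have "\<dots> = ennreal (r ^ (DIM('a) * card L)) *
      (\<integral>\<^sup>+z. (\<integral>\<^sup>+y. ?H z * ennreal (f y * (\<Prod>j\<in>L. f (y + r *\<^sub>R z j))) \<partial>lborel) \<partial>?P)"
  proof -
    interpret P: finite_product_sigma_finite "\<lambda>_. lborel :: 'a measure" L by standard (rule L(1))
    interpret PP: pair_sigma_finite ?P "lborel :: 'a measure"
      by (simp add: pair_sigma_finite_def P.sigma_finite_measure_axioms lborel.sigma_finite_measure_axioms)
    have m: "(\<lambda>(z, y). ?H z * ennreal (f y * (\<Prod>j\<in>L. f (y + r *\<^sub>R z j)))) \<in> borel_measurable (?P \<Otimes>\<^sub>M lborel)"
    proof -
      have "(\<lambda>p. ?H (fst p)) \<in> borel_measurable (?P \<Otimes>\<^sub>M (lborel :: 'a measure))"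
        by (rule measurable_compose[OF measurable_fst pinned_measurable])
      from borel_measurable_times_ennreal[OF this shifted_integrand_measurable[of r]] show ?thesis
        by (simp add: case_prod_beta')
    qed
    have swap: "(\<integral>\<^sup>+y. (\<integral>\<^sup>+z. ?H z * ennreal (f y * (\<Prod>j\<in>L. f (y + r *\<^sub>R z j))) \<partial>?P) \<partial>lborel) =
      (\<integral>\<^sup>+z. (\<integral>\<^sup>+y. ?H z * ennreal (f y * (\<Prod>j\<in>L. f (y + r *\<^sub>R z j))) \<partial>lborel) \<partial>?P)"
      using PP.Fubini[OF m] by simp
    have "(\<lambda>y. (\<integral>\<^sup>+z. ?H z * ennreal (f y * (\<Prod>j\<in>L. f (y + r *\<^sub>R z j))) \<partial>?P)) \<in> borel_measurable lborel"
      using P.borel_measurable_nn_integral[OF measurable_pair_swap[OF m, simplified]] by (simp add: case_prod_beta')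
    then have "(\<integral>\<^sup>+y. ennreal (r ^ (DIM('a) * card L)) *
      (\<integral>\<^sup>+z. ?H z * ennreal (f y * (\<Prod>j\<in>L. f (y + r *\<^sub>R z j))) \<partial>?P) \<partial>lborel) = ennreal (r ^ (DIM('a) * card L)) *
      (\<integral>\<^sup>+y. (\<integral>\<^sup>+z. ?H z * ennreal (f y * (\<Prod>j\<in>L. f (y + r *\<^sub>R z j))) \<partial>?P) \<partial>lborel)"
      by (rule nn_integral_cmult)
    then show ?thesis unfolding swap .
  qed
  also have "(\<integral>\<^sup>+z. (\<integral>\<^sup>+y. ?H z * ennreal (f y * (\<Prod>j\<in>L. f (y + r *\<^sub>R z j))) \<partial>lborel) \<partial>?P) = limit_mass L ?K r"
    unfolding limit_mass_def shifted_mass_def by (intro nn_integral_cong nn_integral_cmult) measurable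
  finally show ?thesis .
qed

text \<open>With at least three indices, the points of an empty simplex of radius 1 are within
  distance 2 of each other, so the pinned shapes lie in a product of balls of radius 2 about the
  origin; together with \<open>shifted_mass_le\<close> this gives an integrable majorant independent
  of \<open>t\<close>.\<close>

lemma limit_mass_tendsto:
  assumes \<rho>: "\<rho> \<longlonglongrightarrow> 0" and c: "card L \<ge> 2"
  shows "(\<lambda>n. limit_mass L (insert 1 L) (\<rho> n)) \<longlonglongrightarrow> limit_mass L (insert 1 L) 0"
    and "limit_mass L (insert 1 L) t < \<top>"
proof -
  let ?P = "PiM L (\<lambda>_. lborel :: 'a measure)"
  let ?H = "\<lambda>z. indicator {z. idx_empty 1 (z(1 := 0)) (insert 1 L)} z :: ennreal"
  let ?w = "\<lambda>z. indicator (PiE L (\<lambda>_. cball (0::'a) 2)) z * ennreal (B ^ card L)"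
  have ball: "PiE L (\<lambda>_. cball (0::'a) 2) \<in> sets ?P" using L(1) by (intro sets_PiM_I_finite) auto
  have wm: "?w \<in> borel_measurable ?P" using ball by measurable
  have wfin: "(\<integral>\<^sup>+z. ?w z \<partial>?P) < \<infinity>"
  proof -
    have "(\<integral>\<^sup>+z. ?w z \<partial>?P) = emeasure ?P (PiE L (\<lambda>_. cball (0::'a) 2)) * ennreal (B ^ card L)"
      using ball by (subst nn_integral_multc) auto
    have "emeasure ?P (PiE L (\<lambda>_. cball (0::'a) 2)) = (\<Prod>j\<in>L. emeasure lborel (cball (0::'a) 2))"
      by (rule lborel_prod.emeasure_PiM[OF L(1)]) auto
    also have "\<dots> < \<infinity>" using emeasure_cball[of 2 "0::'a"] by (simp add: ennreal_power ennreal_mult_less_top less_top[symmetric])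
    finally have "emeasure ?P (PiE L (\<lambda>_. cball (0::'a) 2)) < \<top>" by simp
    then have "emeasure ?P (PiE L (\<lambda>_. cball (0::'a) 2)) * ennreal (B ^ card L) < \<top>"
      by (simp add: ennreal_mult_less_top)
    then show ?thesis unfolding \<open>(\<integral>\<^sup>+z. ?w z \<partial>?P) = emeasure ?P (PiE L (\<lambda>_. cball (0::'a) 2)) * ennreal (B ^ card L)\<close> by simp
  qed
  have dom: "?H z * shifted_mass L t z \<le> ?w z" if z: "z \<in> space ?P" for z t
  proof (cases "idx_empty 1 (z(1 := 0)) (insert 1 L)")
    case True
    have "z j \<in> cball 0 2" if "j \<in> L" for j
    proof -
      have "dist ((z(1 := 0)) 1) ((z(1 := 0)) j) \<le> 2 * 1"
        using L c that by (intro idx_empty_dist[OF True]) auto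
      then show ?thesis using that L(3) by (auto split: if_splits)
    qed
    then have "z \<in> PiE L (\<lambda>_. cball 0 2)" using z by (auto simp: space_PiM PiE_def)
    then show ?thesis using True shifted_mass_le[of L t z] by simp
  qed simp
  have um: "(\<lambda>z. ?H z * shifted_mass L t z) \<in> borel_measurable ?P" for t
    by (intro borel_measurable_times_ennreal pinned_measurable shifted_mass_measurable)
  show "(\<lambda>n. limit_mass L (insert 1 L) (\<rho> n)) \<longlonglongrightarrow> limit_mass L (insert 1 L) 0"
    unfolding limit_mass_def
  proof (rule nn_integral_dominated_convergence[OF um um wm _ wfin])
    show "AE z in ?P. ?H z * shifted_mass L (\<rho> n) z \<le> ?w z" for n using dom by (intro AE_I2)
    show "AE z in ?P. (\<lambda>n. ?H z * shifted_mass L (\<rho> n) z) \<longlonglongrightarrow> ?H z * shifted_mass L 0 z"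
      by (intro AE_I2 ennreal_tendsto_cmult shifted_mass_tendsto \<rho>) (simp add: indicator_def)
  qed
  have "limit_mass L (insert 1 L) t \<le> (\<integral>\<^sup>+z. ?w z \<partial>?P)"
    unfolding limit_mass_def by (rule nn_integral_mono[OF dom])
  then show "limit_mass L (insert 1 L) t < \<top>" using wfin by simp
qed

end

text \<open>The exponent counts the \<open>k + 1\<close> points that are free once index 1 is
  pinned. The limit is \<open>limit_mass\<close> at 0, hence the same for every
  \<open>\<rho>\<close>; \<open>k \<ge> 1\<close> provides the three indices behind the
  majorant.\<close>

theorem prob_idx_empty_tendsto:
  assumes k: "k \<ge> 1" and \<rho>: "\<rho> \<longlonglongrightarrow> 0" and pos: "\<And>n. n \<ge> 1 \<Longrightarrow> \<rho> n > 0"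
  shows "\<exists>m\<ge>0. (\<lambda>n. prob {\<omega> \<in> space M. idx_empty (\<rho> n) (\<lambda>j. X j \<omega>) {1..k + 2}} / \<rho> n ^ (DIM('a) * (k + 1))) \<longlonglongrightarrow> m"
proof -
  let ?L = "{2..k + 2}"
  have L: "finite ?L" "?L \<subseteq> {1..}" "1 \<notin> ?L" "card ?L = k + 1" "insert 1 ?L = {1..k + 2}" by auto
  have "(\<lambda>n. enn2real (limit_mass ?L {1..k + 2} (\<rho> n))) \<longlonglongrightarrow> enn2real (limit_mass ?L {1..k + 2} 0)"
    using limit_mass_tendsto[OF L(1-3) \<rho>] k L(4,5) by (intro tendsto_enn2real) (auto simp: less_top[symmetric])
  moreover have "prob {\<omega> \<in> space M. idx_empty (\<rho> n) (\<lambda>j. X j \<omega>) {1..k + 2}} / \<rho> n ^ (DIM('a) * (k + 1)) =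
    enn2real (limit_mass ?L {1..k + 2} (\<rho> n))" if "n \<ge> 1" for n
    using emeasure_idx_empty_scaled[OF L(1-3) pos[OF that]] pos[OF that] unfolding L(4,5) measure_def
    by (simp add: enn2real_mult)
  then have "eventually (\<lambda>n. prob {\<omega> \<in> space M. idx_empty (\<rho> n) (\<lambda>j. X j \<omega>) {1..k + 2}} / \<rho> n ^ (DIM('a) * (k + 1)) =
    enn2real (limit_mass ?L {1..k + 2} (\<rho> n))) sequentially"
    by (auto simp: eventually_sequentially intro!: exI[of _ 1])
  ultimately have "(\<lambda>n. prob {\<omega> \<in> space M. idx_empty (\<rho> n) (\<lambda>j. X j \<omega>) {1..k + 2}} / \<rho> n ^ (DIM('a) * (k + 1)))
    \<longlonglongrightarrow> enn2real (limit_mass ?L {1..k + 2} 0)"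
    by (subst tendsto_cong)
  then show ?thesis by (intro exI[of _ "enn2real (limit_mass ?L {1..k + 2} 0)"] conjI) simp_all
qed

end

section \<open>The central limit theorem\<close>

lemma real_distribution_normal:
  assumes "v \<ge> 0"
  shows "real_distribution (normal_distribution 0 v)"
proof (cases "v = 0")
  case True
  then show ?thesis unfolding normal_distribution_def
    by (simp add: real_distribution_def real_distribution_axioms_def prob_space_return)
next
  case False
  then have "prob_space (density lborel (normal_density 0 (sqrt v)))"
    using assms by (intro prob_space_normal_density) simp
  then show ?thesis using False unfolding normal_distribution_def
    by (simp add: real_distribution_def real_distribution_axioms_def)
qed

text \<open>For \<open>v = 0\<close> the law is a point mass and both sides are 1; otherwise it is
  the image of the standard normal law under multiplication by \<open>sqrt v\<close>.\<close>

lemma char_normal_distribution: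
  assumes "v \<ge> 0"
  shows "char (normal_distribution 0 v) t = of_real (exp (- (v * t\<^sup>2 / 2)))"
proof (cases "v = 0")
  case True
  then show ?thesis unfolding normal_distribution_def char_def by (simp add: integral_return)
next
  case False
  then have v: "v > 0" using assms by simp
  let ?N = "density lborel (\<lambda>x. ennreal (normal_density 0 1 x))"
  interpret N: prob_space ?N by (rule prob_space_normal_density) simp
  have "distributed ?N lborel (\<lambda>x. x) (\<lambda>x. ennreal (normal_density 0 1 x))"
    unfolding distributed_def by (simp add: distr_id2 cong: distr_cong)
  from N.normal_density_affine[OF this, of "sqrt v" 0]
  have "distributed ?N lborel (\<lambda>x. sqrt v * x) (\<lambda>x. ennreal (normal_density 0 (sqrt v) x))" using v by simp
  then have d: "density lborel (normal_density 0 (sqrt v)) = distr ?N lborel (\<lambda>x. sqrt v * x)"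
    by (simp add: distributed_distr_eq_density)
  have "char (normal_distribution 0 v) t = (CLINT x|distr ?N lborel (\<lambda>x. sqrt v * x). iexp (t * x))"
    using False unfolding normal_distribution_def char_def d by simp
  also have "\<dots> = char std_normal_distribution (t * sqrt v)"
    unfolding char_def by (subst integral_distr) (auto simp: mult.assoc)
  also have "\<dots> = of_real (exp (- (v * t\<^sup>2 / 2)))"
    using v by (simp add: char_std_normal_distribution power_mult_distrib mult.commute)
  finally show ?thesis .
qed

lemma binomial_over_power_tendsto: "(\<lambda>n. real (n choose K) / real n ^ K) \<longlonglongrightarrow> 1 / fact K"
proof -
  have "(\<lambda>n. (\<Prod>i<K. (real n - real i) / real n)) \<longlonglongrightarrow> (\<Prod>i<K. 1)"
    by (intro tendsto_prod) real_asymp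
  then have "(\<lambda>n. (\<Prod>i<K. (real n - real i) / real n) / fact K) \<longlonglongrightarrow> 1 / fact K"
    by (intro tendsto_divide) auto
  moreover have "(\<Prod>i<K. (real n - real i) / real n) / fact K = real (n choose K) / real n ^ K" for n
    by (simp add: binomial_gbinomial gbinomial_prod_rev prod_dividef atLeast0LessThan)
  ultimately show ?thesis by simp
qed

context iid_sample
begin

text \<open>The Betti number is split into excess \<open>F\<close> and count \<open>W\<close>.
  Replacing \<open>F\<close> by its mean costs at most \<open>\<bar>s\<bar>\<close> times its mean
  absolute deviation, hence the square root of the variance bound; \<open>W\<close> is compared with
  a Poisson variable, and centring by \<open>l\<close> turns the Poisson characteristic function
  into \<open>exp (l * (iexp s - 1 - \<i> * s))\<close>. The normalisation \<open>S\<close> is kept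
  free.\<close>

lemma char_estimate:
  fixes n k :: nat and r S t :: real
  assumes n: "n \<ge> 1" and k: "k \<ge> 1" and r: "r > 0" and S: "S > 0"
  defines "\<beta> \<equiv> \<lambda>\<omega>. real (betti (cech_complex r ((\<lambda>i. X i \<omega>) ` {1..n})) k)"
    and "c \<equiv> real n * ball_mass (4 * r)"
    and "l \<equiv> real (n choose (k + 2)) * prob {\<omega> \<in> space M. idx_empty r (\<lambda>j. X j \<omega>) {1..k + 2}}"
  shows "cmod ((CLINT \<omega>|M. iexp (t * (1 / sqrt S * (\<beta> \<omega> - expectation \<beta>)))) -
      exp (of_real l * (iexp (t / sqrt S) - 1 - \<i> * of_real (t / sqrt S)))) \<le>
    \<bar>t\<bar> * sqrt (real n * (9 * 4 ^ (k + 2) * (kC k * (c ^ (k + 2) + c ^ (3 * k + 6)))) / S) +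
    t\<^sup>2 * exp (l / S * t\<^sup>2 / 2) * ((l * ((real k + 2) * (kC k * (c ^ (k + 1) + c ^ (2 * k + 2)))) +
      real n * (kC k * (c ^ (k + 2) + c ^ (3 * k + 4)))) / S)"
proof -
  let ?J = "{1..n}"
  have J: "finite ?J" "?J \<subseteq> {1..}" "?J \<noteq> {}" "card ?J = n" using n by auto
  define F where "F = (\<lambda>\<omega>. betti_excess r k (\<lambda>j. X j \<omega>) ?J)"
  define W where "W = (\<lambda>\<omega>. real (card (empties r k (\<lambda>j. X j \<omega>) ?J)))"
  define s where "s = t / sqrt S"
  define V where "V = real n * (9 * 4 ^ (k + 2) * (kC k * (c ^ (k + 2) + c ^ (3 * k + 6))))"
  define b where "b = l * ((real k + 2) * (kC k * (c ^ (k + 1) + c ^ (2 * k + 2)))) +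
      real n * (kC k * (c ^ (k + 2) + c ^ (3 * k + 4)))"
  have s2: "s\<^sup>2 = t\<^sup>2 / S" using S by (simp add: s_def power_divide)
  have XJ': "\<And>j. j \<in> ?J \<Longrightarrow> X j \<in> borel_measurable M" using X_measurable by simp
  have Fm [measurable]: "F \<in> borel_measurable M" unfolding F_def by (rule measurable_betti_excess[OF J(1) XJ'])
  have Wm [measurable]: "W \<in> borel_measurable M" unfolding W_def by (rule measurable_card_empties[OF J(1) XJ'])
  have Fb: "\<bar>F \<omega>\<bar> \<le> 3 * real n * (real n + 1) ^ (k + 2)" for \<omega>
    using abs_betti_excess_le[OF J(1) k r] unfolding F_def J(4) .
  have Fint: "integrable M F" using Fb by (intro integrable_bounded[OF Fm]) simp
  have l_eq: "l = (\<Sum>\<alpha>\<in>{\<alpha>. \<alpha> \<subseteq> ?J \<and> card \<alpha> = k + 2}. prob {\<omega> \<in> space M. idx_empty r (\<lambda>j. X j \<omega>) \<alpha>})"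
  proof -
    have "prob {\<omega> \<in> space M. idx_empty r (\<lambda>j. X j \<omega>) \<alpha>} = prob {\<omega> \<in> space M. idx_empty r (\<lambda>j. X j \<omega>) {1..k + 2}}"
      if "\<alpha> \<in> {\<alpha>. \<alpha> \<subseteq> ?J \<and> card \<alpha> = k + 2}" for \<alpha>
    proof (rule prob_idx_empty_eq)
      show "finite \<alpha>" using that finite_subset[of \<alpha> ?J] by auto
      show "\<alpha> \<subseteq> {1..}" "\<alpha> \<noteq> {}" using that by auto
    qed (use that in auto)
    then show ?thesis by (simp add: l_def n_subsets)
  qed
  \<comment> \<open>\<open>card {1..n}\<close> has to become \<open>n\<close> before
    \<open>c\<close> can be recognised, whence the order of the rewriting attributes.\<close>
  note cW = char_card_empties[OF J(1-3) r k, folded l_eq, unfolded J(4), folded c_def]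
  have EW: "expectation W = l" and Wint: "integrable M W" unfolding W_def by (rule cW(2), rule cW(3))
  have \<beta>: "\<beta> \<omega> = F \<omega> + W \<omega>" for \<omega> unfolding \<beta>_def F_def W_def betti_excess_def by simp
  have E\<beta>: "expectation \<beta> = expectation F + l" unfolding \<beta>[abs_def] using Fint Wint EW by simp
  have decomp: "t * (1 / sqrt S * (\<beta> \<omega> - expectation \<beta>)) = s * (W \<omega> - l) + s * (F \<omega> - expectation F)" for \<omega>
    unfolding \<beta> E\<beta> s_def by (simp add: algebra_simps add_divide_distrib diff_divide_distrib)
  have 1: "cmod ((CLINT \<omega>|M. iexp (t * (1 / sqrt S * (\<beta> \<omega> - expectation \<beta>)))) - (CLINT \<omega>|M. iexp (s * (W \<omega> - l)))) \<le> \<bar>t\<bar> * sqrt (V / S)"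
  proof -
    have "cmod ((CLINT \<omega>|M. iexp (t * (1 / sqrt S * (\<beta> \<omega> - expectation \<beta>)))) - (CLINT \<omega>|M. iexp (s * (W \<omega> - l)))) \<le>
      expectation (\<lambda>\<omega>. \<bar>s\<bar> * \<bar>F \<omega> - expectation F\<bar>)"
      unfolding decomp
    proof (rule norm_expectation_diff_le)
      show "integrable M (\<lambda>\<omega>. iexp (s * (W \<omega> - l) + s * (F \<omega> - expectation F)))"
        by (rule integrable_bounded[of _ 1]) auto
      show "integrable M (\<lambda>\<omega>. iexp (s * (W \<omega> - l)))" by (rule integrable_bounded[of _ 1]) auto
      show "integrable M (\<lambda>\<omega>. \<bar>s\<bar> * \<bar>F \<omega> - expectation F\<bar>)" using Fint by simp
      fix \<omega>
      show "cmod (iexp (s * (W \<omega> - l) + s * (F \<omega> - expectation F)) - iexp (s * (W \<omega> - l))) \<le> \<bar>s\<bar> * \<bar>F \<omega> - expectation F\<bar>"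
        using norm_iexp_diff_le[of "s * (W \<omega> - l) + s * (F \<omega> - expectation F)" "s * (W \<omega> - l)"] by (simp add: abs_mult)
    qed
    also have "\<dots> = \<bar>s\<bar> * expectation (\<lambda>\<omega>. \<bar>F \<omega> - expectation F\<bar>)" by simp
    also have "expectation (\<lambda>\<omega>. \<bar>F \<omega> - expectation F\<bar>) \<le> sqrt V"
    proof (rule real_le_rsqrt)
      have "(expectation (\<lambda>\<omega>. \<bar>F \<omega> - expectation F\<bar>))\<^sup>2 \<le> expectation (\<lambda>\<omega>. \<bar>F \<omega> - expectation F\<bar>\<^sup>2)"
      proof (rule expectation_square_ge)
        show "\<bar>\<bar>F \<omega> - expectation F\<bar>\<bar> \<le> 3 * real n * (real n + 1) ^ (k + 2) + \<bar>expectation F\<bar>" for \<omega>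
          using Fb[of \<omega>] by linarith
      qed measurable
      also have "\<dots> \<le> V"
        using variance_betti_excess[OF J(1-3) r k] unfolding V_def c_def F_def J(4) by simp
      finally show "(expectation (\<lambda>\<omega>. \<bar>F \<omega> - expectation F\<bar>))\<^sup>2 \<le> V" .
    qed
    also have "\<bar>s\<bar> * sqrt V = \<bar>t\<bar> * sqrt (V / S)" using S by (simp add: s_def real_sqrt_divide abs_divide)
    finally show ?thesis by (simp add: mult_left_mono)
  qed
  have 2: "cmod ((CLINT \<omega>|M. iexp (s * (W \<omega> - l))) - exp (of_real l * (iexp s - 1 - \<i> * of_real s))) \<le> t\<^sup>2 * exp (l / S * t\<^sup>2 / 2) * (b / S)"
  proof -
    have "(CLINT \<omega>|M. iexp (s * (W \<omega> - l))) = (CLINT \<omega>|M. iexp (- (s * l)) * iexp (s * W \<omega>))"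
      by (intro Bochner_Integration.integral_cong refl) (simp add: exp_add[symmetric] algebra_simps)
    also have "\<dots> = iexp (- (s * l)) * (CLINT \<omega>|M. iexp (s * W \<omega>))" by (rule integral_mult_right_zero)
    finally have e1: "(CLINT \<omega>|M. iexp (s * (W \<omega> - l))) = iexp (- (s * l)) * (CLINT \<omega>|M. iexp (s * W \<omega>))" .
    have e2: "exp (of_real l * (iexp s - 1 - \<i> * of_real s)) = iexp (- (s * l)) * exp (of_real l * (iexp s - 1))"
      by (simp add: exp_add[symmetric] algebra_simps)
    have "cmod ((CLINT \<omega>|M. iexp (s * (W \<omega> - l))) - exp (of_real l * (iexp s - 1 - \<i> * of_real s))) =
      cmod ((CLINT \<omega>|M. iexp (s * W \<omega>)) - exp (of_real l * (iexp s - 1)))"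
      unfolding e1 e2 right_diff_distrib[symmetric] norm_mult by simp
    also have "\<dots> \<le> s\<^sup>2 * exp (l * s\<^sup>2 / 2) * b" using cW(1)[of s] unfolding W_def b_def .
    also have "\<dots> = t\<^sup>2 * exp (l / S * t\<^sup>2 / 2) * (b / S)" unfolding s2 by simp
    finally show ?thesis .
  qed
  show ?thesis
    using norm_triangle_mono[OF 1 2] unfolding V_def b_def s_def by simp
qed

end

theorem theorem2p2:
  fixes M :: "'w measure"
    and X :: "nat \<Rightarrow> 'w \<Rightarrow> real ^ 'd"
    and f :: "real ^ 'd \<Rightarrow> real"
    and r :: "nat \<Rightarrow> real"
    and k :: nat and \<delta> :: real
  defines "\<beta> \<equiv> \<lambda>n \<omega>. real (betti (cech_complex (r n) ((\<lambda>i. X i \<omega>) ` {1..n})) k)"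
  assumes k: "k \<ge> 1"
    and f_density: "f \<in> borel_measurable borel" "\<And>x. 0 \<le> f x"
      "(\<integral>\<^sup>+ x. ennreal (f x) \<partial>lborel) = 1"
    and f_bounded: "\<exists>B. \<forall>x. f x \<le> B"
    and M: "prob_space M"
    and X_density: "\<And>i. i \<ge> 1 \<Longrightarrow> distributed M lborel (X i) (\<lambda>x. ennreal (f x))"
    and X_indep: "prob_space.indep_vars M (\<lambda>_. borel) X {1..}"
    and \<delta>: "\<delta> > 0"
    and r_pos: "\<And>n. n \<ge> 1 \<Longrightarrow> r n > 0"
    and r_small: "r \<in> o(\<lambda>n. real n powr (- 1 / real CARD('d) - \<delta>))"
    and r_large: "filterlim (\<lambda>n. real n ^ (k + 2) * r n ^ (CARD('d) * (k + 1))) at_top sequentially"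
  shows "weak_conv_m
    (\<lambda>n. distr M borel (\<lambda>\<omega>.
       1 / sqrt (real n * (real n * r n ^ CARD('d)) ^ (k + 1)) *
       (\<beta> n \<omega> - prob_space.expectation M (\<beta> n))))
    (normal_distribution 0 (cech_mu M X r k / fact (k + 2)))"
proof -
  interpret prob_space M by (rule M)
  obtain B where B: "\<And>x. f x \<le> B" using f_bounded by blast
  interpret iid_sample M X f B
    by unfold_locales (use f_density B X_density X_indep in auto)
  let ?d = "CARD('d)"
  define a where "a n = real n * r n ^ ?d" for n
  define S where "S n = real n * a n ^ (k + 1)" for n
  define p where "p n = prob {\<omega> \<in> space M. idx_empty (r n) (\<lambda>j. X j \<omega>) {1..k + 2}}" for n
  define l where "l n = real (n choose (k + 2)) * p n" for n
  \<comment> \<open>Chosen so that \<open>real n * ball_mass (4 * r n) = \<kappa> * a n\<close>; the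
    4 is the radius factor of \<open>near\<close>.\<close>
  define \<kappa> where "\<kappa> = B * unit_ball_vol (real ?d) * 4 ^ ?d"
  have d: "?d \<ge> 1" by (simp add: Suc_leI)
  have r_le: "eventually (\<lambda>n. r n \<le> real n powr (- 1 / real ?d - \<delta>)) sequentially"
    using landau_o.smallD[OF r_small, of 1] by (auto elim: eventually_mono)
  have r0: "r \<longlonglongrightarrow> 0"
  proof (rule tendsto_sandwich[OF _ r_le tendsto_const])
    show "eventually (\<lambda>n. 0 \<le> r n) sequentially"
      using r_pos by (auto simp: eventually_sequentially intro!: exI[of _ 1] less_imp_le)
    have "1 / real ?d > 0" using d by simp
    then have "- 1 / real ?d - \<delta> < 0" using \<delta> by (simp only: minus_divide_left[symmetric])
    then show "(\<lambda>n. real n powr (- 1 / real ?d - \<delta>)) \<longlonglongrightarrow> 0"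
      by (rule tendsto_neg_powr[OF _ filterlim_real_sequentially])
  qed
  have a_pos: "a n > 0" if "n \<ge> 1" for n using r_pos[OF that] that by (simp add: a_def)
  have S_pos: "S n > 0" if "n \<ge> 1" for n using a_pos[OF that] that by (simp add: S_def)
  \<comment> \<open>The power \<open>d\<close> of the bound on \<open>r\<close> is
    \<open>n powr (- 1 - d * \<delta>)\<close>; the factor \<open>n\<close> in \<open>a\<close>
    cancels the \<open>- 1\<close> and leaves a negative power of \<open>n\<close>.\<close>
  have a0: "a \<longlonglongrightarrow> 0"
  proof (rule tendsto_sandwich[OF _ _ tendsto_const])
    show "eventually (\<lambda>n. 0 \<le> a n) sequentially"
      using a_pos by (auto simp: eventually_sequentially intro!: exI[of _ 1] less_imp_le)
    show "eventually (\<lambda>n. a n \<le> real n powr (- (real ?d * \<delta>))) sequentially"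
      using r_le eventually_ge_at_top[of 1]
    proof eventually_elim
      case (elim n)
      have "r n ^ ?d \<le> (real n powr (- 1 / real ?d - \<delta>)) ^ ?d"
        using elim r_pos[of n] by (intro power_mono) auto
      also have "\<dots> = real n powr ((- 1 / real ?d - \<delta>) * real ?d)"
        using elim by (simp add: powr_powr[symmetric] powr_realpow)
      also have "(- 1 / real ?d - \<delta>) * real ?d = - 1 - real ?d * \<delta>" using d by (simp add: field_simps)
      finally have "a n \<le> real n * real n powr (- 1 - real ?d * \<delta>)" unfolding a_def by (intro mult_left_mono) auto
      also have "\<dots> = real n powr 1 * real n powr (- 1 - real ?d * \<delta>)" using elim by simp
      also have "\<dots> = real n powr (- (real ?d * \<delta>))" unfolding powr_add[symmetric] by simp
      finally show ?case .
    qed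
    have "- (real ?d * \<delta>) < 0" using \<delta> by simp
    then show "(\<lambda>n. real n powr (- (real ?d * \<delta>))) \<longlonglongrightarrow> 0"
      by (rule tendsto_neg_powr[OF _ filterlim_real_sequentially])
  qed
  have S_eq: "S n = real n ^ (k + 2) * r n ^ (?d * (k + 1))" for n
    by (simp add: S_def a_def power_mult_distrib power_mult power_add)
  have S_inf: "filterlim S at_top sequentially" unfolding S_eq[abs_def] by (rule r_large)
  have DIM: "DIM(real ^ 'd) = ?d" by simp
  obtain m where m: "m \<ge> 0" "(\<lambda>n. p n / r n ^ (?d * (k + 1))) \<longlonglongrightarrow> m"
    using prob_idx_empty_tendsto[OF k r0 r_pos] unfolding p_def DIM by blast
  \<comment> \<open>\<open>cech_mu\<close> is defined by \<open>lim\<close>, so its value is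
    available only through an actual limit: \<open>betti_eq_one_iff\<close> turns its event into an
    empty simplex, for which the limit \<open>m\<close> is at hand.\<close>
  have mu: "cech_mu M X r k = m"
    unfolding cech_mu_def
  proof (rule limI)
    have "(complex_connected (cech_complex (r n) (x ` {1..k + 2})) \<and> betti (cech_complex (r n) (x ` {1..k + 2})) k = 1)
      = idx_empty (r n) x {1..k + 2}" for n and x :: "nat \<Rightarrow> real ^ 'd"
      by (rule betti_eq_one_iff[OF k]) auto
    then have "{\<omega> \<in> space M. complex_connected (cech_complex (r n) ((\<lambda>i. X i \<omega>) ` {1..k + 2})) \<and>
       betti (cech_complex (r n) ((\<lambda>i. X i \<omega>) ` {1..k + 2})) k = 1} =
      {\<omega> \<in> space M. idx_empty (r n) (\<lambda>j. X j \<omega>) {1..k + 2}}" for n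
      by (intro Collect_cong conj_cong refl)
    then have "r n powi (- int (?d * (k + 1))) * prob {\<omega> \<in> space M. complex_connected (cech_complex (r n) ((\<lambda>i. X i \<omega>) ` {1..k + 2})) \<and>
       betti (cech_complex (r n) ((\<lambda>i. X i \<omega>) ` {1..k + 2})) k = 1} = p n / r n ^ (?d * (k + 1))" for n
      unfolding power_int_minus power_int_of_nat p_def by (simp only: divide_inverse mult.commute)
    then show "(\<lambda>n. r n powi (- int (?d * (k + 1))) * prob {\<omega> \<in> space M. complex_connected (cech_complex (r n) ((\<lambda>i. X i \<omega>) ` {1..k + 2})) \<and>
       betti (cech_complex (r n) ((\<lambda>i. X i \<omega>) ` {1..k + 2})) k = 1}) \<longlonglongrightarrow> m" using m(2) by simp
  qed
  define v where "v = m / fact (k + 2)"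
  have v: "v \<ge> 0" using m(1) by (simp add: v_def)
  have lS: "(\<lambda>n. l n / S n) \<longlonglongrightarrow> v"
  proof -
    have "(\<lambda>n. real (n choose (k + 2)) / real n ^ (k + 2) * (p n / r n ^ (?d * (k + 1)))) \<longlonglongrightarrow> 1 / fact (k + 2) * m"
      by (intro tendsto_mult binomial_over_power_tendsto m(2))
    then show ?thesis by (simp add: l_def S_eq v_def)
  qed
  have c_eq: "real n * ball_mass (4 * r n) = \<kappa> * a n" for n
    by (simp add: ball_mass_def \<kappa>_def a_def power_mult_distrib)
  \<comment> \<open>After division by \<open>S\<close>, every power of
    \<open>c = \<kappa> * a\<close> beyond \<open>k + 1\<close> leaves a positive power of
    \<open>a\<close>. All error terms with the explicit factor \<open>n\<close> are handled by this;
    the one with the factor \<open>l\<close> uses that \<open>l / S\<close> converges.\<close>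
  have quot: "real n * (\<kappa> * a n) ^ (k + 1 + j) / S n = \<kappa> ^ (k + 1 + j) * a n ^ j" if "n \<ge> 1" for n j
  proof -
    have "real n * (\<kappa> * a n) ^ (k + 1 + j) = \<kappa> ^ (k + 1 + j) * a n ^ j * S n"
      unfolding power_mult_distrib power_add[of "a n" "k + 1" j] S_def by (simp only: mult_ac)
    then show ?thesis using S_pos[OF that] by (metis less_irrefl nonzero_mult_div_cancel_right)
  qed
  have char_lim: "(\<lambda>n. char (distr M borel (\<lambda>\<omega>. 1 / sqrt (S n) * (\<beta> n \<omega> - expectation (\<beta> n)))) t) \<longlonglongrightarrow>
    char (normal_distribution 0 v) t" for t
  proof -
    define Z where "Z n \<omega> = 1 / sqrt (S n) * (\<beta> n \<omega> - expectation (\<beta> n))" for n \<omega>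
    define G where "G n = exp (of_real (l n) * (iexp (t / sqrt (S n)) - 1 - \<i> * of_real (t / sqrt (S n))))" for n
    \<comment> \<open>\<open>e1\<close> is the variance bound and \<open>e2\<close> the Stein--Chen
      bound of \<open>char_estimate\<close>, both divided by \<open>S\<close> and rewritten so that
      only \<open>l / S\<close> and powers of \<open>a\<close> vary with \<open>n\<close>.\<close>
    define e1 where "e1 n = 9 * 4 ^ (k + 2) * (kC k * (\<kappa> ^ (k + 2) * a n + \<kappa> ^ (3 * k + 6) * a n ^ (2 * k + 5)))" for n
    define e2 where "e2 n = l n / S n * ((real k + 2) * (kC k * ((\<kappa> * a n) ^ (k + 1) + (\<kappa> * a n) ^ (2 * k + 2)))) +
      kC k * (\<kappa> ^ (k + 2) * a n + \<kappa> ^ (3 * k + 4) * a n ^ (2 * k + 3))" for n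
    have est: "cmod ((CLINT \<omega>|M. iexp (t * Z n \<omega>)) - G n) \<le> \<bar>t\<bar> * sqrt (e1 n) + t\<^sup>2 * exp (l n / S n * t\<^sup>2 / 2) * e2 n"
      if n: "n \<ge> 1" for n
    proof -
      have "k + 1 + 1 = k + 2" "k + 1 + (2 * k + 5) = 3 * k + 6" "k + 1 + (2 * k + 3) = 3 * k + 4" by simp_all
      note q = quot[OF n, of 1, unfolded this(1) power_one_right] quot[OF n, of "2 * k + 5", unfolded this(2)]
        quot[OF n, of "2 * k + 3", unfolded this(3)]
      \<comment> \<open>Stated for plain variables to keep the powers opaque to the
        simplifier.\<close>
      have "N * (C * (K * (x + y))) / s = C * (K * (N * x / s + N * y / s))" for N C K x y s :: real
        by (simp add: algebra_simps add_divide_distrib)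
      then have 1: "real n * (9 * 4 ^ (k + 2) * (kC k * ((\<kappa> * a n) ^ (k + 2) + (\<kappa> * a n) ^ (3 * k + 6)))) / S n = e1 n"
        unfolding e1_def q[symmetric] .
      have "(L * (C * A) + N * (K * (x + y))) / s = L / s * (C * A) + K * (N * x / s + N * y / s)" for L A N C K x y s :: real
        by (simp add: algebra_simps add_divide_distrib)
      then have 2: "(l n * ((real k + 2) * (kC k * ((\<kappa> * a n) ^ (k + 1) + (\<kappa> * a n) ^ (2 * k + 2)))) +
        real n * (kC k * ((\<kappa> * a n) ^ (k + 2) + (\<kappa> * a n) ^ (3 * k + 4)))) / S n = e2 n"
        unfolding e2_def q[symmetric] .
      show ?thesis
        using char_estimate[OF n k r_pos[OF n] S_pos[OF n], of t, unfolded c_eq, folded p_def, folded l_def]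
        unfolding 1 2 Z_def G_def \<beta>_def .
    qed
    have e1: "e1 \<longlonglongrightarrow> 0"
    proof -
      have "e1 \<longlonglongrightarrow> 9 * 4 ^ (k + 2) * (kC k * (\<kappa> ^ (k + 2) * 0 + \<kappa> ^ (3 * k + 6) * 0 ^ (2 * k + 5)))" (is "_ \<longlonglongrightarrow> ?L")
        unfolding e1_def[abs_def] by (intro tendsto_intros a0)
      moreover have "?L = 0" by (simp add: power_0_left)
      ultimately show ?thesis by (simp only:)
    qed
    have e2: "e2 \<longlonglongrightarrow> 0"
    proof -
      have "e2 \<longlonglongrightarrow> v * ((real k + 2) * (kC k * ((\<kappa> * 0) ^ (k + 1) + (\<kappa> * 0) ^ (2 * k + 2)))) +
          kC k * (\<kappa> ^ (k + 2) * 0 + \<kappa> ^ (3 * k + 4) * 0 ^ (2 * k + 3))" (is "_ \<longlonglongrightarrow> ?L")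
        unfolding e2_def[abs_def] by (intro tendsto_intros a0 lS)
      moreover have "?L = 0" by (simp add: power_0_left)
      ultimately show ?thesis by (simp only:)
    qed
    have "(\<lambda>n. \<bar>t\<bar> * sqrt (e1 n) + t\<^sup>2 * exp (l n / S n * t\<^sup>2 / 2) * e2 n) \<longlonglongrightarrow>
      \<bar>t\<bar> * sqrt 0 + t\<^sup>2 * exp (v * t\<^sup>2 / 2) * 0"
      by (intro tendsto_intros e1 e2 lS) simp
    then have "(\<lambda>n. \<bar>t\<bar> * sqrt (e1 n) + t\<^sup>2 * exp (l n / S n * t\<^sup>2 / 2) * e2 n) \<longlonglongrightarrow> 0" by simp
    moreover have "eventually (\<lambda>n. norm ((CLINT \<omega>|M. iexp (t * Z n \<omega>)) - G n) \<le>
      \<bar>t\<bar> * sqrt (e1 n) + t\<^sup>2 * exp (l n / S n * t\<^sup>2 / 2) * e2 n) sequentially"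
      using est by (auto simp: eventually_sequentially intro!: exI[of _ 1])
    ultimately have D: "(\<lambda>n. (CLINT \<omega>|M. iexp (t * Z n \<omega>)) - G n) \<longlonglongrightarrow> 0"
      by (rule Lim_null_comparison[rotated])
    have sqS: "(\<lambda>n. inverse (sqrt (S n))) \<longlonglongrightarrow> 0"
      by (intro tendsto_inverse_0_at_top filterlim_compose[OF sqrt_at_top S_inf])
    \<comment> \<open>Second-order expansion of \<open>iexp s\<close> at
      \<open>s = t / sqrt (S n)\<close>: the quadratic term gives
      \<open>- (l / S) * t\<^sup>2 / 2\<close>, and the remainder is at most
      \<open>l * \<bar>s\<bar> ^ 3 / 6\<close>, that is \<open>l / S\<close> times a multiple of
      \<open>1 / sqrt S\<close>. Convergence of \<open>l / S\<close> and divergence of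
      \<open>S\<close> finish.\<close>
    have "(\<lambda>n. of_real (l n) * (iexp (t / sqrt (S n)) - 1 - \<i> * of_real (t / sqrt (S n)))) \<longlonglongrightarrow> - of_real (v * t\<^sup>2 / 2)"
    proof -
      have "(\<lambda>n. of_real (l n) * (iexp (t / sqrt (S n)) - 1 - \<i> * of_real (t / sqrt (S n))) + of_real (l n / S n * t\<^sup>2 / 2)) \<longlonglongrightarrow> (0::complex)"
      proof (rule Lim_null_comparison)
        show "eventually (\<lambda>n. norm (of_real (l n) * (iexp (t / sqrt (S n)) - 1 - \<i> * of_real (t / sqrt (S n))) + of_real (l n / S n * t\<^sup>2 / 2))
          \<le> (l n / S n) * (\<bar>t\<bar> ^ 3 / 6) * inverse (sqrt (S n))) sequentially"
          using eventually_ge_at_top[of 1]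
        proof eventually_elim
          case (elim n)
          define s where "s = t / sqrt (S n)"
          have Sp: "S n > 0" using S_pos elim by simp
          have l0: "l n \<ge> 0" by (simp add: l_def p_def)
          have s2: "s\<^sup>2 = t\<^sup>2 / S n" using Sp by (simp add: s_def power_divide)
          have "of_real (l n) * (iexp s - 1 - \<i> * of_real s) + of_real (l n / S n * t\<^sup>2 / 2) =
            of_real (l n) * (iexp s - (\<Sum>j\<le>2. (\<i> * of_real s) ^ j / fact j))"
          proof -
            have A: "of_real (l n / S n * t\<^sup>2 / 2) = complex_of_real (l n) * (of_real (s\<^sup>2) / 2)" unfolding s2 by simp
            have "(\<Sum>j\<le>2. g j) = g 0 + g 1 + g 2" for g :: "nat \<Rightarrow> complex" by (simp add: numeral_2_eq_2)
            then have B: "(\<Sum>j\<le>2. (\<i> * complex_of_real s) ^ j / fact j) = 1 + \<i> * of_real s - of_real (s\<^sup>2) / 2"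
              by (simp add: power_mult_distrib)
            show ?thesis unfolding A B by (simp add: algebra_simps)
          qed
          then have "norm (of_real (l n) * (iexp s - 1 - \<i> * of_real s) + of_real (l n / S n * t\<^sup>2 / 2)) =
            l n * cmod (iexp s - (\<Sum>j\<le>2. (\<i> * of_real s) ^ j / fact j))"
            using l0 by (simp add: norm_mult)
          also have "\<dots> \<le> l n * (\<bar>s\<bar> ^ 3 / 6)"
            using iexp_approx1[of s 2] l0 by (intro mult_left_mono) (simp_all add: eval_nat_numeral)
          also have "\<bar>s\<bar> ^ 3 = \<bar>t\<bar> ^ 3 / (S n * sqrt (S n))"
            using Sp by (simp add: s_def abs_divide power_divide power3_eq_cube)
          also have "l n * (\<bar>t\<bar> ^ 3 / (S n * sqrt (S n)) / 6) = (l n / S n) * (\<bar>t\<bar> ^ 3 / 6) * inverse (sqrt (S n))"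
            by (simp add: field_simps)
          finally show ?case unfolding s_def .
        qed
        have "(\<lambda>n. (l n / S n) * (\<bar>t\<bar> ^ 3 / 6) * inverse (sqrt (S n))) \<longlonglongrightarrow> v * (\<bar>t\<bar> ^ 3 / 6) * 0"
          by (intro tendsto_mult lS sqS tendsto_const)
        then show "(\<lambda>n. (l n / S n) * (\<bar>t\<bar> ^ 3 / 6) * inverse (sqrt (S n))) \<longlonglongrightarrow> 0" by simp
      qed
      moreover have "(\<lambda>n. complex_of_real (l n / S n * t\<^sup>2 / 2)) \<longlonglongrightarrow> of_real (v * t\<^sup>2 / 2)"
        by (intro tendsto_of_real tendsto_intros lS) simp
      ultimately have "(\<lambda>n. (of_real (l n) * (iexp (t / sqrt (S n)) - 1 - \<i> * of_real (t / sqrt (S n))) + of_real (l n / S n * t\<^sup>2 / 2)) -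
        of_real (l n / S n * t\<^sup>2 / 2)) \<longlonglongrightarrow> 0 - of_real (v * t\<^sup>2 / 2)"
        by (rule tendsto_diff)
      then show ?thesis by simp
    qed
    then have "G \<longlonglongrightarrow> exp (- of_real (v * t\<^sup>2 / 2))" unfolding G_def[abs_def] by (rule tendsto_exp)
    from tendsto_add[OF D this] have "(\<lambda>n. CLINT \<omega>|M. iexp (t * Z n \<omega>)) \<longlonglongrightarrow> of_real (exp (- (v * t\<^sup>2 / 2)))"
      by (simp add: exp_of_real[symmetric])
    moreover have "char (distr M borel (Z n)) t = (CLINT \<omega>|M. iexp (t * Z n \<omega>))" for n
    proof -
      have [measurable]: "\<beta> n \<in> borel_measurable M"
        unfolding \<beta>_def by (rule measurable_betti_cech) (auto intro: X_measurable)
      have "Z n \<in> borel_measurable M" unfolding Z_def by measurable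
      then show ?thesis unfolding char_def by (intro integral_distr) auto
    qed
    ultimately show ?thesis unfolding char_normal_distribution[OF v] Z_def[abs_def] by simp
  qed
  \<comment> \<open>Levy's theorem asks only for a limit distribution with this characteristic
    function, so the point mass at \<open>v = 0\<close> is covered along with the normal
    densities.\<close>
  have "weak_conv_m (\<lambda>n. distr M borel (\<lambda>\<omega>. 1 / sqrt (S n) * (\<beta> n \<omega> - expectation (\<beta> n)))) (normal_distribution 0 v)"
  proof (rule levy_continuity[OF _ real_distribution_normal[OF v] char_lim])
    fix n
    have [measurable]: "\<beta> n \<in> borel_measurable M"
      unfolding \<beta>_def by (rule measurable_betti_cech) (auto intro: X_measurable)
    show "real_distribution (distr M borel (\<lambda>\<omega>. 1 / sqrt (S n) * (\<beta> n \<omega> - expectation (\<beta> n))))"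
      by (rule real_distribution_distr) measurable
  qed
  then show ?thesis unfolding S_def a_def v_def mu .
qed

end
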